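(* Let $\beta>0$, $\gamma>0$, $\eta\in\mathbb{R}$, $N\ge1$ an integer and $f\in(H^1_0(\Lambda))'$. Let $u\in H^1(\Lambda)$ be the (weak) solution of the Dirichlet problem $$-u''+\gamma u=f\ \text{ in }\Lambda,\qquad u(0)=\eta,\qquad \lim_{x\to+\infty}u(x)=0,$$ i.e. $u(0)=\eta$ and $A_{\gamma}(u,v)=(f,v)$ for all $v\in H^1_0(\Lambda)$, and let $u_N\in X^{\beta}_N$ be the solution of the generalized Laguerre spectral scheme: $u_N(0)=\eta$ and $A_{\gamma}(u_N,v_N)=(f,v_N)$ for all $v_N\in X^{0,\beta}_N$. Then $u$ and $u_N$ have the explicit representations $$u(x)=\eta\,\mathcal{S}^{\beta}_0(x)+\sum_{k=1}^{\infty}\hat u_k\,\mathcal{S}^{\beta}_k(x),\qquad u_N(x)=\eta\,\mathcal{S}^{\beta}_{0,N}(x)+\sum_{k=1}^{N}\hat u_k\,\mathcal{S}^{\beta}_k(x),$$ $$\hat u_k=\frac{1}{\varrho_k}A_{\gamma}(u,\mathcal{S}^{\beta}_k)=\frac{(f,\mathcal{S}^{\beta}_k)}{\varrho_k},\qquad k\ge1,$$ where the infinite series converges in $H^1(\Lambda)$.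
   Context: $\Lambda=(0,\infty)$; $(\cdot,\cdot)$ is the $L^2(\Lambda)$ inner product, and $(f,v)$ also denotes the duality pairing between $(H^1_0(\Lambda))'$ and $H^1_0(\Lambda)$. $A_{\gamma}(u,v)=(u',v')+\gamma(u,v)$. With $\mathbb{P}_N$ the real polynomials of degree $\le N$: $X^{\beta}_N=\{e^{-\frac12\beta x}p(x):p\in\mathbb{P}_N\}$ and $X^{0,\beta}_N=\{e^{-\frac12\beta x}p(x):p\in\mathbb{P}_N,\ p(0)=0\}$. For $a\in\mathbb{R}$ let $(a)_n=a(a+1)\cdots(a+n-1)$, $(a)_0=1$; $\mathcal{L}^{\alpha}_k(x)=\sum_{\nu=0}^{k}\frac{(\alpha+\nu+1)_{k-\nu}}{(k-\nu)!\,\nu!}(-x)^{\nu}$ and $l^{\alpha,\beta}_k(x)=e^{-\frac12\beta x}\mathcal{L}^{\alpha}_k(\beta x)$. For $k\ge1$, $\mathcal{S}^{\beta}_k\in X^{0,\beta}_k$ are the functions with $\mathcal{S}^{\beta}_k-l^{-1,\beta}_k\in X^{0,\beta}_{k-1}$ and $A_{\gamma}(\mathcal{S}^{\beta}_k,\mathcal{S}^{\beta}_m)=\varrho_k\delta_{k,m}$ for all $k,m\ge1$. Further, $$\mathcal{S}^{\beta}_0(x)=\sum_{m=0}^{\infty}\frac{(2\sqrt{\gamma}-\beta)^m}{(2\sqrt{\gamma}+\beta)^m}\,l^{-1,\beta}_m(x),$$ $$\mathcal{S}^{\beta}_{0,N}(x)=\sum_{m=0}^{N}\frac{(2\sqrt{\gamma}+\beta)^{2N+2-m}(2\sqrt{\gamma}-\beta)^{m}-(2\sqrt{\gamma}-\beta)^{2N+2-m}(2\sqrt{\gamma}+\beta)^{m}}{(2\sqrt{\gamma}+\beta)^{2N+2}-(2\sqrt{\gamma}-\beta)^{2N+2}}\,l^{-1,\beta}_m(x)$$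 (with the convention $0^0=1$). $\mathcal{S}^{\beta}_0$ takes the value $1$ at $0$ and is $A_\gamma$-orthogonal to $H^1_0(\Lambda)$; $\mathcal{S}^{\beta}_{0,N}\in X^{\beta}_N$ takes the value $1$ at $0$ and is $A_\gamma$-orthogonal to $X^{0,\beta}_N$. *)

theory Defs
  imports "HOL-Analysis.Analysis" "HOL-Computational_Algebra.Polynomial"
begin

text \<open>
  Square-integrable and Sobolev functions on the half line are represented by total functions
  \<^typ>\<open>real \<Rightarrow> real\<close> and their values outside the half line are irrelevant. The notions for \<open>L2\<close>,
  \<open>H1\<close> and \<open>H10\<close> depend only on the class of a function modulo equality almost everywhere on the
  half line; test functions and the spaces of Laguerre functions consist of concrete functions.
\<close>

abbreviation half_line :: "real measure" where
  "half_line \<equiv> lebesgue_on {0<..}"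

definition L2 :: "(real \<Rightarrow> real) set" where
  "L2 = {u. u \<in> borel_measurable half_line \<and> integrable half_line (\<lambda>x. (u x)\<^sup>2)}"

definition L2_inner :: "(real \<Rightarrow> real) \<Rightarrow> (real \<Rightarrow> real) \<Rightarrow> real" where
  "L2_inner u v = (LINT x|half_line. u x * v x)"

definition test_functions :: "(real \<Rightarrow> real) set" where
  "test_functions = {\<phi>. (\<forall>n. (deriv ^^ n) \<phi> differentiable_on UNIV) \<and>
     (\<exists>K. compact K \<and> K \<subseteq> {0<..} \<and> (\<forall>x. x \<notin> K \<longrightarrow> \<phi> x = 0))}"

definition has_weak_deriv :: "(real \<Rightarrow> real) \<Rightarrow> (real \<Rightarrow> real) \<Rightarrow> bool" where
  "has_weak_deriv u g \<longleftrightarrow>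
     (\<forall>\<phi>\<in>test_functions. L2_inner u (deriv \<phi>) = - L2_inner g \<phi>)"

definition H1 :: "(real \<Rightarrow> real) set" where
  "H1 = {u \<in> L2. \<exists>g\<in>L2. has_weak_deriv u g}"

text \<open>The weak derivative of an element of \<^const>\<open>H1\<close>, determined up to a null set.\<close>

definition weak_deriv :: "(real \<Rightarrow> real) \<Rightarrow> real \<Rightarrow> real" where
  "weak_deriv u = (SOME g. g \<in> L2 \<and> has_weak_deriv u g)"

definition H1_norm :: "(real \<Rightarrow> real) \<Rightarrow> real" where
  "H1_norm u = sqrt (L2_inner (weak_deriv u) (weak_deriv u) + L2_inner u u)"

text \<open>The closure of the test functions in \<^const>\<open>H1\<close>.\<close>

definition H10 :: "(real \<Rightarrow> real) set" where
  "H10 = {v \<in> H1. \<forall>e>0. \<exists>\<phi>\<in>test_functions. H1_norm (\<lambda>x. v x - \<phi> x) < e}"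

text \<open>
  The bounded linear functionals on \<^const>\<open>H10\<close>. Boundedness and linearity make the value of such a
  functional independent of the representative.
\<close>

definition H10_dual :: "((real \<Rightarrow> real) \<Rightarrow> real) set" where
  "H10_dual = {f.
     (\<forall>v\<in>H10. \<forall>w\<in>H10. f (\<lambda>x. v x + w x) = f v + f w) \<and>
     (\<forall>c. \<forall>v\<in>H10. f (\<lambda>x. c * v x) = c * f v) \<and>
     (\<exists>C. \<forall>v\<in>H10. \<bar>f v\<bar> \<le> C * H1_norm v)}"

text \<open>
  The representative of an element of \<^const>\<open>H1\<close> that is continuous up to the boundary point 0. Its values on
  \<^term>\<open>{0..} :: real set\<close> are uniquely determined; they give pointwise evaluation, in particular at 0, a meaning.
\<close>

definition cont_rep :: "(real \<Rightarrow> real) \<Rightarrow> real \<Rightarrow> real" where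
  "cont_rep u = (SOME v. continuous_on {0..} v \<and> (AE x in half_line. u x = v x))"

definition H1_tendsto :: "(nat \<Rightarrow> real \<Rightarrow> real) \<Rightarrow> (real \<Rightarrow> real) \<Rightarrow> bool" where
  "H1_tendsto w u \<longleftrightarrow> (\<forall>n. w n \<in> H1) \<and> u \<in> H1 \<and>
     (\<lambda>n. H1_norm (\<lambda>x. w n x - u x)) \<longlonglongrightarrow> 0"

definition A_form :: "real \<Rightarrow> (real \<Rightarrow> real) \<Rightarrow> (real \<Rightarrow> real) \<Rightarrow> real" where
  "A_form \<gamma> u v = L2_inner (weak_deriv u) (weak_deriv v) + \<gamma> * L2_inner u v"

definition X_space :: "real \<Rightarrow> nat \<Rightarrow> (real \<Rightarrow> real) set" where
  "X_space \<beta> N = {\<lambda>x. exp (- (1/2) * \<beta> * x) * poly p x | p. degree p \<le> N}"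

definition X0_space :: "real \<Rightarrow> nat \<Rightarrow> (real \<Rightarrow> real) set" where
  "X0_space \<beta> N = {\<lambda>x. exp (- (1/2) * \<beta> * x) * poly p x | p. degree p \<le> N \<and> poly p 0 = 0}"

definition laguerre :: "real \<Rightarrow> nat \<Rightarrow> real \<Rightarrow> real" where
  "laguerre \<alpha> k x =
     (\<Sum>\<nu>\<le>k. pochhammer (\<alpha> + real \<nu> + 1) (k - \<nu>) / (fact (k - \<nu>) * fact \<nu>) * (- x) ^ \<nu>)"

definition laguerre_fun :: "real \<Rightarrow> real \<Rightarrow> nat \<Rightarrow> real \<Rightarrow> real" where
  "laguerre_fun \<alpha> \<beta> k x = exp (- (1/2) * \<beta> * x) * laguerre \<alpha> k (\<beta> * x)"

text \<open>
  The Sobolev-orthogonal functions \<open>S k\<close> for \<open>k \<ge> 1\<close> with \<open>\<rho> k = A_form \<gamma> (S k) (S k)\<close>; nothing is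
  required of \<open>S 0\<close> and \<open>\<rho> 0\<close>.
\<close>

definition sobolev_orthogonal ::
    "real \<Rightarrow> real \<Rightarrow> (nat \<Rightarrow> real \<Rightarrow> real) \<Rightarrow> (nat \<Rightarrow> real) \<Rightarrow> bool" where
  "sobolev_orthogonal \<beta> \<gamma> S \<rho> \<longleftrightarrow>
     (\<forall>k\<ge>1. S k \<in> X0_space \<beta> k \<and>
        (\<lambda>x. S k x - laguerre_fun (-1) \<beta> k x) \<in> X0_space \<beta> (k - 1)) \<and>
     (\<forall>k\<ge>1. \<forall>m\<ge>1. A_form \<gamma> (S k) (S m) = (if k = m then \<rho> k else 0))"

definition S0 :: "real \<Rightarrow> real \<Rightarrow> real \<Rightarrow> real" where
  "S0 \<beta> \<gamma> x = (\<Sum>m. (2 * sqrt \<gamma> - \<beta>) ^ m / (2 * sqrt \<gamma> + \<beta>) ^ m * laguerre_fun (-1) \<beta> m x)"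

definition S0N :: "real \<Rightarrow> real \<Rightarrow> nat \<Rightarrow> real \<Rightarrow> real" where
  "S0N \<beta> \<gamma> N x = (\<Sum>m\<le>N.
     ((2 * sqrt \<gamma> + \<beta>) ^ (2 * N + 2 - m) * (2 * sqrt \<gamma> - \<beta>) ^ m
       - (2 * sqrt \<gamma> - \<beta>) ^ (2 * N + 2 - m) * (2 * sqrt \<gamma> + \<beta>) ^ m)
     / ((2 * sqrt \<gamma> + \<beta>) ^ (2 * N + 2) - (2 * sqrt \<gamma> - \<beta>) ^ (2 * N + 2))
     * laguerre_fun (-1) \<beta> m x)"

text \<open>
  The weak solution of \<open>- u'' + \<gamma> u = f\<close> with \<open>u(0) = \<eta>\<close>. Decay at infinity is part of membership
  in \<^const>\<open>H1\<close>.
\<close>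

definition weak_solution ::
    "real \<Rightarrow> real \<Rightarrow> ((real \<Rightarrow> real) \<Rightarrow> real) \<Rightarrow> (real \<Rightarrow> real) \<Rightarrow> bool" where
  "weak_solution \<gamma> \<eta> f u \<longleftrightarrow>
     u \<in> H1 \<and> cont_rep u 0 = \<eta> \<and> (\<forall>v\<in>H10. A_form \<gamma> u v = f v)"

definition spectral_solution ::
    "real \<Rightarrow> real \<Rightarrow> real \<Rightarrow> ((real \<Rightarrow> real) \<Rightarrow> real) \<Rightarrow> nat \<Rightarrow> (real \<Rightarrow> real) \<Rightarrow> bool" where
  "spectral_solution \<beta> \<gamma> \<eta> f N w \<longleftrightarrow>
     w \<in> X_space \<beta> N \<and> w 0 = \<eta> \<and> (\<forall>v\<in>X0_space \<beta> N. A_form \<gamma> w v = f v)"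

end

theory Submission imports Defs begin

text \<open>
  Subtracting \<open>\<eta> S0\<close> from the solution reduces both expansions to orthogonal projections. By the
  generating function of the Laguerre polynomials, \<open>S0\<close> is just \<open>x \<mapsto> exp (- sqrt \<gamma> x)\<close>
  (theorem \<open>S0_eq_exp\<close>), the decaying solution of \<open>- S'' + \<gamma> S = 0\<close>. It takes the value 1 at 0 and is
  \<open>A_form\<close>-orthogonal to every weighted polynomial that vanishes at 0 (\<open>A_form_S0\<close>). So \<open>w = u - \<eta> S0\<close> lies
  in \<open>H1\<close>, its continuous representative vanishes at 0, and its Fourier coefficients with respect to the
  orthogonal system \<open>S k\<close> are the numbers \<open>uhat k\<close>. Since \<open>S k\<close> has exact polynomial degree \<open>k\<close>, the
  functions \<open>S 1, ..., S n\<close> span \<open>X0_space \<beta> n\<close>, so the partial sums are the best approximations of \<open>w\<close>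
  from these spaces in the energy norm. Convergence in \<open>H1\<close> therefore follows from the density of the weighted
  polynomials \<open>exp (- \<beta> x / 2) p x\<close> with \<open>p 0 = 0\<close> among the \<open>H1\<close> functions with trace 0
  (\<open>h1_pair_expoly_approximation\<close>). Pointwise convergence follows because the \<open>H1\<close> norm controls the
  continuous representative of a function with trace 0 (\<open>h1_pair_pointwise_bound\<close>).

  The density statement is brought down to \<open>L2\<close> by the first-order operator \<open>z \<mapsto> z' + a z\<close> with
  \<open>a = \<beta> / 2\<close>. On functions with trace 0 the \<open>L2\<close> norm of \<open>z' + a z\<close> controls the \<open>H1\<close> norm of \<open>z\<close>,
  because the integral of the cross term \<open>2 z z'\<close> is a limit of squares, and the operator maps \<open>exp (- a x) p x\<close> to
  \<open>exp (- a x) p' x\<close>, whose range is all weighted polynomials. These are dense in \<open>L2\<close> (\<open>expoly_dense\<close>):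
  multiplication by a Taylor polynomial of \<open>exp (- c x)\<close> with \<open>c < b\<close> shows that the closure for the rate
  \<open>b\<close> contains the weighted polynomials for the rate \<open>b + c\<close>, hence after iteration all polynomials in
  \<open>t = exp (- c x)\<close> divisible by \<open>t\<^sup>2\<close>, and for those the theorem of Weierstrass applies.

  The same density result carries the theory of weak derivatives. Smooth cutoffs show that
  \<open>exp (- b x) p x\<close> with \<open>p 0 = 0\<close> is a limit of test functions (\<open>expoly_test_function_approximation\<close>);
  afterwards weighted polynomials themselves serve as test functions, which gives uniqueness of weak
  derivatives and shows that a function in \<open>H1\<close> is a primitive of its weak derivative
  (\<open>weak_deriv_imp_primitive\<close>).

  The discrete boundary function \<open>S0N\<close> is treated by algebra. In the basis of the functions
  \<open>laguerre_fun (-1) \<beta> m\<close> the bilinear form is tridiagonal with constant diagonals apart from the first entry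
  (\<open>energy_lag_neg1\<close>), and the coefficients of \<open>S0N\<close> solve the resulting three-term recurrence with the value 0
  at the index \<open>N + 1\<close>. So \<open>S0N\<close> is orthogonal to \<open>X0_space \<beta> N\<close>, and comparing coefficients of
  \<open>u\<^sub>N - \<eta> S0N\<close> gives the second expansion.
\<close>

section \<open>Square-integrable functions on the half line\<close>

abbreviation L2_sqdist :: "(real \<Rightarrow> real) \<Rightarrow> (real \<Rightarrow> real) \<Rightarrow> real" where
  "L2_sqdist u v \<equiv> L2_inner (\<lambda>x. u x - v x) (\<lambda>x. u x - v x)"

lemma AE_half_lineI: "(\<And>x. x > 0 \<Longrightarrow> P x) \<Longrightarrow> AE x in half_line. P x"
  by (rule AE_I2) simp

lemma continuous_on_interval_bounded:
  fixes h :: "real \<Rightarrow> real"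
  assumes "continuous_on {a..b} h"
  obtains C where "\<And>x. x \<in> {a..b} \<Longrightarrow> \<bar>h x\<bar> \<le> C"
proof -
  have "bounded (h ` {a..b})"
    using assms by (intro compact_imp_bounded compact_continuous_image) auto
  then show ?thesis
    using that unfolding bounded_iff by (metis image_eqI real_norm_def)
qed

lemma L2_measurable: "u \<in> L2 \<Longrightarrow> u \<in> borel_measurable half_line"
  by (simp add: L2_def)

lemma L2_square_integrable: "u \<in> L2 \<Longrightarrow> integrable half_line (\<lambda>x. (u x)\<^sup>2)"
  by (simp add: L2_def)

lemma L2_mult_integrable:
  assumes "u \<in> L2" "v \<in> L2"
  shows "integrable half_line (\<lambda>x. u x * v x)"
proof (rule Bochner_Integration.integrable_bound)
  show "integrable half_line (\<lambda>x. (u x)\<^sup>2 + (v x)\<^sup>2)"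
    using assms by (auto simp: L2_def)
  show "(\<lambda>x. u x * v x) \<in> borel_measurable half_line"
    using assms by (auto simp: L2_def)
  have "\<bar>a * b\<bar> \<le> a\<^sup>2 + b\<^sup>2" for a b :: real
    using sum_squares_bound[of a b] sum_squares_bound[of a "-b"] zero_le_power2[of a] zero_le_power2[of b]
    by (simp add: abs_if)
  then show "AE x in half_line. norm (u x * v x) \<le> norm ((u x)\<^sup>2 + (v x)\<^sup>2)"
    by auto
qed

lemma L2_bound:
  assumes "w \<in> L2" "u \<in> borel_measurable half_line" "AE x in half_line. \<bar>u x\<bar> \<le> \<bar>w x\<bar>"
  shows "u \<in> L2"
proof -
  have "integrable half_line (\<lambda>x. (u x)\<^sup>2)"
  proof (rule Bochner_Integration.integrable_bound)
    show "integrable half_line (\<lambda>x. (w x)\<^sup>2)" using assms by (simp add: L2_def)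
    show "(\<lambda>x. (u x)\<^sup>2) \<in> borel_measurable half_line" using assms by auto
    show "AE x in half_line. norm ((u x)\<^sup>2) \<le> norm ((w x)\<^sup>2)"
      using assms(3) by eventually_elim (simp add: abs_le_square_iff)
  qed
  then show ?thesis using assms by (simp add: L2_def)
qed

lemma L2_cong_AE:
  assumes "w \<in> L2" "u \<in> borel_measurable half_line" "AE x in half_line. u x = w x"
  shows "u \<in> L2"
  by (rule L2_bound[OF assms(1,2)]) (use assms(3) in \<open>eventually_elim, simp\<close>)

lemma L2_cmult: "u \<in> L2 \<Longrightarrow> (\<lambda>x. c * u x) \<in> L2"
  by (auto simp: L2_def power_mult_distrib)

lemma L2_add:
  assumes "u \<in> L2" "v \<in> L2" shows "(\<lambda>x. u x + v x) \<in> L2"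
proof -
  have "integrable half_line (\<lambda>x. (u x)\<^sup>2 + (v x)\<^sup>2 + 2 * (u x * v x))"
    using assms L2_mult_integrable[OF assms] by (auto simp: L2_def)
  then show ?thesis using assms by (auto simp: L2_def power2_sum mult.assoc)
qed

lemma L2_uminus: "u \<in> L2 \<Longrightarrow> (\<lambda>x. - u x) \<in> L2"
  using L2_cmult[of u "-1"] by simp

lemma L2_diff: "u \<in> L2 \<Longrightarrow> v \<in> L2 \<Longrightarrow> (\<lambda>x. u x - v x) \<in> L2"
  using L2_add[OF _ L2_uminus] by simp

lemma L2_zero: "(\<lambda>x. 0) \<in> L2"
  by (simp add: L2_def)

lemma L2_sum:
  assumes "\<And>i. i \<in> I \<Longrightarrow> u i \<in> L2" shows "(\<lambda>x. \<Sum>i\<in>I. u i x) \<in> L2"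
  using assms by (induction I rule: infinite_finite_induct) (auto intro: L2_zero L2_add)

lemma L2_inner_commute: "L2_inner u v = L2_inner v u"
  by (simp add: L2_inner_def mult.commute)

lemma L2_inner_add_left:
  assumes "u \<in> L2" "v \<in> L2" "w \<in> L2"
  shows "L2_inner (\<lambda>x. u x + v x) w = L2_inner u w + L2_inner v w"
  using L2_mult_integrable[OF assms(1,3)] L2_mult_integrable[OF assms(2,3)]
  by (simp add: L2_inner_def distrib_right)

lemma L2_inner_cmult_left: "L2_inner (\<lambda>x. c * u x) w = c * L2_inner u w"
  by (simp add: L2_inner_def mult.assoc)

lemma L2_inner_add_right:
  assumes "u \<in> L2" "v \<in> L2" "w \<in> L2"
  shows "L2_inner w (\<lambda>x. u x + v x) = L2_inner w u + L2_inner w v"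
  using L2_inner_add_left[OF assms] by (simp add: L2_inner_commute)

lemma L2_inner_cmult_right: "L2_inner u (\<lambda>x. c * w x) = c * L2_inner u w"
  using L2_inner_cmult_left[of c w u] by (simp add: L2_inner_commute)

lemma L2_inner_diff_left:
  assumes "u \<in> L2" "v \<in> L2" "w \<in> L2"
  shows "L2_inner (\<lambda>x. u x - v x) w = L2_inner u w - L2_inner v w"
  using L2_mult_integrable[OF assms(1,3)] L2_mult_integrable[OF assms(2,3)]
  by (simp add: L2_inner_def left_diff_distrib)

lemma L2_inner_diff_right:
  assumes "u \<in> L2" "v \<in> L2" "w \<in> L2"
  shows "L2_inner w (\<lambda>x. u x - v x) = L2_inner w u - L2_inner w v"
  using L2_inner_diff_left[OF assms] by (simp add: L2_inner_commute)

lemma L2_inner_self_nonneg: "0 \<le> L2_inner u u"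
  by (simp add: L2_inner_def)

lemma L2_inner_cong_AE:
  assumes "AE x in half_line. u x = u' x" "AE x in half_line. v x = v' x"
    and "u \<in> borel_measurable half_line" "u' \<in> borel_measurable half_line"
    and "v \<in> borel_measurable half_line" "v' \<in> borel_measurable half_line"
  shows "L2_inner u v = L2_inner u' v'"
  unfolding L2_inner_def
proof (rule integral_cong_AE)
  show "AE x in half_line. u x * v x = u' x * v' x"
    using assms(1,2) by eventually_elim simp
qed (use assms in auto)

lemma L2_inner_self_eq_0:
  assumes "u \<in> L2" "L2_inner u u = 0" shows "AE x in half_line. u x = 0"
proof -
  have "AE x in half_line. u x * u x = 0"
    using assms L2_mult_integrable[OF assms(1,1)]
    by (subst integral_nonneg_eq_0_iff_AE[symmetric]) (auto simp: L2_inner_def)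
  then show ?thesis by simp
qed

lemma L2_inner_self_add:
  assumes "u \<in> L2" "v \<in> L2"
  shows "L2_inner (\<lambda>x. u x + v x) (\<lambda>x. u x + v x) = L2_inner u u + 2 * L2_inner u v + L2_inner v v"
  using assms by (simp add: L2_inner_add_left L2_inner_add_right L2_add L2_inner_commute[of v u])

lemma L2_inner_self_diff:
  assumes "u \<in> L2" "v \<in> L2"
  shows "L2_sqdist u v = L2_inner u u - 2 * L2_inner u v + L2_inner v v"
  using assms by (simp add: L2_inner_diff_left L2_inner_diff_right L2_diff L2_inner_commute[of v u])

lemma L2_inner_self_add_le:
  assumes "u \<in> L2" "v \<in> L2"
  shows "L2_inner (\<lambda>x. u x + v x) (\<lambda>x. u x + v x) \<le> 2 * L2_inner u u + 2 * L2_inner v v"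
  using L2_inner_self_add[OF assms] L2_inner_self_diff[OF assms]
    L2_inner_self_nonneg[of "\<lambda>x. u x - v x"] by linarith

lemma L2_Cauchy_Schwarz:
  assumes "u \<in> L2" "v \<in> L2"
  shows "(L2_inner u v)\<^sup>2 \<le> L2_inner u u * L2_inner v v"
proof (cases "L2_inner v v = 0")
  case True
  have v0: "AE x in half_line. v x = 0" by (rule L2_inner_self_eq_0[OF assms(2) True])
  have "L2_inner u v = L2_inner u (\<lambda>x. 0)"
    by (rule L2_inner_cong_AE) (use assms v0 in \<open>auto simp: L2_def\<close>)
  then show ?thesis using True by (simp add: L2_inner_def)
next
  case False
  then have pos: "L2_inner v v > 0" using L2_inner_self_nonneg[of v] by linarith
  \<comment> \<open>the coefficient of the orthogonal projection of \<open>u\<close> onto \<open>v\<close>\<close>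
  define t where "t = L2_inner u v / L2_inner v v"
  have "0 \<le> L2_inner (\<lambda>x. u x - t * v x) (\<lambda>x. u x - t * v x)"
    by (rule L2_inner_self_nonneg)
  also have "\<dots> = L2_inner u u - 2 * t * L2_inner u v + t\<^sup>2 * L2_inner v v"
    using assms by (simp add: L2_inner_self_diff L2_cmult L2_inner_cmult_left L2_inner_cmult_right power2_eq_square)
  also have "\<dots> = L2_inner u u - (L2_inner u v)\<^sup>2 / L2_inner v v"
    using pos by (simp add: t_def power2_eq_square)
  finally show ?thesis using pos by (simp add: field_simps)
qed

lemma L2_dominated_convergence:
  assumes w: "w \<in> L2"
    and h: "h \<in> borel_measurable half_line" and hn: "\<And>n. hn n \<in> borel_measurable half_line"
    and bound: "\<And>n. AE x in half_line. \<bar>hn n x - h x\<bar> \<le> w x"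
    and lim: "AE x in half_line. (\<lambda>n. hn n x) \<longlonglongrightarrow> h x"
  shows "(\<lambda>n. L2_sqdist (hn n) h) \<longlonglongrightarrow> 0"
proof -
  have "(\<lambda>n. LINT x|half_line. (hn n x - h x) * (hn n x - h x)) \<longlonglongrightarrow> (LINT x|half_line. 0)"
  proof (rule integral_dominated_convergence[where w = "\<lambda>x. (w x)\<^sup>2"])
    show "AE x in half_line. (\<lambda>n. (hn n x - h x) * (hn n x - h x)) \<longlonglongrightarrow> 0"
      using lim
    proof eventually_elim
      case (elim x)
      have "(\<lambda>n. (hn n x - h x) * (hn n x - h x)) \<longlonglongrightarrow> (h x - h x) * (h x - h x)"
        by (intro tendsto_intros elim)
      then show ?case by simp
    qed
    show "AE x in half_line. norm ((hn n x - h x) * (hn n x - h x)) \<le> (w x)\<^sup>2" for n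
      using bound[of n]
    proof eventually_elim
      case (elim x)
      then show ?case
        using power_mono[OF elim, of 2] by (simp add: power2_eq_square abs_mult)
    qed
  qed (use w h hn in \<open>auto simp: L2_def\<close>)
  then show ?thesis by (simp add: L2_inner_def)
qed

text \<open>
  Membership in the \<open>L2\<close> closure. Squared distances avoid square roots; the price is the factor 2 in
  \<open>L2_inner_self_add_le\<close>, which replaces the triangle inequality.
\<close>

definition L2_adherent :: "(real \<Rightarrow> real) set \<Rightarrow> (real \<Rightarrow> real) \<Rightarrow> bool" where
  "L2_adherent V h \<longleftrightarrow> (\<forall>e>0. \<exists>v\<in>V. L2_sqdist v h < e)"

lemma L2_adherentI_tendsto:
  assumes "\<And>n. v n \<in> V" "(\<lambda>n. L2_sqdist (v n) h) \<longlonglongrightarrow> 0"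
  shows "L2_adherent V h"
  unfolding L2_adherent_def
proof (intro allI impI)
  fix e :: real assume "e > 0"
  then have "eventually (\<lambda>n. L2_sqdist (v n) h < e) sequentially"
    using assms(2) by (simp add: order_tendsto_iff)
  then show "\<exists>v\<in>V. L2_sqdist v h < e"
    using assms(1) by (auto simp: eventually_sequentially)
qed

lemma L2_adherent_trans:
  assumes "V \<subseteq> L2" "W \<subseteq> L2" "h \<in> L2" "\<And>w. w \<in> W \<Longrightarrow> L2_adherent V w" "L2_adherent W h"
  shows "L2_adherent V h"
  unfolding L2_adherent_def
proof (intro allI impI)
  fix e :: real assume e: "e > 0"
  obtain w where w: "w \<in> W" "L2_sqdist w h < e/4"
    using assms(5) e unfolding L2_adherent_def by (meson divide_pos_pos zero_less_numeral)
  obtain v where v: "v \<in> V" "L2_sqdist v w < e/4"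
    using assms(4)[OF w(1)] e unfolding L2_adherent_def by (meson divide_pos_pos zero_less_numeral)
  have "L2_inner (\<lambda>x. (v x - w x) + (w x - h x)) (\<lambda>x. (v x - w x) + (w x - h x))
      \<le> 2 * L2_sqdist v w + 2 * L2_sqdist w h"
    using v(1) w(1) assms(1-3) by (intro L2_inner_self_add_le L2_diff) auto
  then show "\<exists>v\<in>V. L2_sqdist v h < e"
    using v w by (intro bexI[of _ v]) auto
qed

text \<open>
  Orthogonality passes to the closure by the Cauchy-Schwarz inequality. Applied to \<open>g = h\<close> it turns
  density of \<open>V\<close> into the statement that only null functions are orthogonal to \<open>V\<close>.
\<close>

lemma L2_adherent_orthogonal:
  assumes "V \<subseteq> L2" "h \<in> L2" "g \<in> L2" "L2_adherent V h" "\<And>v. v \<in> V \<Longrightarrow> L2_inner g v = 0"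
  shows "L2_inner g h = 0"
proof -
  have le: "(L2_inner g h)\<^sup>2 \<le> L2_inner g g * e" if e: "e > 0" for e
  proof -
    obtain v where v: "v \<in> V" "L2_sqdist v h < e"
      using assms(4) e unfolding L2_adherent_def by meson
    have "L2_inner g (\<lambda>x. v x - h x) = - L2_inner g h"
      using v assms by (subst L2_inner_diff_right) auto
    then have "(L2_inner g h)\<^sup>2 = (L2_inner g (\<lambda>x. v x - h x))\<^sup>2" by simp
    also have "\<dots> \<le> L2_inner g g * L2_sqdist v h"
      using v assms by (intro L2_Cauchy_Schwarz L2_diff) auto
    also have "\<dots> \<le> L2_inner g g * e"
      using v L2_inner_self_nonneg by (intro mult_left_mono) auto
    finally show ?thesis .
  qed
  have "(L2_inner g h)\<^sup>2 \<le> 0"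
  proof (rule field_le_epsilon)
    fix e :: real assume e: "e > 0"
    have "(L2_inner g h)\<^sup>2 \<le> L2_inner g g * (e / (L2_inner g g + 1))"
      using e L2_inner_self_nonneg[of g] by (intro le) auto
    also have "\<dots> \<le> e"
      using e L2_inner_self_nonneg[of g] by (simp add: field_simps)
    finally show "(L2_inner g h)\<^sup>2 \<le> 0 + e" by simp
  qed
  then show ?thesis by simp
qed

section \<open>Exponentially weighted polynomials\<close>

text \<open>
  The elements of \<open>X_space \<beta> N\<close> have the rate \<open>b = \<beta> / 2\<close>. Other rates occur because products
  add the rates, so that \<open>L2\<close> inner products are integrals of the same kind of function.
\<close>

definition expoly :: "real \<Rightarrow> real poly \<Rightarrow> real \<Rightarrow> real" where
  "expoly b p x = exp (- b * x) * poly p x"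

lemma expoly_add: "expoly b (p + q) x = expoly b p x + expoly b q x"
  and expoly_diff: "expoly b (p - q) x = expoly b p x - expoly b q x"
  and expoly_smult: "expoly b (smult c p) x = c * expoly b p x"
  and expoly_sum: "expoly b (\<Sum>i\<in>I. r i) x = (\<Sum>i\<in>I. expoly b (r i) x)"
  and expoly_mult: "expoly b p x * expoly c q x = expoly (b + c) (p * q) x"
  by (simp_all add: expoly_def algebra_simps poly_sum sum_distrib_left exp_add[symmetric])

lemma power_over_fact_le_exp:
  fixes x :: real assumes "x \<ge> 0" shows "x ^ n / fact n \<le> exp x"
proof -
  have "(\<Sum>i\<in>{n}. x ^ i /\<^sub>R fact i) \<le> (\<Sum>i. x ^ i /\<^sub>R fact i)"
    using assms by (intro sum_le_suminf summable_exp_generic) auto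
  then show ?thesis by (simp add: exp_def divide_inverse mult.commute)
qed

text \<open>
  Each monomial is bounded because \<open>(b x)\<^sup>n / n!\<close> is one term of the series of \<open>exp (b x)\<close>.
\<close>

lemma expoly_bounded:
  assumes "b > 0" obtains K where "K > 0" "\<And>x. x \<ge> 0 \<Longrightarrow> \<bar>expoly b p x\<bar> \<le> K"
proof -
  have mono: "exp (- b * x) * x ^ n \<le> fact n / b ^ n" if x: "x \<ge> 0" for x n
  proof -
    have "(b * x) ^ n / fact n \<le> exp (b * x)"
      using x assms by (intro power_over_fact_le_exp) auto
    then show ?thesis using assms
      by (simp add: field_simps exp_minus power_mult_distrib)
  qed
  define K where "K = (\<Sum>i\<le>degree p. \<bar>coeff p i\<bar> * (fact i / b ^ i))"
  have K: "\<bar>expoly b p x\<bar> \<le> K" if x: "x \<ge> 0" for x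
  proof -
    have "expoly b p x = (\<Sum>i\<le>degree p. coeff p i * (exp (- b * x) * x ^ i))"
      by (simp add: expoly_def poly_altdef sum_distrib_left mult_ac)
    also have "\<bar>\<dots>\<bar> \<le> (\<Sum>i\<le>degree p. \<bar>coeff p i * (exp (- b * x) * x ^ i)\<bar>)"
      by (rule sum_abs)
    also have "\<dots> \<le> K"
      unfolding K_def
    proof (rule sum_mono)
      fix i
      show "\<bar>coeff p i * (exp (- b * x) * x ^ i)\<bar> \<le> \<bar>coeff p i\<bar> * (fact i / b ^ i)"
        using mult_left_mono[OF mono[OF x, of i], of "\<bar>coeff p i\<bar>"] x by (simp add: abs_mult)
    qed
    finally show ?thesis .
  qed
  have "K \<ge> 0" using K[of 0] by linarith
  then show ?thesis using K by (intro that[of "K + 1"]) (auto simp: add_increasing2)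
qed

lemma continuous_imp_measurable_half_line:
  "continuous_on {0<..} h \<Longrightarrow> h \<in> borel_measurable half_line"
  by (rule continuous_imp_measurable_on_sets_lebesgue) auto

lemma expoly_continuous: "continuous_on S (expoly b p)"
  unfolding expoly_def by (intro continuous_intros)

lemma expoly_measurable: "expoly b p \<in> borel_measurable half_line"
  by (intro continuous_imp_measurable_half_line expoly_continuous)

lemma exp_integrable:
  assumes "b > 0" shows "integrable half_line (\<lambda>x. exp (- b * x))"
proof -
  have "(\<lambda>x. exp (- b * x)) absolutely_integrable_on {0..}"
    using integrable_on_exp_minus_to_infinity[OF assms, of 0]
    by (intro nonnegative_absolutely_integrable_1) auto
  then have "(\<lambda>x. exp (- b * x)) absolutely_integrable_on {0<..}"
    by (rule set_integrable_subset) auto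
  then show ?thesis
    by (simp add: integrable_restrict_space set_integrable_def)
qed

text \<open>
  Half of the exponential weight absorbs the polynomial, the other half is integrable.
\<close>

lemma expoly_integrable:
  assumes "b > 0" shows "integrable half_line (expoly b p)"
proof -
  obtain K where K: "K > 0" "\<And>x. x \<ge> 0 \<Longrightarrow> \<bar>expoly (b/2) p x\<bar> \<le> K"
    using expoly_bounded[of "b/2" p] assms by auto
  show ?thesis
  proof (rule Bochner_Integration.integrable_bound)
    show "integrable half_line (\<lambda>x. K * exp (- (b/2) * x))"
      using exp_integrable[of "b/2"] assms by simp
    show "AE x in half_line. norm (expoly b p x) \<le> norm (K * exp (- (b/2) * x))"
    proof (rule AE_half_lineI)
      fix x :: real assume x: "x > 0"
      have "expoly b p x = exp (- (b/2) * x) * expoly (b/2) p x"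
        by (simp add: expoly_def exp_add[symmetric] mult.assoc[symmetric])
      then show "norm (expoly b p x) \<le> norm (K * exp (- (b/2) * x))"
        using K(2)[of x] K(1) x by (simp add: abs_mult mult.commute mult_left_mono)
    qed
  qed (rule expoly_measurable)
qed

lemma expoly_L2:
  assumes "b > 0" shows "expoly b p \<in> L2"
proof -
  have "(expoly b p x)\<^sup>2 = expoly (b + b) (p * p) x" for x
    by (simp add: power2_eq_square expoly_mult)
  then show ?thesis
    using expoly_integrable[of "b + b" "p * p"] expoly_measurable assms
    by (simp add: L2_def)
qed

section \<open>Density of the weighted polynomials\<close>

lemma L2_adherent_add:
  assumes "V \<subseteq> L2" "h \<in> L2" "k \<in> L2" "L2_adherent V h" "L2_adherent V k"
    and "\<And>v w. v \<in> V \<Longrightarrow> w \<in> V \<Longrightarrow> (\<lambda>x. v x + w x) \<in> V"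
  shows "L2_adherent V (\<lambda>x. h x + k x)"
  unfolding L2_adherent_def
proof (intro allI impI)
  fix e :: real assume e: "e > 0"
  obtain v where v: "v \<in> V" "L2_sqdist v h < e/4"
    using assms(4) e unfolding L2_adherent_def by (meson divide_pos_pos zero_less_numeral)
  obtain w where w: "w \<in> V" "L2_sqdist w k < e/4"
    using assms(5) e unfolding L2_adherent_def by (meson divide_pos_pos zero_less_numeral)
  have "L2_inner (\<lambda>x. (v x - h x) + (w x - k x)) (\<lambda>x. (v x - h x) + (w x - k x))
      \<le> 2 * L2_sqdist v h + 2 * L2_sqdist w k"
    using v(1) w(1) assms(1-3) by (intro L2_inner_self_add_le L2_diff) auto
  then show "\<exists>z\<in>V. L2_inner (\<lambda>x. z x - (h x + k x)) (\<lambda>x. z x - (h x + k x)) < e"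
    using v w assms(6) by (intro bexI[of _ "\<lambda>x. v x + w x"]) (auto simp: algebra_simps)
qed

lemma L2_adherent_cmult:
  assumes "L2_adherent V h" and "\<And>c v. v \<in> V \<Longrightarrow> (\<lambda>x. c * v x) \<in> V"
  shows "L2_adherent V (\<lambda>x. c * h x)"
  unfolding L2_adherent_def
proof (intro allI impI)
  fix e :: real assume e: "e > 0"
  have pos: "c\<^sup>2 + 1 > 0" by (simp add: add_nonneg_pos)
  obtain v where v: "v \<in> V" "L2_sqdist v h < e / (c\<^sup>2 + 1)"
    using assms(1) e pos unfolding L2_adherent_def by (meson divide_pos_pos)
  have "L2_inner (\<lambda>x. c * v x - c * h x) (\<lambda>x. c * v x - c * h x)
      = c\<^sup>2 * L2_sqdist v h"
    using L2_inner_cmult_left[of c "\<lambda>x. v x - h x" "\<lambda>x. c * (v x - h x)"]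
      L2_inner_cmult_right[of "\<lambda>x. v x - h x" c "\<lambda>x. v x - h x"]
    by (simp add: right_diff_distrib power2_eq_square)
  also have "\<dots> \<le> (c\<^sup>2 + 1) * L2_sqdist v h"
    using L2_inner_self_nonneg by (intro mult_right_mono) auto
  also have "\<dots> < e" using v(2) pos by (simp add: field_simps)
  finally show "\<exists>z\<in>V. L2_inner (\<lambda>x. z x - c * h x) (\<lambda>x. z x - c * h x) < e"
    using v(1) assms(2) by (intro bexI[of _ "\<lambda>x. c * v x"]) auto
qed

lemma L2_adherent_self: "v \<in> V \<Longrightarrow> L2_adherent V v"
  unfolding L2_adherent_def by (auto simp: L2_inner_def intro!: bexI[of _ v])

definition exp_taylor :: "real \<Rightarrow> nat \<Rightarrow> real poly" where
  "exp_taylor c M = (\<Sum>i<M. monom ((- c) ^ i / fact i) i)"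

lemma poly_exp_taylor: "poly (exp_taylor c M) x = (\<Sum>i<M. (- c * x) ^ i /\<^sub>R fact i)"
proof -
  have "(- c) ^ i / fact i * x ^ i = (- c * x) ^ i /\<^sub>R fact i" for i
    unfolding power_mult_distrib by (simp add: field_simps)
  then show ?thesis by (simp add: exp_taylor_def poly_sum poly_monom)
qed

lemma expoly_shift: "expoly (b + c) p x = expoly b p x * exp (- c * x)"
proof -
  have "exp (- (b + c) * x) = exp (- b * x) * exp (- c * x)"
    by (subst exp_add[symmetric]) (simp add: algebra_simps)
  then show ?thesis by (simp add: expoly_def)
qed

lemma exp_taylor_tendsto: "(\<lambda>M. poly (exp_taylor c M) x) \<longlonglongrightarrow> exp (- c * x)"
  unfolding poly_exp_taylor exp_def by (intro summable_LIMSEQ summable_exp_generic)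

lemma exp_taylor_bound:
  assumes "c \<ge> 0" "x \<ge> 0" shows "\<bar>poly (exp_taylor c M) x\<bar> \<le> exp (c * x)"
proof -
  have "\<bar>poly (exp_taylor c M) x\<bar> \<le> (\<Sum>i<M. \<bar>(- c * x) ^ i /\<^sub>R fact i\<bar>)"
    unfolding poly_exp_taylor by (rule sum_abs)
  also have "\<dots> = (\<Sum>i<M. (c * x) ^ i /\<^sub>R fact i)"
    using assms by (intro sum.cong) (auto simp: abs_mult power_abs)
  also have "\<dots> \<le> exp (c * x)"
    unfolding exp_def using assms by (intro sum_le_suminf summable_exp_generic) auto
  finally show ?thesis .
qed

text \<open>
  The weighted polynomial \<open>exp (- b x) p x\<close> times the Taylor polynomials of \<open>exp (- c x)\<close> converges pointwise
  to the weighted polynomial for the rate \<open>b + c\<close>. All these Taylor polynomials are bounded by \<open>exp (c x)\<close>, so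
  the rate \<open>b - c > 0\<close> remains for a square-integrable majorant.
\<close>

lemma expoly_shift_adherent:
  assumes "0 < c" "c < b"
  shows "L2_adherent (range (expoly b)) (expoly (b + c) p)"
proof (rule L2_adherentI_tendsto)
  show "(\<lambda>M. L2_sqdist (expoly b (p * exp_taylor c M)) (expoly (b + c) p)) \<longlonglongrightarrow> 0"
  proof (rule L2_dominated_convergence[where w = "\<lambda>x. 2 * \<bar>expoly (b - c) p x\<bar>"])
    have "(\<lambda>x. 2 * expoly (b - c) p x) \<in> L2"
      using assms by (intro L2_cmult expoly_L2) auto
    then show "(\<lambda>x. 2 * \<bar>expoly (b - c) p x\<bar>) \<in> L2"
      by (rule L2_bound) (use expoly_measurable[of "b - c" p] in auto)
    show "AE x in half_line. \<bar>expoly b (p * exp_taylor c M) x - expoly (b + c) p x\<bar>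
        \<le> 2 * \<bar>expoly (b - c) p x\<bar>" for M
    proof (rule AE_half_lineI)
      fix x :: real assume x: "x > 0"
      have 1: "expoly b (p * exp_taylor c M) x - expoly (b + c) p x
          = expoly b p x * (poly (exp_taylor c M) x - exp (- c * x))"
        unfolding expoly_shift by (simp add: expoly_def right_diff_distrib)
      have "exp (- c * x) \<le> exp (c * x)" using x assms by simp
      then have "\<bar>poly (exp_taylor c M) x - exp (- c * x)\<bar> \<le> 2 * exp (c * x)"
        using exp_taylor_bound[of c x M] x assms by (smt (verit) exp_gt_zero)
      then have "\<bar>expoly b p x\<bar> * \<bar>poly (exp_taylor c M) x - exp (- c * x)\<bar>
          \<le> \<bar>expoly b p x\<bar> * (2 * exp (c * x))"
        by (intro mult_left_mono) auto
      also have "\<dots> = 2 * \<bar>expoly (b - c) p x\<bar>"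
        using expoly_shift[of "b - c" c p x] by (simp add: abs_mult exp_minus)
      finally show "\<bar>expoly b (p * exp_taylor c M) x - expoly (b + c) p x\<bar>
          \<le> 2 * \<bar>expoly (b - c) p x\<bar>"
        unfolding 1 abs_mult .
    qed
    show "AE x in half_line. (\<lambda>M. expoly b (p * exp_taylor c M) x) \<longlonglongrightarrow> expoly (b + c) p x"
    proof (rule AE_I2)
      fix x
      have "(\<lambda>M. expoly b p x * poly (exp_taylor c M) x) \<longlonglongrightarrow> expoly b p x * exp (- c * x)"
        by (intro tendsto_intros exp_taylor_tendsto)
      then show "(\<lambda>M. expoly b (p * exp_taylor c M) x) \<longlonglongrightarrow> expoly (b + c) p x"
        unfolding expoly_shift by (simp add: expoly_def mult.assoc)
    qed
  qed (auto intro: expoly_measurable)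
qed auto

lemma expoly_shift_iterate_adherent:
  assumes "0 < c" "c < b"
  shows "L2_adherent (range (expoly b)) (expoly (b + real k * c) p)"
proof (induction k arbitrary: p)
  case 0
  then show ?case by (auto intro: L2_adherent_self)
next
  case (Suc k)
  have "L2_adherent (range (expoly b)) (expoly ((b + real k * c) + c) p)"
  proof (rule L2_adherent_trans[where W = "range (expoly (b + real k * c))"])
    show "L2_adherent (range (expoly (b + real k * c))) (expoly (b + real k * c + c) p)"
      using assms by (intro expoly_shift_adherent) (auto simp: add.commute[of b] intro: add_nonneg_pos[THEN less_le_trans] add_increasing less_le_trans[of c b])
  qed (use Suc assms in \<open>auto intro!: expoly_L2 simp: add_pos_nonneg\<close>)
  then show ?case by (simp add: algebra_simps)
qed

text \<open>
  Polynomials in \<open>t = exp (- c x)\<close> that are divisible by \<open>t\<^sup>2\<close>. The factor \<open>t\<^sup>2\<close> makes the lowest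
  rate \<open>2 c\<close>, which exceeds the step width \<open>c\<close> of \<open>expoly_shift_adherent\<close>, and it turns uniform approximation
  in \<open>t\<close> into approximation in \<open>L2\<close>.
\<close>

definition exp_polynomials :: "real \<Rightarrow> (real \<Rightarrow> real) set" where
  "exp_polynomials c = {\<lambda>x. exp (- (2 * c) * x) * poly q (exp (- c * x)) | q. True}"

lemma exp_polynomial_eq_sum:
  "exp (- (2 * c) * x) * poly q (exp (- c * x)) = (\<Sum>i\<le>degree q. coeff q i * expoly (2 * c + real i * c) 1 x)"
proof -
  have "exp (- c * x) ^ i = exp (- (real i * c) * x)" for i
    by (subst exp_of_nat_mult[symmetric]) (simp add: mult.assoc)
  then show ?thesis
    unfolding expoly_shift poly_altdef sum_distrib_left
    by (intro sum.cong) (simp_all add: expoly_def mult_ac)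
qed

lemma exp_polynomials_L2: "c > 0 \<Longrightarrow> exp_polynomials c \<subseteq> L2"
  unfolding exp_polynomials_def exp_polynomial_eq_sum
  by (auto intro!: L2_sum L2_cmult expoly_L2 simp: add_pos_nonneg)

lemma exp_polynomial_adherent:
  assumes "c > 0" "w \<in> exp_polynomials c"
  shows "L2_adherent (range (expoly (2 * c))) w"
proof -
  let ?V = "range (expoly (2 * c))"
  have add: "(\<lambda>x. v x + w x) \<in> ?V" if vw: "v \<in> ?V" "w \<in> ?V" for v w
  proof -
    obtain p q where "v = expoly (2 * c) p" "w = expoly (2 * c) q" using vw by auto
    then show ?thesis by (intro image_eqI[of _ _ "p + q"]) (auto simp: expoly_add)
  qed
  have scale: "(\<lambda>x. a * v x) \<in> ?V" if v: "v \<in> ?V" for v a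
  proof -
    obtain p where "v = expoly (2 * c) p" using v by auto
    then show ?thesis by (intro image_eqI[of _ _ "smult a p"]) (auto simp: expoly_smult)
  qed
  have V: "?V \<subseteq> L2" using assms by (auto intro!: expoly_L2)
  have W: "expoly (2 * c + real i * c) 1 \<in> L2" for i
    using assms by (intro expoly_L2) (auto intro: add_pos_nonneg)
  have "L2_adherent ?V (\<lambda>x. \<Sum>i\<in>I. coeff q i * expoly (2 * c + real i * c) 1 x)" if "finite I" for I q
    using that
  proof (induction I rule: finite_induct)
    case empty
    have "expoly (2 * c) 0 = (\<lambda>x. 0)" by (auto simp: expoly_def)
    then show ?case by (auto intro!: L2_adherent_self) (metis rangeI)
  next
    case (insert i I)
    have "L2_adherent ?V (\<lambda>x. coeff q i * expoly (2 * c + real i * c) 1 x +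
        (\<Sum>i\<in>I. coeff q i * expoly (2 * c + real i * c) 1 x))"
      using assms insert
      by (intro L2_adherent_add V add L2_adherent_cmult scale L2_cmult L2_sum W expoly_shift_iterate_adherent) auto
    then show ?case using insert by simp
  qed
  then show ?thesis
    using assms(2) unfolding exp_polynomials_def exp_polynomial_eq_sum by auto
qed

definition exp_continuous :: "real \<Rightarrow> (real \<Rightarrow> real) set" where
  "exp_continuous c = {\<lambda>x. exp (- (2 * c) * x) * F (exp (- c * x)) | F. continuous_on {0..1} F}"

lemma exp_continuous_measurable:
  assumes "c > 0" "continuous_on {0..1} F"
  shows "(\<lambda>x. exp (- (2 * c) * x) * F (exp (- c * x))) \<in> borel_measurable half_line"
proof (rule continuous_imp_measurable_half_line)
  have "continuous_on {0<..} (\<lambda>x. F (exp (- c * x)))"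
    by (rule continuous_on_compose2[OF assms(2)]) (use assms(1) in \<open>auto intro!: continuous_intros\<close>)
  then show "continuous_on {0<..} (\<lambda>x. exp (- (2 * c) * x) * F (exp (- c * x)))"
    by (intro continuous_intros)
qed

lemma exp_continuous_L2: 
  assumes "c > 0" shows "exp_continuous c \<subseteq> L2"
proof
  fix w assume "w \<in> exp_continuous c"
  then obtain F where F: "continuous_on {0..1} F" and w: "w = (\<lambda>x. exp (- (2 * c) * x) * F (exp (- c * x)))"
    by (auto simp: exp_continuous_def)
  obtain K where K: "\<And>t. t \<in> {0..1} \<Longrightarrow> \<bar>F t\<bar> \<le> K"
    by (rule continuous_on_interval_bounded[OF F], rule that)
  show "w \<in> L2"
  proof (rule L2_bound)
    show "(\<lambda>x. K * expoly (2 * c) 1 x) \<in> L2" using assms by (intro L2_cmult expoly_L2) auto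
    show "w \<in> borel_measurable half_line"
      unfolding w by (rule exp_continuous_measurable[OF assms F])
    show "AE x in half_line. \<bar>w x\<bar> \<le> \<bar>K * expoly (2 * c) 1 x\<bar>"
    proof (rule AE_half_lineI)
      fix x :: real assume "x > 0"
      then have "\<bar>F (exp (- c * x))\<bar> \<le> \<bar>K\<bar>" using K[of "exp (- c * x)"] assms by simp
      then show "\<bar>w x\<bar> \<le> \<bar>K * expoly (2 * c) 1 x\<bar>"
        by (simp add: w expoly_def abs_mult mult.commute mult_left_mono)
    qed
  qed
qed

text \<open>
  The theorem of Weierstrass on the interval \<open>{0..1}\<close> of the variable \<open>t = exp (- c x)\<close>.
\<close>

lemma exp_continuous_adherent:
  assumes "c > 0" "w \<in> exp_continuous c"
  shows "L2_adherent (exp_polynomials c) w"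
proof -
  obtain F where F: "continuous_on {0..1} F" and w: "w = (\<lambda>x. exp (- (2 * c) * x) * F (exp (- c * x)))"
    using assms by (auto simp: exp_continuous_def)
  have "\<exists>q. \<forall>t\<in>{0..1}. \<bar>F t - poly q t\<bar> < 1 / real (Suc m)" for m
  proof -
    obtain g where g: "real_polynomial_function g" "\<And>t. t \<in> {0..1} \<Longrightarrow> \<bar>F t - g t\<bar> < 1 / real (Suc m)"
      using Stone_Weierstrass_real_polynomial_function[OF _ F, of "1 / real (Suc m)"] by auto
    obtain a n where "g = (\<lambda>x. \<Sum>i\<le>n. a i * x ^ i)"
      using g(1) by (auto simp: real_polynomial_function_iff_sum)
    then have "g = poly (\<Sum>i\<le>n. monom (a i) i)"
      by (auto simp: poly_sum poly_monom)
    then show ?thesis using g(2) by blast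
  qed
  then obtain q where q: "\<And>m t. t \<in> {0..1} \<Longrightarrow> \<bar>F t - poly (q m) t\<bar> < 1 / real (Suc m)"
    by metis
  have unit: "exp (- c * x) \<in> {0..1}" if "x > 0" for x using that assms by simp
  define v where "v = (\<lambda>m x. exp (- (2 * c) * x) * poly (q m) (exp (- c * x)))"
  have diff: "\<bar>v m x - w x\<bar> \<le> expoly (2 * c) 1 x * (1 / real (Suc m))" if "x > 0" for m x
  proof -
    have "\<bar>v m x - w x\<bar> = expoly (2 * c) 1 x * \<bar>F (exp (- c * x)) - poly (q m) (exp (- c * x))\<bar>"
      by (simp add: v_def w expoly_def abs_mult right_diff_distrib[symmetric] abs_minus_commute)
    then show ?thesis
      using mult_left_mono[OF less_imp_le[OF q[OF unit[OF that], of m]], of "expoly (2 * c) 1 x"]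
      by (simp add: expoly_def)
  qed
  show ?thesis
  proof (rule L2_adherentI_tendsto[where v = v])
    show "v m \<in> exp_polynomials c" for m by (auto simp: v_def exp_polynomials_def)
    show "(\<lambda>m. L2_sqdist (v m) w) \<longlonglongrightarrow> 0"
    proof (rule L2_dominated_convergence[where w = "expoly (2 * c) 1"])
      show "w \<in> borel_measurable half_line" "v m \<in> borel_measurable half_line" for m
        unfolding w v_def by (rule exp_continuous_measurable[OF assms(1)], intro F continuous_intros)+
      show "AE x in half_line. \<bar>v m x - w x\<bar> \<le> expoly (2 * c) 1 x" for m
      proof (rule AE_half_lineI)
        fix x :: real assume "x > 0"
        then have "\<bar>v m x - w x\<bar> \<le> expoly (2 * c) 1 x * (1 / real (Suc m))" by (intro diff) auto
        also have "\<dots> \<le> expoly (2 * c) 1 x * 1"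
          by (intro mult_left_mono) (auto simp: expoly_def)
        finally show "\<bar>v m x - w x\<bar> \<le> expoly (2 * c) 1 x" by simp
      qed
      show "AE x in half_line. (\<lambda>m. v m x) \<longlonglongrightarrow> w x"
      proof (rule AE_half_lineI)
        fix x :: real assume x: "x > 0"
        have "(\<lambda>m. v m x - w x) \<longlonglongrightarrow> 0"
        proof (rule Lim_null_comparison)
          show "eventually (\<lambda>m. norm (v m x - w x) \<le> expoly (2 * c) 1 x * (1 / real (Suc m))) sequentially"
            using diff[OF x] by simp
          have "(\<lambda>m. expoly (2 * c) 1 x * (1 / real (Suc m))) \<longlonglongrightarrow> expoly (2 * c) 1 x * 0"
            by (intro tendsto_mult tendsto_const LIMSEQ_Suc[OF lim_1_over_n])
          then show "(\<lambda>m. expoly (2 * c) 1 x * (1 / real (Suc m))) \<longlonglongrightarrow> 0" by simp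
        qed
        then show "(\<lambda>m. v m x) \<longlonglongrightarrow> w x" by (simp add: LIM_zero_iff)
      qed
    qed (use assms in \<open>auto intro: expoly_L2\<close>)
  qed
qed

definition truncated :: "(real \<Rightarrow> real) set" where
  "truncated = {k \<in> L2. \<exists>n::nat. \<forall>x. \<bar>k x\<bar> \<le> n \<and> (x > n \<longrightarrow> k x = 0)}"

text \<open>
  A measurable function is almost everywhere the limit of continuous functions \<open>G m\<close>. For the bounded function
  \<open>k' x = exp (2 c x) k x\<close> the functions \<open>G m\<close> may be clamped to the bound of \<open>k'\<close> and cut off
  continuously beyond the support, which keeps the pointwise limit and gives a majorant. After the cutoff they
  vanish near \<open>t = 0\<close> and are therefore continuous functions of \<open>t\<close> on all of \<open>{0..1}\<close>.
\<close>

lemma truncated_adherent: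
  assumes "c > 0" "k \<in> truncated"
  shows "L2_adherent (exp_continuous c) k"
proof -
  obtain n :: nat where n: "\<And>x. \<bar>k x\<bar> \<le> n" "\<And>x. x > real n \<Longrightarrow> k x = 0" and kL2: "k \<in> L2"
    using assms by (auto simp: truncated_def)
  define B where "B = exp (2 * c * n) * n"
  define k' where "k' x = exp (2 * c * x) * k x" for x
  have k'_bound: "\<bar>k' x\<bar> \<le> B" for x
  proof (cases "x > n")
    case True then show ?thesis using n(2) by (simp add: k'_def B_def)
  next
    case False then show ?thesis
      unfolding k'_def B_def abs_mult using n(1)[of x] assms by (intro mult_mono) auto
  qed
  have "B \<ge> 0" by (simp add: B_def)
  have "(\<lambda>x. exp (2 * c * x)) \<in> borel_measurable half_line"
    by (intro continuous_imp_measurable_half_line continuous_intros)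
  then have "k' \<in> borel_measurable half_line"
    unfolding k'_def using kL2 by (auto simp: L2_def)
  then have "k' measurable_on {0<..}"
    by (subst measurable_on_iff_borel_measurable) auto
  then obtain N G where N: "negligible N" and G: "\<And>m. continuous_on UNIV (G m)"
    and lim: "\<And>x. x \<notin> N \<Longrightarrow> (\<lambda>m. G m x) \<longlonglongrightarrow> (if x \<in> {0<..} then k' x else 0)"
    unfolding measurable_on_def by blast
  \<comment> \<open>\<open>y\<close> inverts \<open>t = exp (- c x)\<close> for \<open>x \<le> n + 1\<close> and stays at \<open>n + 1\<close> beyond, where the
     cutoff factor of \<open>F\<close> is 0\<close>
  define \<delta> where "\<delta> = exp (- c * (n + 1))"
  define y where "y t = - ln (max t \<delta>) / c" for t
  define F where "F m t = max (- B) (min B (G m (y t))) * max 0 (min 1 (n + 1 - y t))" for m t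
  have \<delta>: "\<delta> > 0" by (simp add: \<delta>_def)
  have y: "y (exp (- c * x)) = min x (n + 1)" for x
  proof -
    have "max (exp (- c * x)) \<delta> = exp (max (- c * x) (- c * (n + 1)))"
      by (simp add: \<delta>_def max_def)
    also have "max (- c * x) (- c * (n + 1)) = - c * min x (n + 1)"
      using assms by (auto simp: max_def min_def)
    finally show ?thesis using assms by (simp add: y_def)
  qed
  have "continuous_on {0..1} y"
    unfolding y_def using \<delta> assms by (intro continuous_intros) (auto simp: max_def)
  then have contF: "continuous_on {0..1} (F m)" for m
    unfolding F_def by (intro continuous_intros continuous_on_compose2[OF G]) auto
  define v where "v = (\<lambda>m x. exp (- (2 * c) * x) * F m (exp (- c * x)))"
  have k_eq: "k x = exp (- (2 * c) * x) * k' x" for x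
    by (simp add: k'_def mult.assoc[symmetric] exp_add[symmetric])
  show ?thesis
  proof (rule L2_adherentI_tendsto[where v = v])
    show "v m \<in> exp_continuous c" for m using contF by (auto simp: v_def exp_continuous_def)
    show "(\<lambda>m. L2_sqdist (v m) k) \<longlonglongrightarrow> 0"
    proof (rule L2_dominated_convergence[where w = "\<lambda>x. (2 * B) * expoly (2 * c) 1 x"])
      show "(\<lambda>x. 2 * B * expoly (2 * c) 1 x) \<in> L2" using assms by (intro L2_cmult expoly_L2) auto
      show "k \<in> borel_measurable half_line" using kL2 by (rule L2_measurable)
      show "v m \<in> borel_measurable half_line" for m
        unfolding v_def by (rule exp_continuous_measurable[OF assms(1) contF])
      show "AE x in half_line. \<bar>v m x - k x\<bar> \<le> 2 * B * expoly (2 * c) 1 x" for m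
      proof (rule AE_I2)
        fix x
        have "\<bar>F m (exp (- c * x))\<bar> \<le> B * 1"
          unfolding F_def abs_mult using \<open>B \<ge> 0\<close> by (intro mult_mono) auto
        then have "\<bar>F m (exp (- c * x)) - k' x\<bar> \<le> 2 * B" using k'_bound[of x] by linarith
        then have "exp (- (2 * c) * x) * \<bar>F m (exp (- c * x)) - k' x\<bar> \<le> exp (- (2 * c) * x) * (2 * B)"
          by (intro mult_left_mono) auto
        moreover have "v m x - k x = exp (- (2 * c) * x) * (F m (exp (- c * x)) - k' x)"
          by (simp add: v_def k_eq right_diff_distrib)
        ultimately show "\<bar>v m x - k x\<bar> \<le> 2 * B * expoly (2 * c) 1 x"
          by (simp add: abs_mult expoly_def mult_ac)
      qed
      have "AE x in lebesgue. x \<notin> N" 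
        using N by (intro AE_not_in) (simp add: negligible_iff_null_sets)
      then have "AE x in half_line. x \<notin> N"
        by (subst AE_restrict_space_iff) (auto elim: eventually_mono)
      moreover have "AE x in half_line. x > 0" by (rule AE_I2) simp
      ultimately show "AE x in half_line. (\<lambda>m. v m x) \<longlonglongrightarrow> k x"
      proof eventually_elim
        case (elim x)
        have lim: "(\<lambda>m. G m x) \<longlonglongrightarrow> k' x" using lim[of x] elim by simp
        have "(\<lambda>m. F m (exp (- c * x))) \<longlonglongrightarrow> k' x"
        proof (cases "x \<le> n + 1")
          case True
          have "(\<lambda>m. max (- B) (min B (G m x)) * max 0 (min 1 (n + 1 - x)))
              \<longlonglongrightarrow> max (- B) (min B (k' x)) * max 0 (min 1 (n + 1 - x))"
            by (intro tendsto_intros lim)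
          moreover have "max (- B) (min B (k' x)) = k' x" using k'_bound[of x] by auto
          moreover have "k' x * max 0 (min 1 (n + 1 - x)) = k' x"
            using n(2)[of x] by (cases "x > n") (auto simp: k'_def)
          ultimately show ?thesis
            unfolding F_def y using True by (simp only: min_absorb1)
        next
          case False
          then show ?thesis unfolding F_def y using n(2)[of x] by (simp add: k'_def)
        qed
        then show ?case unfolding v_def k_eq by (intro tendsto_intros)
      qed
    qed
  qed
qed

lemma L2_truncated_adherent:
  assumes "h \<in> L2" shows "L2_adherent truncated h"
proof -
  define v where "v = (\<lambda>(n::nat) (x::real). if x \<le> real n then max (- real n) (min n (h x)) else 0)"
  have [measurable]: "h \<in> borel_measurable half_line" using assms by (simp add: L2_def)
  have [measurable]: "(\<lambda>x. x) \<in> borel_measurable half_line"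
    by (intro continuous_imp_measurable_half_line continuous_intros)
  have meas: "v n \<in> borel_measurable half_line" for n
    unfolding v_def by measurable
  have le: "\<bar>v n x\<bar> \<le> \<bar>h x\<bar>" "\<bar>v n x - h x\<bar> \<le> \<bar>h x\<bar>" for n x
    by (auto simp: v_def max_def min_def)
  have vL2: "v n \<in> L2" for n
    by (rule L2_bound[OF assms meas]) (use le in auto)
  show ?thesis
  proof (rule L2_adherentI_tendsto[where v = v])
    show "v n \<in> truncated" for n
      using vL2 by (auto simp: truncated_def v_def intro!: exI[of _ n])
    show "(\<lambda>n. L2_sqdist (v n) h) \<longlonglongrightarrow> 0"
    proof (rule L2_dominated_convergence[where w = "\<lambda>x. \<bar>h x\<bar>"])
      show "(\<lambda>x. \<bar>h x\<bar>) \<in> L2" by (rule L2_bound[OF assms]) auto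
      show "AE x in half_line. (\<lambda>n. v n x) \<longlonglongrightarrow> h x"
      proof (rule AE_I2)
        fix x
        obtain m :: nat where "max x \<bar>h x\<bar> \<le> m" using real_arch_simple by blast
        then have m: "x \<le> m" "\<bar>h x\<bar> \<le> m" by auto
        have "eventually (\<lambda>n. v n x = h x) sequentially"
          using eventually_ge_at_top[of m]
        proof eventually_elim
          case (elim n)
          then have "real m \<le> real n" by simp
          then have "x \<le> n" "- real n \<le> h x" "h x \<le> real n" using m by linarith+
          then show ?case by (simp add: v_def)
        qed
        then show "(\<lambda>n. v n x) \<longlonglongrightarrow> h x" by (simp add: tendsto_eventually)
      qed
    qed (use meas le in auto)
  qed
qed

text \<open>
  The chain is: functions in \<open>L2\<close>, truncated functions, continuous functions of \<open>t\<close>, polynomials in \<open>t\<close>,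
  weighted polynomials with the rate \<open>2 c = b\<close>.
\<close>

theorem expoly_dense:
  assumes "b > 0" "h \<in> L2" shows "L2_adherent (range (expoly b)) h"
proof -
  define c where "c = b / 2"
  have c: "c > 0" "2 * c = b" using assms by (auto simp: c_def)
  have V: "range (expoly (2 * c)) \<subseteq> L2" unfolding c(2) using expoly_L2[OF assms(1)] by auto
  have trunc: "truncated \<subseteq> L2" by (auto simp: truncated_def)
  have 1: "L2_adherent (exp_continuous c) h"
    by (rule L2_adherent_trans[OF exp_continuous_L2[OF c(1)] trunc assms(2)
      truncated_adherent[OF c(1)] L2_truncated_adherent[OF assms(2)]])
  have 2: "L2_adherent (exp_polynomials c) h"
    by (rule L2_adherent_trans[OF exp_polynomials_L2[OF c(1)] exp_continuous_L2[OF c(1)] assms(2)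
      exp_continuous_adherent[OF c(1)] 1])
  have "L2_adherent (range (expoly (2 * c))) h"
    by (rule L2_adherent_trans[OF V exp_polynomials_L2[OF c(1)] assms(2)
      exp_polynomial_adherent[OF c(1)] 2])
  then show ?thesis unfolding c(2) .
qed

corollary expoly_orthogonal_imp_zero:
  assumes "b > 0" "g \<in> L2" "\<And>p. L2_inner g (expoly b p) = 0"
  shows "AE x in half_line. g x = 0"
proof (rule L2_inner_self_eq_0[OF assms(2)])
  show "L2_inner g g = 0"
    by (rule L2_adherent_orthogonal[OF _ assms(2,2) expoly_dense[OF assms(1,2)]])
      (use assms in \<open>auto intro: expoly_L2\<close>)
qed

section \<open>Smooth cutoffs\<close>

text \<open>
  The functions \<open>P (1 / x) exp (- 1 / x)\<close>, extended by 0, are closed under differentiation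
  (\<open>flat_has_deriv\<close>); this is the usual reason for the smoothness of \<open>exp (- 1 / x)\<close> at 0.
\<close>

definition flat :: "real poly \<Rightarrow> real \<Rightarrow> real" where
  "flat P x = (if x > 0 then poly P (1 / x) * exp (- (1 / x)) else 0)"

definition flat_deriv :: "real poly \<Rightarrow> real poly" where
  "flat_deriv P = monom 1 2 * (P - pderiv P)"

text \<open>
  At 0 the derivative vanishes because of a bound of second order, which follows from the boundedness of
  \<open>y\<^sup>2 P y exp (- y)\<close> for \<open>y = 1 / x\<close>.
\<close>

lemma flat_quadratic_bound: obtains K where "\<And>x. \<bar>flat P x\<bar> \<le> K * x\<^sup>2"
proof -
  obtain K where K: "K > 0" "\<And>x. x \<ge> 0 \<Longrightarrow> \<bar>expoly 1 (monom 1 2 * P) x\<bar> \<le> K"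
    using expoly_bounded[of 1 "monom 1 2 * P"] by auto
  have "\<bar>flat P x\<bar> \<le> K * x\<^sup>2" for x
  proof (cases "x > 0")
    case True
    have "expoly 1 (monom 1 2 * P) (1 / x) * x\<^sup>2 = flat P x"
      using True by (simp add: expoly_def flat_def poly_monom power_divide)
    then have "\<bar>flat P x\<bar> = \<bar>expoly 1 (monom 1 2 * P) (1 / x)\<bar> * x\<^sup>2"
      by (metis abs_mult abs_power2)
    then show ?thesis using K(2)[of "1 / x"] True by (simp add: mult_right_mono)
  next
    case False then show ?thesis using K by (simp add: flat_def)
  qed
  then show ?thesis by (rule that)
qed

lemma flat_has_deriv: "(flat P has_real_derivative flat (flat_deriv P) x) (at x)"
proof -
  consider "x > 0" | "x = 0" | "x < 0" by linarith
  then show ?thesis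
  proof cases
    case 1
    have "((\<lambda>x. poly P (1 / x) * exp (- (1 / x))) has_real_derivative
        flat (flat_deriv P) x) (at x)"
      using 1 by (auto intro!: derivative_eq_intros DERIV_chain2[OF poly_DERIV]
        simp: flat_def flat_deriv_def poly_monom field_simps power2_eq_square)
    then show ?thesis
      by (rule has_field_derivative_transform_within_open[of _ _ _ "{0<..}"]) (use 1 in \<open>auto simp: flat_def\<close>)
  next
    case 2
    obtain K where K: "\<And>x. \<bar>flat P x\<bar> \<le> K * x\<^sup>2" by (rule flat_quadratic_bound[of P]) blast
    have "(\<lambda>h. flat P h / h) \<midarrow>0\<rightarrow> 0"
    proof (rule Lim_null_comparison)
      have "\<bar>flat P h / h\<bar> \<le> \<bar>K\<bar> * \<bar>h\<bar>" for h
      proof (cases "h = 0")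
        case False
        have "\<bar>flat P h\<bar> \<le> \<bar>K\<bar> * h\<^sup>2"
          using K[of h] by (meson abs_ge_self mult_right_mono order_trans zero_le_power2)
        also have "\<dots> = (\<bar>K\<bar> * \<bar>h\<bar>) * \<bar>h\<bar>" by (simp add: power2_eq_square)
        finally show ?thesis using False by (simp add: abs_divide divide_le_eq)
      qed simp
      then show "\<forall>\<^sub>F h in at 0. norm (flat P h / h) \<le> \<bar>K\<bar> * \<bar>h\<bar>" by simp
      show "(\<lambda>h. \<bar>K\<bar> * \<bar>h\<bar>) \<midarrow>0\<rightarrow> 0" by (auto intro!: tendsto_eq_intros)
    qed
    then show ?thesis using 2 by (simp add: DERIV_def flat_def)
  next
    case 3
    have "((\<lambda>x. 0) has_real_derivative flat (flat_deriv P) x) (at x)"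
      using 3 by (simp add: flat_def)
    then show ?thesis
      by (rule has_field_derivative_transform_within_open[of _ _ _ "{..<0}"]) (use 3 in \<open>auto simp: flat_def\<close>)
  qed
qed

lemma flat_tendsto: "(flat P \<longlongrightarrow> poly P 0) at_top"
proof -
  have "((\<lambda>x::real. 1 / x) \<longlongrightarrow> 0) at_top"
    by (intro tendsto_divide_0[OF tendsto_const] filterlim_at_top_imp_at_infinity filterlim_ident)
  then have "((\<lambda>x. poly P (1 / x) * exp (- (1 / x))) \<longlongrightarrow> poly P 0 * exp (- 0)) at_top"
    by (intro tendsto_intros)
  moreover have "eventually (\<lambda>x. poly P (1 / x) * exp (- (1 / x)) = flat P x) at_top"
    using eventually_gt_at_top[of 0] by eventually_elim (simp add: flat_def)
  ultimately show ?thesis by (simp add: filterlim_cong)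
qed

text \<open>
  Smoothness of a function is shown by membership in an algebra in which every element has a derivative that
  again belongs to it. The algebra contains the cutoffs and the weighted polynomials.
\<close>

inductive_set smooth_algebra :: "(real \<Rightarrow> real) set" where
  flat: "(\<lambda>x. flat P (a * x + c)) \<in> smooth_algebra"
| expoly: "expoly b p \<in> smooth_algebra"
| add: "f \<in> smooth_algebra \<Longrightarrow> g \<in> smooth_algebra \<Longrightarrow> (\<lambda>x. f x + g x) \<in> smooth_algebra"
| mult: "f \<in> smooth_algebra \<Longrightarrow> g \<in> smooth_algebra \<Longrightarrow> (\<lambda>x. f x * g x) \<in> smooth_algebra"

lemma expoly_has_deriv:
  "(expoly b p has_real_derivative expoly b (pderiv p - smult b p) x) (at x)"
  unfolding expoly_def
  by (auto intro!: derivative_eq_intros poly_DERIV simp: algebra_simps)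

lemma smooth_algebra_has_deriv:
  assumes "f \<in> smooth_algebra"
  shows "\<exists>g\<in>smooth_algebra. \<forall>x. (f has_real_derivative g x) (at x)"
  using assms
proof induction
  case (flat P a c)
  have "((\<lambda>x. flat P (a * x + c)) has_real_derivative flat (smult a (flat_deriv P)) (a * x + c)) (at x)" for x
    by (rule DERIV_cong[OF DERIV_chain2[OF flat_has_deriv]])
      (auto intro!: derivative_eq_intros simp: flat_def)
  then show ?case
    by (intro bexI[of _ "\<lambda>x. flat (smult a (flat_deriv P)) (a * x + c)"] allI smooth_algebra.flat)
next
  case (expoly b p)
  show ?case
    by (intro bexI[of _ "expoly b (pderiv p - smult b p)"] allI smooth_algebra.expoly expoly_has_deriv)
next
  case (add f g)
  then obtain f' g' where "f' \<in> smooth_algebra" "g' \<in> smooth_algebra"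
    "\<And>x. (f has_real_derivative f' x) (at x)" "\<And>x. (g has_real_derivative g' x) (at x)" by blast
  then show ?case
    by (intro bexI[of _ "\<lambda>x. f' x + g' x"]) (auto intro!: smooth_algebra.intros derivative_eq_intros)
next
  case (mult f g)
  then obtain f' g' where "f' \<in> smooth_algebra" "g' \<in> smooth_algebra"
    "\<And>x. (f has_real_derivative f' x) (at x)" "\<And>x. (g has_real_derivative g' x) (at x)" by blast
  with mult show ?case
    by (intro bexI[of _ "\<lambda>x. f' x * g x + g' x * f x"])
      (auto intro!: smooth_algebra.intros DERIV_mult)
qed

lemma smooth_algebra_deriv: "f \<in> smooth_algebra \<Longrightarrow> deriv f \<in> smooth_algebra"
  using smooth_algebra_has_deriv[of f] DERIV_imp_deriv[of f] by (metis ext)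

lemma smooth_algebra_smooth:
  assumes "f \<in> smooth_algebra" shows "(deriv ^^ n) f differentiable_on UNIV"
proof -
  have "(deriv ^^ n) f \<in> smooth_algebra"
    using assms by (induction n) (auto intro: smooth_algebra_deriv)
  then show ?thesis
    using smooth_algebra_has_deriv unfolding differentiable_on_def real_differentiable_def by blast
qed

section \<open>Test functions\<close>

lemma test_function_has_deriv:
  assumes "\<phi> \<in> test_functions" shows "(\<phi> has_real_derivative deriv \<phi> x) (at x)"
proof -
  have "(deriv ^^ 0) \<phi> differentiable_on UNIV"
    using assms unfolding test_functions_def by blast
  then show ?thesis
    by (simp add: differentiable_on_def DERIV_deriv_iff_real_differentiable)
qed

lemma test_function_deriv:
  assumes "\<phi> \<in> test_functions" shows "deriv \<phi> \<in> test_functions"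
proof -
  obtain K where K: "compact K" "K \<subseteq> {0<..}" "\<And>x. x \<notin> K \<Longrightarrow> \<phi> x = 0"
    using assms by (auto simp: test_functions_def)
  have "(deriv ^^ n) (deriv \<phi>) differentiable_on UNIV" for n
    using assms unfolding test_functions_def
    by (metis (mono_tags, lifting) funpow_Suc_right comp_apply mem_Collect_eq)
  moreover have "deriv \<phi> x = 0" if "x \<notin> K" for x
  proof -
    have "((\<lambda>x. 0) has_real_derivative 0) (at x)" by simp
    then have "(\<phi> has_real_derivative 0) (at x)"
      by (rule has_field_derivative_transform_within_open[of _ _ _ "- K"])
        (use K that in \<open>auto simp: compact_imp_closed open_Compl\<close>)
    then show ?thesis by (rule DERIV_imp_deriv)
  qed
  ultimately show ?thesis using K unfolding test_functions_def by blast
qed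

lemma test_function_continuous:
  assumes "\<phi> \<in> test_functions" shows "continuous_on S \<phi>"
  using test_function_has_deriv[OF assms] by (meson DERIV_continuous continuous_at_imp_continuous_on)

lemma test_function_support:
  assumes "\<phi> \<in> test_functions"
  obtains R where "R > 0" "\<And>x. x \<le> 0 \<Longrightarrow> \<phi> x = 0" "\<And>x. x \<ge> R \<Longrightarrow> \<phi> x = 0"
proof -
  obtain K where K: "compact K" "K \<subseteq> {0<..}" "\<And>x. x \<notin> K \<Longrightarrow> \<phi> x = 0"
    using assms by (auto simp: test_functions_def)
  obtain R where R: "\<And>x. x \<in> K \<Longrightarrow> \<bar>x\<bar> \<le> R"
    using compact_imp_bounded[OF K(1)] unfolding bounded_iff by (metis real_norm_def)
  show ?thesis
  proof (rule that[of "\<bar>R\<bar> + 1"])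
    show "\<phi> x = 0" if "x \<le> 0" for x using that K by force
    show "\<phi> x = 0" if "x \<ge> \<bar>R\<bar> + 1" for x using that K(3)[of x] R[of x] by force
  qed simp
qed

lemma test_function_L2:
  assumes "\<phi> \<in> test_functions" shows "\<phi> \<in> L2"
proof -
  obtain R where R: "R > 0" "\<And>x. x \<le> 0 \<Longrightarrow> \<phi> x = 0" "\<And>x. x \<ge> R \<Longrightarrow> \<phi> x = 0"
    using test_function_support[OF assms] by blast
  obtain C where C: "\<And>x. x \<in> {0..R} \<Longrightarrow> \<bar>\<phi> x\<bar> \<le> C"
    by (rule continuous_on_interval_bounded[OF test_function_continuous[OF assms]], rule that)
  show ?thesis
  proof (rule L2_bound)
    show "(\<lambda>x. (C * exp R) * expoly 1 1 x) \<in> L2" by (intro L2_cmult expoly_L2) auto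
    show "\<phi> \<in> borel_measurable half_line"
      by (intro continuous_imp_measurable_half_line test_function_continuous assms)
    show "AE x in half_line. \<bar>\<phi> x\<bar> \<le> \<bar>C * exp R * expoly 1 1 x\<bar>"
    proof (rule AE_half_lineI)
      fix x :: real assume x: "x > 0"
      show "\<bar>\<phi> x\<bar> \<le> \<bar>C * exp R * expoly 1 1 x\<bar>"
      proof (cases "x \<le> R")
        case True
        then have "1 \<le> exp R * exp (- x)" by (simp add: exp_add[symmetric])
        then have "\<bar>C\<bar> * 1 \<le> \<bar>C\<bar> * (exp R * exp (- x))" by (intro mult_left_mono) auto
        then show ?thesis using C[of x] x True by (simp add: expoly_def abs_mult mult.assoc)
      qed (use R in auto)
    qed
  qed
qed

section \<open>Approximation of weighted polynomials by test functions\<close>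

lemma flat_one_bounds: "0 \<le> flat 1 x" "flat 1 x \<le> 1"
  by (auto simp: flat_def)

lemma flat_nonneg_bound:
  assumes "\<And>z. z \<ge> 0 \<Longrightarrow> 0 \<le> poly P z" "\<And>z. z \<ge> 0 \<Longrightarrow> poly P z \<le> C * exp z" "C \<ge> 0"
  shows "0 \<le> flat P x" "flat P x \<le> C"
  using assms(1,2)[of "1 / x"] assms(3) by (auto simp: flat_def exp_minus field_simps)

lemma flat_monom2_bounds: "0 \<le> flat (monom 1 2) x" "flat (monom 1 2) x \<le> 2"
proof -
  have 1: "z\<^sup>2 \<le> 2 * exp z" if "z \<ge> 0" for z :: real
    using power_over_fact_le_exp[OF that, of 2] by simp
  show "0 \<le> flat (monom 1 2) x" by (simp add: flat_def poly_monom)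
  show "flat (monom 1 2) x \<le> 2"
    by (rule flat_nonneg_bound) (use 1 in \<open>simp_all add: poly_monom\<close>)
qed

lemma flat_monom12_bounds:
  "0 \<le> flat (monom 1 1 + monom 1 2) x" "flat (monom 1 1 + monom 1 2) x \<le> 3"
proof -
  have 1: "z + z\<^sup>2 \<le> 3 * exp z" if "z \<ge> 0" for z :: real
    using power_over_fact_le_exp[OF that, of 1] power_over_fact_le_exp[OF that, of 2]
    by (simp add: numeral_2_eq_2)
  show "0 \<le> flat (monom 1 1 + monom 1 2) x" by (simp add: flat_def poly_monom)
  show "flat (monom 1 1 + monom 1 2) x \<le> 3"
    by (rule flat_nonneg_bound) (use 1 in \<open>simp_all add: poly_monom\<close>)
qed

text \<open>
  The first factor vanishes for \<open>x \<le> 1 / (n + 1)\<close> and the second for \<open>x \<ge> n + 1\<close>. As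
  \<open>n\<close> grows, the product tends to 1 and its derivative to 0, with a majorant that is harmless for functions
  vanishing at 0.
\<close>

definition cutoff :: "nat \<Rightarrow> real \<Rightarrow> real" where
  "cutoff n x = flat 1 (real (Suc n) * x + (- 1)) * flat 1 (- 1 * x + real (Suc n))"

text \<open>
  The derivative for \<open>x > 0\<close>. With \<open>y = (n + 1) x - 1\<close> the inner derivative \<open>n + 1\<close> equals
  \<open>(y + 1) / x\<close>, so it is traded for a factor \<open>1 / x\<close>, and \<open>(y + 1) / y\<^sup>2\<close> is the value of
  \<open>monom 1 1 + monom 1 2\<close> at \<open>1 / y\<close>. This gives a bound that is uniform in \<open>n\<close>.
\<close>

definition cutoff_deriv :: "nat \<Rightarrow> real \<Rightarrow> real" where
  "cutoff_deriv n x = flat (monom 1 1 + monom 1 2) (real (Suc n) * x + (- 1)) / x * flat 1 (- 1 * x + real (Suc n))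
     - flat 1 (real (Suc n) * x + (- 1)) * flat (monom 1 2) (- 1 * x + real (Suc n))"

lemma cutoff_has_deriv:
  assumes "x > 0" shows "(cutoff n has_real_derivative cutoff_deriv n x) (at x)"
proof -
  have 1: "flat_deriv 1 = monom 1 2" by (simp add: flat_deriv_def)
  have 2: "flat (monom 1 2) y * N = flat (monom 1 1 + monom 1 2) y / x"
    if "y = N * x + (- 1)" for y N
  proof (cases "y > 0")
    case True
    have N: "N = (y + 1) / x" using that assms by simp
    show ?thesis unfolding N using True assms by (simp add: flat_def poly_monom field_simps power2_eq_square)
  qed (simp add: flat_def)
  have 3: "((\<lambda>x. flat 1 (a * x + c)) has_real_derivative flat (monom 1 2) (a * x + c) * a) (at x)" for a c
    by (rule DERIV_cong[OF DERIV_chain2[OF flat_has_deriv]])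
      (auto intro!: derivative_eq_intros simp: 1)
  show ?thesis
    unfolding cutoff_def cutoff_deriv_def
    by (rule DERIV_cong[OF DERIV_mult[OF 3 3]]) (simp only: 2[OF refl], simp)
qed

lemma cutoff_tendsto:
  assumes "x > 0" shows "(\<lambda>n. cutoff n x) \<longlonglongrightarrow> 1" "(\<lambda>n. cutoff_deriv n x) \<longlonglongrightarrow> 0"
proof -
  have 1: "filterlim (\<lambda>n. real (Suc n) * x + (- 1)) at_top sequentially"
    using filterlim_tendsto_add_at_top[OF tendsto_const[of "- 1"]
        filterlim_tendsto_pos_mult_at_top[OF tendsto_const[of x] assms
          filterlim_compose[OF filterlim_real_sequentially filterlim_Suc]]]
    by (simp add: add.commute mult.commute)
  have 2: "filterlim (\<lambda>n. - 1 * x + real (Suc n)) at_top sequentially"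
    using filterlim_tendsto_add_at_top[OF tendsto_const[of "- 1 * x"]
          filterlim_compose[OF filterlim_real_sequentially filterlim_Suc]] by simp
  note lim = filterlim_compose[OF flat_tendsto 1] filterlim_compose[OF flat_tendsto 2]
  have "(\<lambda>n. cutoff n x) \<longlonglongrightarrow> poly 1 0 * poly 1 0"
    unfolding cutoff_def by (intro tendsto_intros lim)
  then show "(\<lambda>n. cutoff n x) \<longlonglongrightarrow> 1" by simp
  have "(\<lambda>n. cutoff_deriv n x) \<longlonglongrightarrow> poly (monom 1 1 + monom 1 2) 0 / x * poly 1 0 - poly 1 0 * poly (monom 1 2) 0"
    unfolding cutoff_deriv_def using assms by (intro tendsto_intros lim) auto
  then show "(\<lambda>n. cutoff_deriv n x) \<longlonglongrightarrow> 0" by (simp add: poly_monom)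
qed

lemma cutoff_bounds: "0 \<le> cutoff n x" "cutoff n x \<le> 1"
  unfolding cutoff_def using flat_one_bounds by (auto intro: mult_le_one)

lemma cutoff_deriv_bound:
  assumes "x > 0" shows "\<bar>cutoff_deriv n x\<bar> \<le> 3 / x + 2"
proof -
  have "\<bar>flat (monom 1 1 + monom 1 2) (real (Suc n) * x + (- 1)) / x * flat 1 (- 1 * x + real (Suc n))\<bar> \<le> (3 / x) * 1"
    unfolding abs_mult using assms flat_monom12_bounds flat_one_bounds
    by (intro mult_mono) (auto simp: abs_divide divide_right_mono)
  moreover have "\<bar>flat 1 (real (Suc n) * x + (- 1)) * flat (monom 1 2) (- 1 * x + real (Suc n))\<bar> \<le> 1 * 2"
    unfolding abs_mult using flat_monom2_bounds flat_one_bounds by (intro mult_mono) auto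
  ultimately show ?thesis unfolding cutoff_deriv_def by linarith
qed

lemma cutoff_expoly_test_function: "(\<lambda>x. expoly b p x * cutoff n x) \<in> test_functions"
proof -
  have "(\<lambda>x. expoly b p x * cutoff n x) \<in> smooth_algebra"
    unfolding cutoff_def by (intro smooth_algebra.intros)
  moreover have "cutoff n x = 0" if "x \<notin> {1 / real (Suc n)..real (Suc n)}" for x
    using that by (auto simp: cutoff_def flat_def field_simps)
  ultimately show ?thesis
    unfolding test_functions_def
    by (auto intro!: smooth_algebra_smooth exI[of _ "{1 / real (Suc n)..real (Suc n)}"]
      intro: less_le_trans[of 0 "1 / real (Suc n)"])
qed

text \<open>
  The derivative of the cutoff is of size \<open>1 / x\<close> near 0. This is compensated by the zero of \<open>p\<close>: writing
  \<open>p = x q\<close>, the product has the majorant \<open>3 \<bar>exp (- b x) q x\<bar> + 2 \<bar>exp (- b x) p x\<bar>\<close>.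
\<close>

theorem expoly_test_function_approximation:
  assumes b: "b > 0" and p: "poly p 0 = 0"
  obtains \<phi> where "\<And>n. \<phi> n \<in> test_functions"
    "(\<lambda>n. L2_sqdist (\<phi> n) (expoly b p)) \<longlonglongrightarrow> 0"
    "(\<lambda>n. L2_sqdist (deriv (\<phi> n)) (expoly b (pderiv p - smult b p))) \<longlonglongrightarrow> 0"
proof (rule that[of "\<lambda>n x. expoly b p x * cutoff n x"])
  let ?\<phi> = "\<lambda>n x. expoly b p x * cutoff n x"
  let ?p' = "pderiv p - smult b p"
  show test: "?\<phi> n \<in> test_functions" for n by (rule cutoff_expoly_test_function)
  have absL2: "(\<lambda>x. \<bar>expoly b r x\<bar>) \<in> L2" for r
    by (rule L2_bound[OF expoly_L2[OF b, of r]]) (use expoly_measurable[of b r] in auto)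
  show "(\<lambda>n. L2_sqdist (?\<phi> n) (expoly b p)) \<longlonglongrightarrow> 0"
  proof (rule L2_dominated_convergence[OF absL2])
    show "AE x in half_line. \<bar>?\<phi> n x - expoly b p x\<bar> \<le> \<bar>expoly b p x\<bar>" for n
    proof (rule AE_I2)
      fix x
      have "?\<phi> n x - expoly b p x = expoly b p x * (cutoff n x - 1)" by (simp add: algebra_simps)
      moreover have "\<bar>cutoff n x - 1\<bar> \<le> 1" using cutoff_bounds[of n x] by simp
      ultimately show "\<bar>?\<phi> n x - expoly b p x\<bar> \<le> \<bar>expoly b p x\<bar>"
        by (simp add: abs_mult mult_left_le)
    qed
    show "AE x in half_line. (\<lambda>n. ?\<phi> n x) \<longlonglongrightarrow> expoly b p x"
    proof (rule AE_half_lineI)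
      fix x :: real assume "x > 0"
      then have "(\<lambda>n. ?\<phi> n x) \<longlonglongrightarrow> expoly b p x * 1"
        by (intro tendsto_intros cutoff_tendsto) auto
      then show "(\<lambda>n. ?\<phi> n x) \<longlonglongrightarrow> expoly b p x" by simp
    qed
    show "?\<phi> n \<in> borel_measurable half_line" for n
      by (rule L2_measurable[OF test_function_L2[OF test]])
  qed (rule expoly_measurable)
  obtain q where q: "p = [:0, 1:] * q" using p by (auto simp: poly_eq_0_iff_dvd)
  have deriv_eq: "deriv (?\<phi> n) x = expoly b ?p' x * cutoff n x + expoly b p x * cutoff_deriv n x"
    if "x > 0" for n x
    by (rule DERIV_imp_deriv, rule DERIV_cong[OF DERIV_mult[OF expoly_has_deriv cutoff_has_deriv[OF that]]])
      simp
  show "(\<lambda>n. L2_sqdist (deriv (?\<phi> n)) (expoly b ?p')) \<longlonglongrightarrow> 0"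
  proof (rule L2_dominated_convergence)
    show "(\<lambda>x. \<bar>expoly b ?p' x\<bar> + (3 * \<bar>expoly b q x\<bar> + 2 * \<bar>expoly b p x\<bar>)) \<in> L2"
      by (intro L2_add L2_cmult absL2)
    show "AE x in half_line. \<bar>deriv (?\<phi> n) x - expoly b ?p' x\<bar>
        \<le> \<bar>expoly b ?p' x\<bar> + (3 * \<bar>expoly b q x\<bar> + 2 * \<bar>expoly b p x\<bar>)" for n
    proof (rule AE_half_lineI)
      fix x :: real assume x: "x > 0"
      have "\<bar>expoly b ?p' x\<bar> * \<bar>cutoff n x - 1\<bar> \<le> \<bar>expoly b ?p' x\<bar>"
        using cutoff_bounds[of n x] by (intro mult_left_le) auto
      moreover have "\<bar>expoly b p x\<bar> * \<bar>cutoff_deriv n x\<bar> \<le> \<bar>expoly b p x\<bar> * (3 / x + 2)"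
        by (intro mult_left_mono cutoff_deriv_bound x) auto
      moreover have "expoly b p x = x * expoly b q x" by (simp add: q expoly_def)
      then have "\<bar>expoly b p x\<bar> * (3 / x + 2) = 3 * \<bar>expoly b q x\<bar> + 2 * \<bar>expoly b p x\<bar>"
        using x by (simp add: abs_mult field_simps)
      moreover have "deriv (?\<phi> n) x - expoly b ?p' x
          = expoly b ?p' x * (cutoff n x - 1) + expoly b p x * cutoff_deriv n x"
        unfolding deriv_eq[OF x] by (simp add: algebra_simps)
      ultimately show "\<bar>deriv (?\<phi> n) x - expoly b ?p' x\<bar>
        \<le> \<bar>expoly b ?p' x\<bar> + (3 * \<bar>expoly b q x\<bar> + 2 * \<bar>expoly b p x\<bar>)"
        using abs_triangle_ineq[of "expoly b ?p' x * (cutoff n x - 1)" "expoly b p x * cutoff_deriv n x"]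
        unfolding abs_mult by linarith
    qed
    show "AE x in half_line. (\<lambda>n. deriv (?\<phi> n) x) \<longlonglongrightarrow> expoly b ?p' x"
    proof (rule AE_half_lineI)
      fix x :: real assume x: "x > 0"
      have "(\<lambda>n. expoly b ?p' x * cutoff n x + expoly b p x * cutoff_deriv n x)
          \<longlonglongrightarrow> expoly b ?p' x * 1 + expoly b p x * 0"
        by (intro tendsto_intros cutoff_tendsto x)
      then show "(\<lambda>n. deriv (?\<phi> n) x) \<longlonglongrightarrow> expoly b ?p' x"
        by (simp add: deriv_eq[OF x])
    qed
    show "deriv (?\<phi> n) \<in> borel_measurable half_line" for n
      by (rule L2_measurable[OF test_function_L2[OF test_function_deriv[OF test]]])
  qed (rule expoly_measurable)
qed

section \<open>Primitives and integration by parts\<close>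

lemma half_line_integrable_interval:
  fixes F :: "real \<Rightarrow> real"
  assumes "integrable half_line F" shows "integrable (lebesgue_on {0..R}) F"
proof -
  have "F absolutely_integrable_on {0<..}"
    using assms by (simp add: integrable_restrict_space set_integrable_def)
  then have "F absolutely_integrable_on {0<..R}"
    by (rule set_integrable_subset) auto
  then have "F absolutely_integrable_on {0..R}"
  proof (rule absolutely_integrable_spike_set)
    show "negligible {x \<in> {0<..R} - {0..R}. F x \<noteq> 0}" by (rule negligible_subset[of "{0}"]) auto
    show "negligible {x \<in> {0..R} - {0<..R}. F x \<noteq> 0}" by (rule negligible_subset[of "{0}"]) auto
  qed
  then show ?thesis by (rule absolutely_integrable_imp_integrable) simp
qed

lemma half_line_integral_limit:
  fixes F :: "real \<Rightarrow> real"
  assumes "integrable half_line F"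
  shows "(\<lambda>n. integral {0..real n} F) \<longlonglongrightarrow> (LINT x|half_line. F x)"
proof -
  have id: "(\<lambda>x::real. x) \<in> borel_measurable half_line"
    by (intro continuous_imp_measurable_half_line continuous_intros)
  have F: "F \<in> borel_measurable half_line" using assms by auto
  have int: "integrable half_line (\<lambda>x. if x \<in> {..real n} then F x else 0)" for n
  proof (rule Bochner_Integration.integrable_bound[OF assms])
    show "(\<lambda>x. if x \<in> {..real n} then F x else 0) \<in> borel_measurable half_line"
      using F id by simp
  qed auto
  have "(\<lambda>n. LINT x|half_line. (if x \<in> {..real n} then F x else 0)) \<longlonglongrightarrow> (LINT x|half_line. F x)"
  proof (rule integral_dominated_convergence[where w = "\<lambda>x. norm (F x)"])
    show "AE x in half_line. (\<lambda>n. if x \<in> {..real n} then F x else 0) \<longlonglongrightarrow> F x"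
    proof (rule AE_I2)
      fix x :: real
      obtain m :: nat where "x \<le> m" using real_arch_simple by blast
      then have "eventually (\<lambda>n. (if x \<in> {..real n} then F x else 0) = F x) sequentially"
        by (intro eventually_sequentiallyI[of m]) auto
      then show "(\<lambda>n. if x \<in> {..real n} then F x else 0) \<longlonglongrightarrow> F x"
        by (rule tendsto_eventually)
    qed
  qed (use assms F int in auto)
  moreover have "(LINT x|half_line. (if x \<in> {..real n} then F x else 0)) = integral {0..real n} F" for n
  proof -
    have "(LINT x|half_line. (if x \<in> {..real n} then F x else 0))
        = integral {0<..} (\<lambda>x. if x \<in> {..real n} then F x else 0)"
      by (rule lebesgue_integral_eq_integral[OF int]) simp
    also have "\<dots> = integral ({..real n} \<inter> {0<..}) F"
      by (rule integral_restrict_Int)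
    also have "\<dots> = integral {0..real n} F"
    proof (rule integral_spike_set)
      show "negligible {x \<in> {..real n} \<inter> {0<..} - {0..real n}. F x \<noteq> 0}"
        by (rule negligible_subset[of "{0}"]) auto
      show "negligible {x \<in> {0..real n} - {..real n} \<inter> {0<..}. F x \<noteq> 0}"
        by (rule negligible_subset[of "{0}"]) auto
    qed
    finally show ?thesis .
  qed
  ultimately show ?thesis by simp
qed

lemma interval_integral_le_half_line:
  fixes F :: "real \<Rightarrow> real"
  assumes int: "integrable half_line F" and nonneg: "\<And>t. F t \<ge> 0"
  shows "integral {0..x} F \<le> (LINT t|half_line. F t)"
proof -
  have mono: "integral {0..x} F \<le> integral {0..real n} F" if "x \<le> n" for n
    using that nonneg half_line_integrable_interval[OF int]
    by (intro integral_subset_le integrable_on_lebesgue_on) auto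
  obtain m :: nat where m: "x \<le> m" using real_arch_simple by blast
  show ?thesis
  proof (rule LIMSEQ_le_const[OF half_line_integral_limit[OF int]])
    show "\<exists>N. \<forall>n\<ge>N. integral {0..x} F \<le> integral {0..real n} F"
      using m mono by (intro exI[of _ m]) (meson of_nat_mono order_trans)
  qed
qed

lemma L2_integrable_interval:
  assumes "g \<in> L2" shows "integrable (lebesgue_on {0..R}) g"
proof -
  have 1: "integrable (lebesgue_on {0..R}) (\<lambda>x. g x * expoly 1 1 x)"
    by (intro half_line_integrable_interval L2_mult_integrable assms expoly_L2) auto
  have "(\<lambda>x. exp x) \<in> borel_measurable (lebesgue_on {0..R})"
    by (intro continuous_imp_measurable_on_sets_lebesgue continuous_intros) auto
  then have "(\<lambda>x. (g x * expoly 1 1 x) * exp x) \<in> borel_measurable (lebesgue_on {0..R})"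
    using borel_measurable_integrable[OF 1] by (rule borel_measurable_times[rotated])
  then have meas: "g \<in> borel_measurable (lebesgue_on {0..R})"
    by (simp add: expoly_def mult.assoc mult_exp_exp)
  show ?thesis
  proof (rule Bochner_Integration.integrable_bound)
    show "integrable (lebesgue_on {0..R}) (\<lambda>x. exp R * (g x * expoly 1 1 x))"
      using 1 by simp
    show "AE x in lebesgue_on {0..R}. norm (g x) \<le> norm (exp R * (g x * expoly 1 1 x))"
    proof (rule AE_I2)
      fix x assume "x \<in> space (lebesgue_on {0..R})"
      then have "1 \<le> exp R * exp (- x)" by (simp add: exp_add[symmetric])
      then have "\<bar>g x\<bar> * 1 \<le> \<bar>g x\<bar> * (exp R * exp (- x))" by (rule mult_left_mono) simp
      then show "norm (g x) \<le> norm (exp R * (g x * expoly 1 1 x))"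
        by (simp add: expoly_def abs_mult mult_ac)
    qed
  qed (rule meas)
qed

text \<open>
  Absolute continuity on the half line, in the form in which it is used: \<open>z\<close> is an indefinite integral of the
  locally integrable function \<open>g\<close>.
\<close>

definition primitive_of :: "(real \<Rightarrow> real) \<Rightarrow> (real \<Rightarrow> real) \<Rightarrow> bool" where
  "primitive_of z g \<longleftrightarrow> (\<forall>R. integrable (lebesgue_on {0..R}) g) \<and>
     (\<forall>x\<ge>0. z x = z 0 + integral {0..x} g)"

lemma primitive_ofI:
  assumes "\<And>R. integrable (lebesgue_on {0..R}) g" "\<And>x. x \<ge> 0 \<Longrightarrow> z x = z 0 + integral {0..x} g"
  shows "primitive_of z g"
  using assms unfolding primitive_of_def by blast

lemma primitive_of_integrable: "primitive_of z g \<Longrightarrow> integrable (lebesgue_on {0..R}) g"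
  unfolding primitive_of_def by blast

lemma primitive_of_eq: "primitive_of z g \<Longrightarrow> x \<ge> 0 \<Longrightarrow> z x = z 0 + integral {0..x} g"
  unfolding primitive_of_def by blast

lemma primitive_of_integrable_on: "primitive_of z g \<Longrightarrow> g integrable_on {0..R}"
  by (intro integrable_on_lebesgue_on primitive_of_integrable) auto

lemma primitive_of_continuous:
  assumes "primitive_of z g" shows "continuous_on {0..} z"
proof -
  have "continuous_on {0..R} z" for R
  proof -
    have "g integrable_on {0..R}"
      by (rule primitive_of_integrable_on[OF assms])
    then have "continuous_on {0..R} (\<lambda>x. z 0 + integral {0..x} g)"
      by (intro continuous_intros indefinite_integral_continuous_1)
    then show ?thesis
      by (rule continuous_on_eq) (metis atLeastAtMost_iff primitive_of_eq[OF assms])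
  qed
  then show ?thesis
    unfolding continuous_on_eq_continuous_within
  proof (intro ballI)
    fix x :: real assume cont: "\<And>R. \<forall>x\<in>{0..R}. continuous (at x within {0..R}) z" and x: "x \<in> {0..}"
    have "continuous (at x within {0..x+1}) z" using cont[of "x+1"] x by auto
    moreover have "at x within {0..x+1} = at x within {0..}"
      by (rule at_within_nhd[of _ "{x-1<..<x+1}"]) (use x in auto)
    ultimately show "continuous (at x within {0..}) z" by simp
  qed
qed

lemma primitive_of_add:
  assumes "primitive_of z g" "primitive_of w h"
  shows "primitive_of (\<lambda>x. z x + w x) (\<lambda>x. g x + h x)"
proof (rule primitive_ofI)
  show "integrable (lebesgue_on {0..R}) (\<lambda>x. g x + h x)" for R
    using assms by (intro Bochner_Integration.integrable_add primitive_of_integrable)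
  show "z x + w x = z 0 + w 0 + integral {0..x} (\<lambda>x. g x + h x)" if "x \<ge> 0" for x
    using primitive_of_eq[OF assms(1) that] primitive_of_eq[OF assms(2) that]
    by (subst Henstock_Kurzweil_Integration.integral_add)
      (use primitive_of_integrable_on[OF assms(1)] primitive_of_integrable_on[OF assms(2)] in simp_all)
qed

lemma primitive_of_cmult:
  assumes "primitive_of z g" shows "primitive_of (\<lambda>x. c * z x) (\<lambda>x. c * g x)"
proof (rule primitive_ofI)
  show "integrable (lebesgue_on {0..R}) (\<lambda>x. c * g x)" for R
    using primitive_of_integrable[OF assms, of R] by simp
  show "c * z x = c * z 0 + integral {0..x} (\<lambda>x. c * g x)" if "x \<ge> 0" for x
    using arg_cong[OF primitive_of_eq[OF assms that], of "\<lambda>t. c * t"] by (simp add: distrib_left)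
qed

lemma primitive_of_const: "primitive_of (\<lambda>x. c) (\<lambda>x. 0)"
  by (simp add: primitive_of_def)

lemma primitive_of_C1:
  assumes "\<And>x. x \<ge> 0 \<Longrightarrow> (F has_real_derivative f x) (at x)" "continuous_on {0..} f"
  shows "primitive_of F f"
proof -
  have cont: "continuous_on {0..R} f" for R
    by (rule continuous_on_subset[OF assms(2)]) auto
  have "F x = F 0 + integral {0..x} f" if "x \<ge> 0" for x
  proof -
    have "(f has_integral (F x - F 0)) {0..x}"
      using that assms(1)
      by (intro fundamental_theorem_of_calculus)
        (auto simp: has_real_derivative_iff_has_vector_derivative[symmetric] intro: has_field_derivative_at_within)
    then show ?thesis by (simp add: integral_unique)
  qed
  moreover have "integrable (lebesgue_on {0..R}) f" for R
    using absolutely_integrable_continuous[of 0 R f] cont[of R]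
    by (intro absolutely_integrable_imp_integrable) auto
  ultimately show ?thesis by (intro primitive_ofI)
qed

lemma integrable_mult_continuous:
  fixes g w :: "real \<Rightarrow> real"
  assumes g: "integrable (lebesgue_on {0..R}) g" and w: "continuous_on {0..R} w"
  shows "integrable (lebesgue_on {0..R}) (\<lambda>x. g x * w x :: real)"
proof -
  obtain C where C: "\<And>x. x \<in> {0..R} \<Longrightarrow> \<bar>w x\<bar> \<le> C"
    by (rule continuous_on_interval_bounded[OF w], rule that)
  have [measurable]: "w \<in> borel_measurable (lebesgue_on {0..R})"
    using w by (intro continuous_imp_measurable_on_sets_lebesgue) auto
  show ?thesis
  proof (rule Bochner_Integration.integrable_bound)
    show "integrable (lebesgue_on {0..R}) (\<lambda>x. C * g x)" using g by simp
    show "(\<lambda>x. g x * w x) \<in> borel_measurable (lebesgue_on {0..R})" using g by measurable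
    show "AE x in lebesgue_on {0..R}. norm (g x * w x) \<le> norm (C * g x)"
    proof (rule AE_I2)
      fix x assume "x \<in> space (lebesgue_on {0..R})"
      then have "\<bar>w x\<bar> \<le> \<bar>C\<bar>" using C[of x] by auto
      then show "norm (g x * w x) \<le> norm (C * g x)"
        using mult_left_mono[of "\<bar>w x\<bar>" "\<bar>C\<bar>" "\<bar>g x\<bar>"] by (simp add: abs_mult mult.commute)
    qed
  qed
qed

lemma product_integrable_lebesgue_on:
  fixes g h :: "real \<Rightarrow> real"
  assumes g: "integrable (lebesgue_on {0..R}) g" and h: "integrable (lebesgue_on {0..R}) h"
  shows "integrable (lebesgue_on {0..R} \<Otimes>\<^sub>M lebesgue_on {0..R}) (\<lambda>(x, y). g x * h y)"
proof -
  let ?M = "lebesgue_on {0..R}"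
  interpret M: finite_measure ?M by (rule finite_measure_lebesgue_on) simp
  interpret P: pair_sigma_finite ?M ?M ..
  have [measurable]: "g \<in> borel_measurable ?M" "h \<in> borel_measurable ?M" using g h by auto
  show ?thesis
  proof (rule P.Fubini_integrable)
    show "(\<lambda>(x, y). g x * h y) \<in> borel_measurable (?M \<Otimes>\<^sub>M ?M)" by measurable
    show "integrable ?M (\<lambda>x. \<integral> y. norm (case (x, y) of (x, y) \<Rightarrow> g x * h y) \<partial>?M)"
      using g by (simp add: abs_mult)
    show "AE x in ?M. integrable ?M (\<lambda>y. case (x, y) of (x, y) \<Rightarrow> g x * h y)"
      using h by simp
  qed
qed

text \<open>
  Integration by parts for two indefinite integrals. The product of the integrals is a double integral over a
  square, which splits along the diagonal into two triangles; exchanging the order of integration in one of them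
  gives the two terms on the left.
\<close>

lemma primitive_product_integral:
  fixes g h :: "real \<Rightarrow> real"
  assumes R: "R \<ge> 0" and g: "integrable (lebesgue_on {0..R}) g" and h: "integrable (lebesgue_on {0..R}) h"
  shows "integral {0..R} (\<lambda>x. g x * integral {0..x} h + h x * integral {0..x} g)
    = integral {0..R} g * integral {0..R} h"
proof -
  let ?M = "lebesgue_on {0..R}"
  interpret M: finite_measure ?M by (rule finite_measure_lebesgue_on) simp
  interpret P: pair_sigma_finite ?M ?M ..
  have [measurable]: "g \<in> borel_measurable ?M" "h \<in> borel_measurable ?M" using g h by auto
  have id[measurable]: "(\<lambda>x::real. x) \<in> borel_measurable ?M"
    by (intro continuous_imp_measurable_on_sets_lebesgue continuous_intros) auto
  have restrict: "integrable ?M (\<lambda>y. if y \<le> x then f y else 0)"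
      "(\<integral>y. (if y \<le> x then f y else 0) \<partial>?M) = integral {0..x} f"
    if f: "integrable ?M f" and x: "x \<in> {0..R}" for f :: "real \<Rightarrow> real" and x
  proof -
    have [measurable]: "f \<in> borel_measurable ?M" using f by auto
    show int: "integrable ?M (\<lambda>y. if y \<le> x then f y else 0)"
      by (rule Bochner_Integration.integrable_bound[OF f]) auto
    have "(\<integral>y. (if y \<le> x then f y else 0) \<partial>?M) = integral {0..R} (\<lambda>y. if y \<in> {..x} then f y else 0)"
      using lebesgue_integral_eq_integral[OF int] by simp
    also have "\<dots> = integral ({..x} \<inter> {0..R}) f" by (rule integral_restrict_Int)
    also have "{..x} \<inter> {0..R} = {0..x}" using x by auto
    finally show "(\<integral>y. (if y \<le> x then f y else 0) \<partial>?M) = integral {0..x} f" .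
  qed
  let ?lower = "\<lambda>x y. if y \<le> x then g x * h y else 0"
  let ?upper = "\<lambda>x y. if x \<le> y then g x * h y else 0"
  note prod = product_integrable_lebesgue_on[OF g h]
  have lower: "integrable (?M \<Otimes>\<^sub>M ?M) (case_prod ?lower)"
  proof (rule Bochner_Integration.integrable_bound[OF prod])
    show "case_prod ?lower \<in> borel_measurable (?M \<Otimes>\<^sub>M ?M)" by measurable
  qed auto
  have upper: "integrable (?M \<Otimes>\<^sub>M ?M) (case_prod ?upper)"
  proof (rule Bochner_Integration.integrable_bound[OF prod])
    show "case_prod ?upper \<in> borel_measurable (?M \<Otimes>\<^sub>M ?M)" by measurable
  qed auto
  have G: "(\<integral>x. ?upper x y \<partial>?M) = h y * integral {0..y} g" if "y \<in> {0..R}" for y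
  proof -
    have "(\<integral>x. ?upper x y \<partial>?M) = (\<integral>x. h y * (if x \<le> y then g x else 0) \<partial>?M)"
      by (intro Bochner_Integration.integral_cong) auto
    then show ?thesis using restrict(2)[OF g that] by simp
  qed
  have H: "(\<integral>y. ?lower x y \<partial>?M) = g x * integral {0..x} h" if "x \<in> {0..R}" for x
  proof -
    have "(\<integral>y. ?lower x y \<partial>?M) = (\<integral>y. g x * (if y \<le> x then h y else 0) \<partial>?M)"
      by (intro Bochner_Integration.integral_cong) auto
    then show ?thesis using restrict(2)[OF h that] by simp
  qed
  have ih: "continuous_on {0..R} (\<lambda>x. integral {0..x} h)" "continuous_on {0..R} (\<lambda>x. integral {0..x} g)"
    using g h by (auto intro!: indefinite_integral_continuous_1 integrable_on_lebesgue_on)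
  have "integral {0..R} (\<lambda>x. g x * integral {0..x} h + h x * integral {0..x} g)
      = (\<integral>x. g x * integral {0..x} h + h x * integral {0..x} g \<partial>?M)"
    by (rule lebesgue_integral_eq_integral[symmetric])
      (use ih g h in \<open>auto intro!: integrable_mult_continuous\<close>)
  also have "\<dots> = (\<integral>x. g x * integral {0..x} h \<partial>?M) + (\<integral>x. h x * integral {0..x} g \<partial>?M)"
    by (rule Bochner_Integration.integral_add) (use ih g h in \<open>auto intro!: integrable_mult_continuous\<close>)
  also have "(\<integral>x. g x * integral {0..x} h \<partial>?M) = (\<integral>x. (\<integral>y. ?lower x y \<partial>?M) \<partial>?M)"
    by (intro Bochner_Integration.integral_cong) (use H in auto)
  also have "(\<integral>x. h x * integral {0..x} g \<partial>?M) = (\<integral>y. (\<integral>x. ?upper x y \<partial>?M) \<partial>?M)"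
    by (intro Bochner_Integration.integral_cong) (use G in auto)
  also have "\<dots> = (\<integral>x. (\<integral>y. ?upper x y \<partial>?M) \<partial>?M)"
    by (rule P.Fubini_integral[OF upper])
  also have "(\<integral>x. (\<integral>y. ?lower x y \<partial>?M) \<partial>?M) + (\<integral>x. (\<integral>y. ?upper x y \<partial>?M) \<partial>?M)
      = (\<integral>p. case_prod ?lower p \<partial>(?M \<Otimes>\<^sub>M ?M)) + (\<integral>p. case_prod ?upper p \<partial>(?M \<Otimes>\<^sub>M ?M))"
    using P.integral_fst[OF lower] P.integral_fst[OF upper] by simp
  also have "\<dots> = (\<integral>p. case_prod ?lower p + case_prod ?upper p \<partial>(?M \<Otimes>\<^sub>M ?M))"
    by (rule Bochner_Integration.integral_add[symmetric, OF lower upper])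
  also have "\<dots> = (\<integral>x. (\<integral>y. ?lower x y + ?upper x y \<partial>?M) \<partial>?M)"
    using P.integral_fst'[OF Bochner_Integration.integrable_add[OF lower upper]] by simp
  also have "\<dots> = (\<integral>x. g x * (\<integral>y. h y \<partial>?M) \<partial>?M)"
  proof (intro Bochner_Integration.integral_cong refl)
    fix x :: real
    \<comment> \<open>both triangles contain the diagonal, which meets each line in a single point\<close>
    have "AE y in lebesgue. y \<notin> {x}"
      by (rule AE_not_in) (simp add: negligible_iff_null_sets[symmetric])
    then have "AE y in ?M. y \<noteq> x"
      by (subst AE_restrict_space_iff) (auto elim: eventually_mono)
    then have "AE y in ?M. ?lower x y + ?upper x y = g x * h y"
      by eventually_elim auto
    then have "(\<integral>y. ?lower x y + ?upper x y \<partial>?M) = (\<integral>y. g x * h y \<partial>?M)"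
      by (intro integral_cong_AE) auto
    then show "(\<integral>y. ?lower x y + ?upper x y \<partial>?M) = g x * (\<integral>y. h y \<partial>?M)" by simp
  qed
  also have "\<dots> = (\<integral>x. g x \<partial>?M) * (\<integral>y. h y \<partial>?M)" by simp
  also have "\<dots> = integral {0..R} g * integral {0..R} h"
    using lebesgue_integral_eq_integral[OF g] lebesgue_integral_eq_integral[OF h] by simp
  finally show ?thesis .
qed

lemma primitive_of_mult:
  assumes z: "primitive_of z g" and w: "primitive_of w h"
  shows "primitive_of (\<lambda>x. z x * w x) (\<lambda>x. g x * w x + z x * h x)"
proof -
  have cont: "continuous_on {0..R} z" "continuous_on {0..R} w" for R
    using primitive_of_continuous[OF z] primitive_of_continuous[OF w] by (auto elim: continuous_on_subset)
  have g: "integrable (lebesgue_on {0..R}) g" and h: "integrable (lebesgue_on {0..R}) h" for R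
    using z w primitive_of_integrable by blast+
  have zh: "integrable (lebesgue_on {0..R}) (\<lambda>x. z x * h x)" for R
    using integrable_mult_continuous[OF h cont(1)] by (simp add: mult.commute)
  have gw: "integrable (lebesgue_on {0..R}) (\<lambda>x. g x * w x)" for R
    by (rule integrable_mult_continuous[OF g cont(2)])
  have "z x * w x = z 0 * w 0 + integral {0..x} (\<lambda>x. g x * w x + z x * h x)" if x: "x \<ge> 0" for x
  proof -
    have zx: "z t = z 0 + integral {0..t} g" and wx: "w t = w 0 + integral {0..t} h" if "t \<ge> 0" for t
      using z w that unfolding primitive_of_def by blast+
    have ig: "g integrable_on {0..x}" and ih: "h integrable_on {0..x}"
      using g h by (auto intro: integrable_on_lebesgue_on)
    have ii: "(\<lambda>t. g t * integral {0..t} h + h t * integral {0..t} g) integrable_on {0..x}"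
      using ig ih g h
      by (intro integrable_on_lebesgue_on[where S="{0..x}"] Bochner_Integration.integrable_add
          integrable_mult_continuous indefinite_integral_continuous_1) auto
    have "integral {0..x} (\<lambda>t. g t * w t + z t * h t)
        = integral {0..x} (\<lambda>t. (w 0 * g t + z 0 * h t) + (g t * integral {0..t} h + h t * integral {0..t} g))"
    proof (rule Henstock_Kurzweil_Integration.integral_cong)
      fix t assume "t \<in> {0..x}"
      then have t: "t \<ge> 0" by simp
      show "g t * w t + z t * h t
          = (w 0 * g t + z 0 * h t) + (g t * integral {0..t} h + h t * integral {0..t} g)"
        unfolding zx[OF t] wx[OF t] by (simp add: algebra_simps)
    qed
    also have "\<dots> = integral {0..x} (\<lambda>t. w 0 * g t + z 0 * h t)
        + integral {0..x} (\<lambda>t. g t * integral {0..t} h + h t * integral {0..t} g)"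
      by (intro Henstock_Kurzweil_Integration.integral_add ii Henstock_Kurzweil_Integration.integrable_add
          integrable_on_mult_right ig ih)
    also have "integral {0..x} (\<lambda>t. w 0 * g t + z 0 * h t) = w 0 * integral {0..x} g + z 0 * integral {0..x} h"
      by (subst Henstock_Kurzweil_Integration.integral_add, rule integrable_on_mult_right[OF ig],
          rule integrable_on_mult_right[OF ih]) simp
    also note primitive_product_integral[OF x g h]
    finally show ?thesis using zx[OF x] wx[OF x] by (simp add: algebra_simps)
  qed
  then show ?thesis using zh gw by (intro primitive_ofI Bochner_Integration.integrable_add)
qed

section \<open>Weak derivatives\<close>

lemma L2_inner_tendsto:
  assumes "u \<in> L2" "\<And>n. v n \<in> L2" "w \<in> L2"
    and "(\<lambda>n. L2_sqdist (v n) w) \<longlonglongrightarrow> 0"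
  shows "(\<lambda>n. L2_inner u (v n)) \<longlonglongrightarrow> L2_inner u w"
proof -
  let ?d = "\<lambda>n x. v n x - w x"
  have "(\<lambda>n. (L2_inner u (?d n))\<^sup>2) \<longlonglongrightarrow> 0"
  proof (rule tendsto_sandwich[OF _ _ tendsto_const])
    show "\<forall>\<^sub>F n in sequentially. 0 \<le> (L2_inner u (?d n))\<^sup>2" by simp
    show "\<forall>\<^sub>F n in sequentially. (L2_inner u (?d n))\<^sup>2 \<le> L2_inner u u * L2_inner (?d n) (?d n)"
      using assms by (intro always_eventually allI L2_Cauchy_Schwarz L2_diff)
    show "(\<lambda>n. L2_inner u u * L2_inner (?d n) (?d n)) \<longlonglongrightarrow> 0"
      using tendsto_mult[OF tendsto_const assms(4), of "L2_inner u u"] by simp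
  qed
  then have "(\<lambda>n. sqrt ((L2_inner u (?d n))\<^sup>2)) \<longlonglongrightarrow> sqrt 0" by (rule tendsto_real_sqrt)
  then have "(\<lambda>n. \<bar>L2_inner u (?d n)\<bar>) \<longlonglongrightarrow> 0" by simp
  then have "(\<lambda>n. L2_inner u (?d n)) \<longlonglongrightarrow> 0" by (rule tendsto_rabs_zero_cancel)
  moreover have "L2_inner u (?d n) = L2_inner u (v n) - L2_inner u w" for n
    using assms by (intro L2_inner_diff_right)
  ultimately show ?thesis by (simp add: LIM_zero_iff)
qed

text \<open>
  Weighted polynomials vanishing at 0 are limits of test functions in \<open>H1\<close>, hence admissible in their place.
\<close>

lemma weak_deriv_expoly:
  assumes "u \<in> L2" "g \<in> L2" "has_weak_deriv u g" "b > 0" "poly p 0 = 0"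
  shows "L2_inner u (expoly b (pderiv p - smult b p)) = - L2_inner g (expoly b p)"
proof -
  obtain \<phi> where \<phi>: "\<And>n. \<phi> n \<in> test_functions"
    "(\<lambda>n. L2_sqdist (\<phi> n) (expoly b p)) \<longlonglongrightarrow> 0"
    "(\<lambda>n. L2_sqdist (deriv (\<phi> n)) (expoly b (pderiv p - smult b p))) \<longlonglongrightarrow> 0"
    by (rule expoly_test_function_approximation[OF assms(4,5)], rule that)
  have "(\<lambda>n. L2_inner u (deriv (\<phi> n))) \<longlonglongrightarrow> L2_inner u (expoly b (pderiv p - smult b p))"
    by (intro L2_inner_tendsto assms(1) test_function_L2 test_function_deriv \<phi> expoly_L2 assms(4))
  moreover have "(\<lambda>n. - L2_inner g (\<phi> n)) \<longlonglongrightarrow> - L2_inner g (expoly b p)"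
    by (intro tendsto_minus L2_inner_tendsto assms(2) test_function_L2 \<phi> expoly_L2 assms(4))
  moreover have "L2_inner u (deriv (\<phi> n)) = - L2_inner g (\<phi> n)" for n
    using assms(3) \<phi>(1) unfolding has_weak_deriv_def by blast
  ultimately show ?thesis using LIMSEQ_unique by simp
qed

text \<open>
  The difference \<open>D\<close> of two weak derivatives is orthogonal to all \<open>exp (- 2 x) x q x\<close>. So \<open>D x exp (- x) x\<close> is
  orthogonal to all \<open>exp (- x) q x\<close> and vanishes by density. The rate 2 is split into 1 for keeping the product in
  \<open>L2\<close> and 1 for the density theorem.
\<close>

lemma weak_deriv_unique:
  assumes "g \<in> L2" "h \<in> L2" "has_weak_deriv u g" "has_weak_deriv u h"
  shows "AE x in half_line. g x = h x"
proof -
  define D where "D = (\<lambda>x. g x - h x)"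
  have D: "D \<in> L2" unfolding D_def using assms by (intro L2_diff)
  have test: "L2_inner D \<phi> = 0" if "\<phi> \<in> test_functions" for \<phi>
  proof -
    have "L2_inner D \<phi> = L2_inner g \<phi> - L2_inner h \<phi>"
      unfolding D_def by (rule L2_inner_diff_left[OF assms(1,2) test_function_L2[OF that]])
    then show ?thesis using assms(3,4) that unfolding has_weak_deriv_def by fastforce
  qed
  have expoly: "L2_inner D (expoly 2 p) = 0" if p: "poly p 0 = 0" for p
  proof (rule L2_adherent_orthogonal[OF _ _ D])
    show "L2_adherent test_functions (expoly 2 p)"
      by (rule expoly_test_function_approximation[OF _ p, of 2], simp, rule L2_adherentI_tendsto)
  qed (use test test_function_L2 expoly_L2 in auto)
  let ?E = "\<lambda>x. D x * expoly 1 [:0, 1:] x"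
  obtain K where K: "K > 0" "\<And>x. x \<ge> 0 \<Longrightarrow> \<bar>expoly 1 [:0, 1:] x\<bar> \<le> K"
    using expoly_bounded[of 1 "[:0, 1:]"] by auto
  have E: "?E \<in> L2"
  proof (rule L2_bound[OF L2_cmult[OF D, of K]])
    show "?E \<in> borel_measurable half_line"
      by (intro borel_measurable_times L2_measurable[OF D] expoly_measurable)
    show "AE x in half_line. \<bar>?E x\<bar> \<le> \<bar>K * D x\<bar>"
    proof (rule AE_half_lineI)
      fix x :: real assume "x > 0"
      then show "\<bar>?E x\<bar> \<le> \<bar>K * D x\<bar>"
        using mult_left_mono[OF K(2)[of x], of "\<bar>D x\<bar>"] K(1) by (simp add: abs_mult mult.commute)
    qed
  qed
  have "AE x in half_line. ?E x = 0"
  proof (rule expoly_orthogonal_imp_zero[OF _ E])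
    fix p
    have eq: "?E x * expoly 1 p x = D x * expoly 2 ([:0, 1:] * p) x" for x
      using expoly_mult[of 1 "[:0, 1:]" x 1 p] by (simp add: mult.assoc)
    have "L2_inner ?E (expoly 1 p) = L2_inner D (expoly 2 ([:0, 1:] * p))"
      unfolding L2_inner_def eq ..
    also have "\<dots> = 0" by (rule expoly) simp
    finally show "L2_inner ?E (expoly 1 p) = 0" .
  qed simp
  moreover have "AE x in half_line. x > 0" by (rule AE_I2) simp
  ultimately show ?thesis
    by eventually_elim (simp add: D_def expoly_def)
qed

lemma expoly_tendsto_0:
  assumes "b > 0" shows "(expoly b p \<longlongrightarrow> 0) at_top"
proof -
  obtain K where K: "K > 0" "\<And>x. x \<ge> 0 \<Longrightarrow> \<bar>expoly b ([:0, 1:] * p) x\<bar> \<le> K"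
    using expoly_bounded[OF assms, of "[:0, 1:] * p"] by auto
  show ?thesis
  proof (rule Lim_null_comparison)
    show "\<forall>\<^sub>F x in at_top. norm (expoly b p x) \<le> K * inverse x"
      using eventually_gt_at_top[of 0]
    proof eventually_elim
      case (elim x)
      have "expoly b ([:0, 1:] * p) x = x * expoly b p x" by (simp add: expoly_def)
      then show ?case using K(2)[of x] elim by (simp add: abs_mult field_simps)
    qed
    show "((\<lambda>x. K * inverse x) \<longlongrightarrow> 0) at_top"
      using tendsto_mult[OF tendsto_const tendsto_inverse_0_at_top[OF filterlim_ident], of K] by simp
  qed
qed

lemma primitive_of_expoly: "primitive_of (expoly b p) (expoly b (pderiv p - smult b p))"
  by (intro primitive_of_C1 expoly_has_deriv expoly_continuous)

lemma half_line_integral_by_primitive: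
  assumes "primitive_of z g" "integrable half_line g" "(\<lambda>n. z (real n)) \<longlonglongrightarrow> l"
  shows "(LINT x|half_line. g x) = l - z 0"
proof -
  have "(\<lambda>n. integral {0..real n} g) \<longlonglongrightarrow> (LINT x|half_line. g x)"
    by (rule half_line_integral_limit[OF assms(2)])
  moreover have "(\<lambda>n. integral {0..real n} g) = (\<lambda>n. z (real n) - z 0)"
  proof
    fix n show "integral {0..real n} g = z (real n) - z 0"
      using primitive_of_eq[OF assms(1), of "real n"] by linarith
  qed
  moreover have "(\<lambda>n. z (real n) - z 0) \<longlonglongrightarrow> l - z 0" by (intro tendsto_intros assms(3))
  ultimately show ?thesis using LIMSEQ_unique by metis
qed

lemma expoly_integral_deriv:
  assumes "b > 0" shows "(LINT x|half_line. expoly b (pderiv p - smult b p) x) = - poly p 0"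
  using half_line_integral_by_primitive[OF primitive_of_expoly expoly_integrable[OF assms]
      filterlim_compose[OF expoly_tendsto_0[OF assms] filterlim_real_sequentially]]
  by (simp add: expoly_def)

text \<open>
  Linear growth is beaten by an exponential weight, so boundary terms at infinity vanish.
\<close>

lemma L2_primitive_growth:
  assumes g: "g \<in> L2" and x: "x \<ge> 0"
  shows "\<bar>integral {0..x} g\<bar> \<le> x + L2_inner g g"
proof -
  have sq: "(\<lambda>t. (g t)\<^sup>2) integrable_on {0..x}"
    using half_line_integrable_interval[OF L2_square_integrable[OF g]] by (intro integrable_on_lebesgue_on) auto
  have "norm (integral {0..x} g) \<le> integral {0..x} (\<lambda>t. 1 + (g t)\<^sup>2)"
  proof (rule integral_norm_bound_integral)
    show "g integrable_on {0..x}"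
      using L2_integrable_interval[OF g] by (intro integrable_on_lebesgue_on) auto
    show "(\<lambda>t. 1 + (g t)\<^sup>2) integrable_on {0..x}" using sq by (intro Henstock_Kurzweil_Integration.integrable_add) auto
    fix t
    have "\<bar>a\<bar> \<le> 1 + a\<^sup>2" for a :: real
      using sum_squares_bound[of "\<bar>a\<bar>" 1] by simp
    then show "norm (g t) \<le> 1 + (g t)\<^sup>2" by simp
  qed
  also have "\<dots> = x + integral {0..x} (\<lambda>t. (g t)\<^sup>2)"
    using sq x by (subst Henstock_Kurzweil_Integration.integral_add) auto
  also have "integral {0..x} (\<lambda>t. (g t)\<^sup>2) \<le> L2_inner g g"
    using interval_integral_le_half_line[OF L2_square_integrable[OF g], of x]
    by (simp add: L2_inner_def power2_eq_square)
  finally show ?thesis by simp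
qed

text \<open>
  If \<open>p\<close> is a solution for the right-hand side \<open>pderiv q\<close>, which has smaller degree, then \<open>(p - q) / b\<close> is a
  solution for \<open>q\<close>.
\<close>

lemma pderiv_shift_surj:
  fixes q :: "real poly" assumes "b \<noteq> 0" shows "\<exists>p. pderiv p - smult b p = q"
proof (induction "degree q" arbitrary: q rule: less_induct)
  case less
  show ?case
  proof (cases "degree q = 0")
    case True
    then obtain c where "q = [:c:]" by (rule degree_eq_zeroE)
    then show ?thesis using assms by (intro exI[of _ "[:- c / b:]"]) simp
  next
    case False
    then have "degree (pderiv q) < degree q" by (simp add: degree_pderiv)
    then obtain p where p: "pderiv p - smult b p = pderiv q" using less by blast
    have "pderiv (smult (1 / b) (p - q)) - smult b (smult (1 / b) (p - q)) = q"
      using assms by (simp add: pderiv_smult pderiv_diff p[symmetric] smult_diff_right)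
    then show ?thesis by blast
  qed
qed

text \<open>
  A pair consisting of the continuous representative of a function in \<open>H1\<close> and a version of its derivative.
\<close>

definition h1_pair :: "(real \<Rightarrow> real) \<Rightarrow> (real \<Rightarrow> real) \<Rightarrow> bool" where
  "h1_pair z g \<longleftrightarrow> z \<in> L2 \<and> g \<in> L2 \<and> primitive_of z g"

text \<open>
  Let \<open>G\<close> be the primitive of \<open>g\<close> that vanishes at 0. By partial integration \<open>u - G\<close> is orthogonal to the
  derivatives of all weighted polynomials vanishing at 0, a subspace of codimension 1 in the weighted polynomials.
  A suitable constant \<open>c\<close> makes \<open>u - G - c\<close> orthogonal to all of them. As \<open>G\<close> need not belong to \<open>L2\<close>, the
  rate 2 is again split into two halves before the density theorem is applied.
\<close>

lemma weak_deriv_imp_primitive: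
  assumes u: "u \<in> L2" and g: "g \<in> L2" and weak: "has_weak_deriv u g"
  obtains z where "h1_pair z g" "AE x in half_line. u x = z x"
proof -
  define G where "G x = integral {0..x} g" for x
  have G: "primitive_of G g"
    by (rule primitive_ofI) (auto simp: G_def intro: L2_integrable_interval g)
  define C where "C = L2_inner g g"
  have growth: "\<bar>G x\<bar> \<le> x + C" if "x \<ge> 0" for x
    using L2_primitive_growth[OF g that] by (simp add: G_def C_def)
  have meas_G: "G \<in> borel_measurable half_line"
    by (intro continuous_imp_measurable_half_line continuous_on_subset[OF primitive_of_continuous[OF G]]) auto
  have GL2: "(\<lambda>x. G x * expoly b p x) \<in> L2" if "b > 0" for b p
  proof (rule L2_bound[OF expoly_L2[OF that, of "[:C, 1:] * p"]])
    show "(\<lambda>x. G x * expoly b p x) \<in> borel_measurable half_line"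
      by (intro borel_measurable_times meas_G expoly_measurable)
    show "AE x in half_line. \<bar>G x * expoly b p x\<bar> \<le> \<bar>expoly b ([:C, 1:] * p) x\<bar>"
    proof (rule AE_half_lineI)
      fix x :: real assume "x > 0"
      then have "\<bar>G x\<bar> \<le> \<bar>C + x\<bar>" using growth[of x] by simp
      then have "\<bar>G x\<bar> * \<bar>expoly b p x\<bar> \<le> \<bar>C + x\<bar> * \<bar>expoly b p x\<bar>" by (rule mult_right_mono) simp
      then show "\<bar>G x * expoly b p x\<bar> \<le> \<bar>expoly b ([:C, 1:] * p) x\<bar>"
        by (simp add: expoly_def abs_mult[symmetric] mult_ac algebra_simps)
    qed
  qed
  have G_tendsto: "(\<lambda>n. G (real n) * expoly b p (real n)) \<longlonglongrightarrow> 0" if "b > 0" for b p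
  proof (rule Lim_null_comparison)
    show "(\<lambda>n. \<bar>expoly b ([:C, 1:] * p) (real n)\<bar>) \<longlonglongrightarrow> 0"
      by (intro tendsto_rabs_zero filterlim_compose[OF expoly_tendsto_0[OF that] filterlim_real_sequentially])
    show "\<forall>\<^sub>F n in sequentially. norm (G (real n) * expoly b p (real n)) \<le> \<bar>expoly b ([:C, 1:] * p) (real n)\<bar>"
    proof (intro always_eventually allI)
      fix n :: nat
      have "\<bar>G n\<bar> \<le> \<bar>C + n\<bar>" using growth[of n] by simp
      then have "\<bar>G n\<bar> * \<bar>expoly b p n\<bar> \<le> \<bar>C + n\<bar> * \<bar>expoly b p n\<bar>" by (rule mult_right_mono) simp
      then show "norm (G n * expoly b p n) \<le> \<bar>expoly b ([:C, 1:] * p) n\<bar>"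
        by (simp add: expoly_def abs_mult[symmetric] mult_ac algebra_simps)
    qed
  qed
  have split: "expoly 2 p x = expoly 1 1 x * expoly 1 p x" for p x
    by (simp add: expoly_mult)
  have intG: "integrable half_line (\<lambda>x. G x * expoly 2 p x)" for p
    using L2_mult_integrable[OF GL2[of 1 1] expoly_L2[of 1 p]] by (simp add: split mult.assoc)
  have intu: "integrable half_line (\<lambda>x. u x * expoly 2 p x)"
    and intg: "integrable half_line (\<lambda>x. g x * expoly 2 p x)" for p
    using u g by (auto intro!: L2_mult_integrable expoly_L2)
  let ?d = "\<lambda>p. pderiv p - smult 2 p"
  have zero: "(LINT x|half_line. (u x - G x) * expoly 2 (?d p) x) = 0" if p: "poly p 0 = 0" for p
  proof -
    have "(LINT x|half_line. g x * expoly 2 p x + G x * expoly 2 (?d p) x) = 0 - G 0 * expoly 2 p 0"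
      by (rule half_line_integral_by_primitive[OF primitive_of_mult[OF G primitive_of_expoly]])
        (use intG intg G_tendsto in auto)
    then have "(LINT x|half_line. G x * expoly 2 (?d p) x) = - L2_inner g (expoly 2 p)"
      using intG intg by (simp add: G_def L2_inner_def)
    moreover have "(LINT x|half_line. u x * expoly 2 (?d p) x) = - L2_inner g (expoly 2 p)"
      using weak_deriv_expoly[OF u g weak _ p, of 2] by (simp add: L2_inner_def)
    ultimately show ?thesis
      using intG intu by (simp add: left_diff_distrib)
  qed
  \<comment> \<open>the factor 2 normalises the weight \<open>exp (- 2 x)\<close> to mean value 1\<close>
  define c where "c = 2 * (LINT x|half_line. (u x - G x) * expoly 2 1 x)"
  have exp_int: "(LINT x|half_line. expoly 2 1 x) = 1 / 2"
    using expoly_integral_deriv[of 2 "[:- 1 / 2:]"] by (simp add: one_pCons)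
  have intd: "integrable half_line (\<lambda>x. (u x - G x) * expoly 2 p x)" for p
    using intu intG by (simp add: left_diff_distrib)
  have intc: "integrable half_line (\<lambda>x. (u x - G x - c) * expoly 2 p x)" for p
    using intd expoly_integrable[of 2 p] by (simp add: left_diff_distrib[of "u x - G x" c for x])
  have orth: "(LINT x|half_line. (u x - G x - c) * expoly 2 q x) = 0" for q
  proof -
    obtain p0 where p0: "?d p0 = q" using pderiv_shift_surj[of 2 q] by auto
    define p where "p = p0 - [:poly p0 0:]"
    \<comment> \<open>removing the constant term of \<open>p0\<close> changes the weighted derivative by a multiple of the weight itself\<close>
    define \<kappa> where "\<kappa> = - 2 * poly p0 0"
    have q: "expoly 2 q x = expoly 2 (?d p) x + \<kappa> * expoly 2 1 x" for x
      by (simp add: p0[symmetric] p_def \<kappa>_def expoly_def pderiv_diff pderiv_pCons algebra_simps)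
    have p: "poly p 0 = 0" by (simp add: p_def)
    have "(LINT x|half_line. (u x - G x - c) * expoly 2 r x)
        = (LINT x|half_line. (u x - G x) * expoly 2 r x) - c * (LINT x|half_line. expoly 2 r x)" for r
      using intd[of r] expoly_integrable[of 2 r] by (simp add: left_diff_distrib[of "u x - G x" c for x])
    note eq = this
    have "(LINT x|half_line. (u x - G x - c) * expoly 2 (?d p) x) = 0"
      unfolding eq zero[OF p] using expoly_integral_deriv[of 2 p] p by simp
    moreover have "(LINT x|half_line. (u x - G x - c) * expoly 2 1 x) = 0"
      unfolding eq exp_int by (simp add: c_def)
    moreover have "(u x - G x - c) * expoly 2 q x
        = (u x - G x - c) * expoly 2 (?d p) x + \<kappa> * ((u x - G x - c) * expoly 2 1 x)" for x
      unfolding q by (simp add: algebra_simps)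
    ultimately show ?thesis using intc by simp
  qed
  let ?D = "\<lambda>x. (u x - G x - c) * expoly 1 1 x"
  have D: "?D \<in> L2"
  proof -
    have "(\<lambda>x. u x * expoly 1 1 x) \<in> L2"
    proof (rule L2_bound[OF u])
      show "(\<lambda>x. u x * expoly 1 1 x) \<in> borel_measurable half_line"
        by (intro borel_measurable_times L2_measurable[OF u] expoly_measurable)
      show "AE x in half_line. \<bar>u x * expoly 1 1 x\<bar> \<le> \<bar>u x\<bar>"
        by (rule AE_I2) (simp add: abs_mult expoly_def mult_left_le)
    qed
    then have "(\<lambda>x. u x * expoly 1 1 x - G x * expoly 1 1 x - c * expoly 1 1 x) \<in> L2"
      by (intro L2_diff GL2 L2_cmult expoly_L2) auto
    then show ?thesis by (simp add: left_diff_distrib)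
  qed
  have "AE x in half_line. ?D x = 0"
  proof (rule expoly_orthogonal_imp_zero[OF _ D])
    fix p
    have eq: "?D x * expoly 1 p x = (u x - G x - c) * expoly 2 p x" for x
      unfolding split by simp
    show "L2_inner ?D (expoly 1 p) = 0" unfolding L2_inner_def eq by (rule orth)
  qed simp
  then have ae: "AE x in half_line. u x = c + G x"
    by eventually_elim (simp add: expoly_def)
  have "(\<lambda>x. c + G x) \<in> L2"
    by (rule L2_cong_AE[OF u]) (use meas_G ae in \<open>auto elim: eventually_mono\<close>)
  moreover have "primitive_of (\<lambda>x. c + G x) g"
    using primitive_of_add[OF primitive_of_const G] by simp
  ultimately show ?thesis using that ae g unfolding h1_pair_def by blast
qed

lemma h1_pair_has_weak_deriv:
  assumes "h1_pair z g" shows "has_weak_deriv z g"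
  unfolding has_weak_deriv_def
proof
  fix \<phi> assume \<phi>: "\<phi> \<in> test_functions"
  obtain R where R: "R > 0" "\<And>x. x \<le> 0 \<Longrightarrow> \<phi> x = 0" "\<And>x. x \<ge> R \<Longrightarrow> \<phi> x = 0"
    using test_function_support[OF \<phi>] by blast
  have z: "z \<in> L2" "g \<in> L2" "primitive_of z g" using assms by (auto simp: h1_pair_def)
  have int: "integrable half_line (\<lambda>x. g x * \<phi> x)" "integrable half_line (\<lambda>x. z x * deriv \<phi> x)"
    using z \<phi> by (auto intro!: L2_mult_integrable test_function_L2 test_function_deriv)
  have prim: "primitive_of \<phi> (deriv \<phi>)"
    by (intro primitive_of_C1 test_function_has_deriv[OF \<phi>] test_function_continuous test_function_deriv \<phi>)
  obtain m :: nat where m: "R \<le> m" using real_arch_simple by blast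
  have "(LINT x|half_line. g x * \<phi> x + z x * deriv \<phi> x) = 0 - z 0 * \<phi> 0"
  proof (rule half_line_integral_by_primitive[OF primitive_of_mult[OF z(3) prim]])
    show "integrable half_line (\<lambda>x. g x * \<phi> x + z x * deriv \<phi> x)" using int by simp
    have "z (real n) * \<phi> (real n) = 0" if "n \<ge> m" for n
      using R(3)[of "real n"] that m by simp
    then show "(\<lambda>n. z (real n) * \<phi> (real n)) \<longlonglongrightarrow> 0"
      by (intro tendsto_eventually eventually_sequentiallyI[of m])
  qed
  then show "L2_inner z (deriv \<phi>) = - L2_inner g \<phi>"
    using int R(2)[of 0] by (simp add: L2_inner_def)
qed

lemma h1_pair_square_integral:
  assumes "h1_pair z g" "x \<ge> 0"
  shows "(z x)\<^sup>2 = (z 0)\<^sup>2 + integral {0..x} (\<lambda>t. 2 * (z t * g t))"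
proof -
  have z: "primitive_of z g" using assms by (auto simp: h1_pair_def)
  show ?thesis
    using primitive_of_eq[OF primitive_of_mult[OF z z] assms(2)]
    by (simp add: power2_eq_square mult.commute)
qed

text \<open>
  Since \<open>z\<close> vanishes at 0, its square is the integral of \<open>2 z z'\<close>, which is at most that of \<open>z\<^sup>2 + z'\<^sup>2\<close>.
\<close>

lemma h1_pair_pointwise_bound:
  assumes zg: "h1_pair z g" and z0: "z 0 = 0" and x: "x \<ge> 0"
  shows "(z x)\<^sup>2 \<le> L2_inner g g + L2_inner z z"
proof -
  have L2: "z \<in> L2" "g \<in> L2" using zg by (auto simp: h1_pair_def)
  let ?s = "\<lambda>t. (g t)\<^sup>2 + (z t)\<^sup>2"
  have int: "integrable half_line ?s" using L2 by (auto simp: L2_def)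
  have on: "?s integrable_on {0..R}" for R
    using half_line_integrable_interval[OF int] by (intro integrable_on_lebesgue_on) auto
  have "(z x)\<^sup>2 = integral {0..x} (\<lambda>t. 2 * (z t * g t))"
    using h1_pair_square_integral[OF zg x] z0 by simp
  also have "\<dots> \<le> integral {0..x} ?s"
  proof (rule integral_le)
    have "integrable half_line (\<lambda>t. 2 * (z t * g t))" using L2_mult_integrable[OF L2] by simp
    then show "(\<lambda>t. 2 * (z t * g t)) integrable_on {0..x}"
      using half_line_integrable_interval by (intro integrable_on_lebesgue_on) auto
    show "2 * (z t * g t) \<le> ?s t" for t
      using sum_squares_bound[of "z t" "g t"] by (simp add: mult.assoc)
  qed (rule on)
  also have "\<dots> \<le> (LINT t|half_line. ?s t)"
    by (rule interval_integral_le_half_line[OF int]) simp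
  also have "\<dots> = L2_inner g g + L2_inner z z"
    using L2 by (simp add: L2_def L2_inner_def power2_eq_square)
  finally show ?thesis .
qed

text \<open>
  The integral of \<open>2 z z'\<close> over \<open>{0..n}\<close> is \<open>(z n)\<^sup>2\<close>. The nonnegative sign passes to
  the limit.
\<close>

lemma h1_pair_inner_nonneg:
  assumes zg: "h1_pair z g" and z0: "z 0 = 0" shows "0 \<le> L2_inner z g"
proof -
  have int: "integrable half_line (\<lambda>t. 2 * (z t * g t))"
    using zg L2_mult_integrable[of z g] by (simp add: h1_pair_def)
  have "0 \<le> (LINT t|half_line. 2 * (z t * g t))"
  proof (rule LIMSEQ_le_const[OF half_line_integral_limit[OF int]])
    have "integral {0..real n} (\<lambda>t. 2 * (z t * g t)) = (z (real n))\<^sup>2" for n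
      using h1_pair_square_integral[OF zg, of "real n"] z0 by simp
    then show "\<exists>N. \<forall>n\<ge>N. 0 \<le> integral {0..real n} (\<lambda>t. 2 * (z t * g t))" by simp
  qed
  then show ?thesis by (simp add: L2_inner_def)
qed

text \<open>
  Completing the square: the cross term of \<open>(z' + a z)\<^sup>2\<close> has a nonnegative integral.
\<close>

lemma h1_pair_norm_bound:
  assumes zg: "h1_pair z g" and z0: "z 0 = 0" and a: "a > 0"
  shows "L2_inner g g + a\<^sup>2 * L2_inner z z \<le> L2_inner (\<lambda>x. g x + a * z x) (\<lambda>x. g x + a * z x)"
proof -
  have L2: "z \<in> L2" "g \<in> L2" using zg by (auto simp: h1_pair_def)
  have "L2_inner (\<lambda>x. g x + a * z x) (\<lambda>x. g x + a * z x)
      = L2_inner g g + 2 * a * L2_inner z g + a\<^sup>2 * L2_inner z z"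
    using L2_inner_self_add[OF L2(2) L2_cmult[OF L2(1), of a]] L2_inner_commute[of z g]
    by (simp add: L2_inner_cmult_left L2_inner_cmult_right power2_eq_square)
  then show ?thesis using h1_pair_inner_nonneg[OF zg z0] a by simp
qed

lemma h1_pair_expoly: "b > 0 \<Longrightarrow> h1_pair (expoly b p) (expoly b (pderiv p - smult b p))"
  by (simp add: h1_pair_def expoly_L2 primitive_of_expoly)

lemma h1_pair_add:
  "h1_pair z g \<Longrightarrow> h1_pair w h \<Longrightarrow> h1_pair (\<lambda>x. z x + w x) (\<lambda>x. g x + h x)"
  by (simp add: h1_pair_def L2_add primitive_of_add)

lemma h1_pair_cmult: "h1_pair z g \<Longrightarrow> h1_pair (\<lambda>x. c * z x) (\<lambda>x. c * g x)"
  by (simp add: h1_pair_def L2_cmult primitive_of_cmult)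

lemma h1_pair_diff:
  assumes "h1_pair z g" "h1_pair w h" shows "h1_pair (\<lambda>x. z x - w x) (\<lambda>x. g x - h x)"
  using h1_pair_add[OF assms(1) h1_pair_cmult[OF assms(2), of "- 1"]] by simp

text \<open>
  The operator \<open>z \<mapsto> z' + a z\<close> maps \<open>exp (- a x) p x\<close> to \<open>exp (- a x) p' x\<close>. So an approximation of
  \<open>g + a z\<close> in \<open>L2\<close> by \<open>exp (- a x) q x\<close> is turned into one of \<open>z\<close> in \<open>H1\<close> by the polynomial primitive of
  \<open>q\<close> that vanishes at 0.
\<close>

theorem h1_pair_expoly_approximation:
  assumes zg: "h1_pair z g" and z0: "z 0 = 0" and a: "a > 0" and e: "e > 0"
  obtains p where "poly p 0 = 0"
    "L2_sqdist g (expoly a (pderiv p - smult a p))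
     + L2_sqdist z (expoly a p) < e"
proof -
  define e' where "e' = e * min 1 (a\<^sup>2)"
  have e': "e' > 0" using e a by (simp add: e'_def)
  have L2: "(\<lambda>x. g x + a * z x) \<in> L2"
    using zg by (intro L2_add L2_cmult) (auto simp: h1_pair_def)
  obtain q where q: "L2_inner (\<lambda>x. expoly a q x - (g x + a * z x)) (\<lambda>x. expoly a q x - (g x + a * z x)) < e'"
    using expoly_dense[OF a L2] e' unfolding L2_adherent_def by blast
  obtain p where p: "pderiv p = q" "poly p 0 = 0"
  proof -
    have "\<exists>p. pderiv p = q"
    proof (intro exI poly_eqI)
      fix n
      have "coeff (\<Sum>i\<le>degree q. monom (coeff q i / real (Suc i)) (Suc i)) (Suc n)
          = (\<Sum>i\<le>degree q. if i = n then coeff q n / real (Suc n) else 0)"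
        unfolding coeff_sum by (intro sum.cong) auto
      then show "coeff (pderiv (\<Sum>i\<le>degree q. monom (coeff q i / real (Suc i)) (Suc i))) n = coeff q n"
        by (auto simp: coeff_pderiv coeff_eq_0 simp del: of_nat_Suc)
    qed
    then obtain p0 where p0: "pderiv p0 = q" ..
    show ?thesis
      by (rule that[of "p0 - [:poly p0 0:]"]) (simp_all add: pderiv_diff pderiv_pCons p0)
  qed
  let ?d = "pderiv p - smult a p"
  have pair: "h1_pair (\<lambda>x. z x - expoly a p x) (\<lambda>x. g x - expoly a ?d x)"
    by (intro h1_pair_diff zg h1_pair_expoly a)
  let ?A = "L2_sqdist g (expoly a ?d)"
  let ?B = "L2_sqdist z (expoly a p)"
  have "?A + a\<^sup>2 * ?B \<le> L2_inner (\<lambda>x. (g x - expoly a ?d x) + a * (z x - expoly a p x))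
      (\<lambda>x. (g x - expoly a ?d x) + a * (z x - expoly a p x))"
    by (rule h1_pair_norm_bound[OF pair _ a]) (simp add: z0 p expoly_def)
  also have "\<dots> = L2_inner (\<lambda>x. expoly a q x - (g x + a * z x)) (\<lambda>x. expoly a q x - (g x + a * z x))"
  proof -
    have "(g x - expoly a ?d x) + a * (z x - expoly a p x) = - (expoly a q x - (g x + a * z x))" for x
      by (simp add: p(1)[symmetric] expoly_def algebra_simps)
    then show ?thesis by (simp only: L2_inner_def minus_mult_minus)
  qed
  also note q
  finally have "?A + a\<^sup>2 * ?B < e'" .
  moreover have "min 1 (a\<^sup>2) * (?A + ?B) \<le> ?A + a\<^sup>2 * ?B"
    unfolding distrib_left
    using L2_inner_self_nonneg[of "\<lambda>x. g x - expoly a ?d x"] L2_inner_self_nonneg[of "\<lambda>x. z x - expoly a p x"]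
    by (intro add_mono mult_left_le_one_le mult_right_mono) auto
  ultimately have "min 1 (a\<^sup>2) * (?A + ?B) < min 1 (a\<^sup>2) * e" by (simp add: e'_def mult.commute)
  then have "?A + ?B < e" using a by (simp add: mult_less_cancel_left_pos)
  then show ?thesis using that p(2) by blast
qed

section \<open>Laguerre polynomials\<close>

text \<open>
  The Laguerre polynomials with the parameters \<open>\<alpha> = 0\<close> and \<open>\<alpha> = -1\<close>, evaluated at \<open>\<beta> x\<close>. The orthogonality
  relations rest on \<open>lag_neg1_Suc\<close> and \<open>pderiv_lag_neg1_Suc\<close>, which tie the two families together.
\<close>

definition lag0 :: "real \<Rightarrow> nat \<Rightarrow> real poly" where
  "lag0 \<beta> m = (\<Sum>i\<le>m. monom ((- \<beta>) ^ i * real (m choose i) / fact i) i)"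

definition lag_neg1 :: "real \<Rightarrow> nat \<Rightarrow> real poly" where
  "lag_neg1 \<beta> m = (\<Sum>i\<le>m. monom ((- \<beta>) ^ i * (pochhammer (real i) (m - i) / (fact (m - i) * fact i))) i)"

lemma laguerre_fun_eq_expoly: "laguerre_fun (- 1) \<beta> m = expoly (\<beta> / 2) (lag_neg1 \<beta> m)"
proof
  fix x
  have power: "(- (\<beta> * x)) ^ i = (- \<beta>) ^ i * x ^ i" for i
    by (metis mult_minus_left power_mult_distrib)
  show "laguerre_fun (- 1) \<beta> m x = expoly (\<beta> / 2) (lag_neg1 \<beta> m) x"
    by (simp add: laguerre_fun_def laguerre_def expoly_def lag_neg1_def poly_sum poly_monom power mult_ac)
qed

lemma coeff_lag0: "coeff (lag0 \<beta> m) i = (- \<beta>) ^ i * real (m choose i) / fact i"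
proof -
  have "coeff (lag0 \<beta> m) i = (\<Sum>j\<le>m. if j = i then (- \<beta>) ^ i * real (m choose i) / fact i else 0)"
    unfolding lag0_def coeff_sum by (intro sum.cong) auto
  then show ?thesis by simp
qed

lemma coeff_lag_neg1:
  "coeff (lag_neg1 \<beta> m) i = (if i \<le> m then (- \<beta>) ^ i * (pochhammer (real i) (m - i) / (fact (m - i) * fact i)) else 0)"
proof -
  have "coeff (lag_neg1 \<beta> m) i = (\<Sum>j\<le>m. if j = i then
      (- \<beta>) ^ i * (pochhammer (real i) (m - i) / (fact (m - i) * fact i)) else 0)"
    unfolding lag_neg1_def coeff_sum by (intro sum.cong) auto
  then show ?thesis by simp
qed

lemma coeff_lag_neg1_Suc_0: "coeff (lag_neg1 \<beta> (Suc k)) 0 = 0"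
  by (simp add: coeff_lag_neg1 pochhammer_0_left)

lemma coeff_lag_neg1_Suc_Suc:
  "coeff (lag_neg1 \<beta> (Suc k)) (Suc j) = (- \<beta>) ^ Suc j * real (k choose j) / fact (Suc j)"
proof (cases "j \<le> k")
  case True
  have "pochhammer 1 (j + (k - j)) = (pochhammer 1 j * pochhammer (1 + real j) (k - j) :: real)"
    by (rule pochhammer_product') 
  then have "pochhammer (real (Suc j)) (k - j) = fact k / fact j"
    using True by (simp add: pochhammer_fact[symmetric] field_simps)
  then show ?thesis using True by (simp add: coeff_lag_neg1 binomial_fact del: of_nat_Suc fact_Suc)
qed (simp add: coeff_lag_neg1)

lemma lag_neg1_0: "lag_neg1 \<beta> 0 = 1" and lag0_0: "lag0 \<beta> 0 = 1"
  by (simp_all add: lag_neg1_def lag0_def)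

lemma lag_neg1_Suc: "lag_neg1 \<beta> (Suc k) = lag0 \<beta> (Suc k) - lag0 \<beta> k"
proof (rule poly_eqI)
  fix i show "coeff (lag_neg1 \<beta> (Suc k)) i = coeff (lag0 \<beta> (Suc k) - lag0 \<beta> k) i"
    by (cases i) (simp_all add: coeff_lag_neg1_Suc_0 coeff_lag_neg1_Suc_Suc coeff_lag0 algebra_simps add_divide_distrib diff_divide_distrib
      del: fact_Suc)
qed

lemma pderiv_lag_neg1_Suc: "pderiv (lag_neg1 \<beta> (Suc k)) = smult (- \<beta>) (lag0 \<beta> k)"
proof (rule poly_eqI)
  fix i
  have "real (Suc i) * ((- \<beta>) ^ Suc i * real (k choose i) / (real (Suc i) * fact i))
      = - \<beta> * ((- \<beta>) ^ i * real (k choose i) / fact i)"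
    by simp
  then show "coeff (pderiv (lag_neg1 \<beta> (Suc k))) i = coeff (smult (- \<beta>) (lag0 \<beta> k)) i"
    unfolding coeff_pderiv coeff_lag_neg1_Suc_Suc coeff_smult coeff_lag0 fact_Suc by simp
qed

lemma degree_lag0: "degree (lag0 \<beta> m) \<le> m"
  by (rule degree_le) (simp add: coeff_lag0)

lemma degree_lag_neg1: "degree (lag_neg1 \<beta> m) \<le> m"
  by (rule degree_le) (simp add: coeff_lag_neg1)

lemma poly_lag_neg1_Suc_0: "poly (lag_neg1 \<beta> (Suc k)) 0 = 0"
  by (simp add: poly_0_coeff_0 coeff_lag_neg1_Suc_0)

lemma coeff_lag_neg1_top: "\<beta> \<noteq> 0 \<Longrightarrow> coeff (lag_neg1 \<beta> m) m \<noteq> 0"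
  by (simp add: coeff_lag_neg1)

section \<open>Orthogonality of the Laguerre polynomials\<close>

text \<open>
  The functional whose value at \<open>p * q\<close> is the \<open>L2\<close> inner product of the weighted polynomials with the rate
  \<open>\<beta> / 2\<close>.
\<close>

definition exp_mean :: "real \<Rightarrow> real poly \<Rightarrow> real" where
  "exp_mean \<beta> p = (LINT x|half_line. expoly \<beta> p x)"

lemma exp_mean_add: "\<beta> > 0 \<Longrightarrow> exp_mean \<beta> (p + q) = exp_mean \<beta> p + exp_mean \<beta> q"
  and exp_mean_diff: "\<beta> > 0 \<Longrightarrow> exp_mean \<beta> (p - q) = exp_mean \<beta> p - exp_mean \<beta> q"
  and exp_mean_smult: "exp_mean \<beta> (smult c p) = c * exp_mean \<beta> p"
  by (simp_all add: exp_mean_def expoly_add expoly_diff expoly_smult expoly_integrable)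

lemma exp_mean_0: "exp_mean \<beta> 0 = 0"
  using exp_mean_smult[of \<beta> 0 0] by simp

lemma exp_mean_by_parts:
  assumes "\<beta> > 0" shows "\<beta> * exp_mean \<beta> p = poly p 0 + exp_mean \<beta> (pderiv p)"
proof -
  have "exp_mean \<beta> (pderiv p) - \<beta> * exp_mean \<beta> p = - poly p 0"
    using expoly_integral_deriv[OF assms, of p] exp_mean_diff[OF assms, of "pderiv p" "smult \<beta> p"]
    by (simp add: exp_mean_smult) (simp add: exp_mean_def)
  then show ?thesis by simp
qed

lemma L2_inner_expoly: "L2_inner (expoly (\<beta> / 2) p) (expoly (\<beta> / 2) q) = exp_mean \<beta> (p * q)"
  by (simp add: L2_inner_def exp_mean_def expoly_mult)

text \<open>
  Integrating \<open>lag_neg1 \<beta> (k + 1) * p\<close> by parts produces no boundary term. As the derivative of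
  \<open>lag_neg1 \<beta> (k + 1)\<close> is \<open>- \<beta> lag0 \<beta> k\<close>, the relation transfers a derivative to \<open>p\<close>.
\<close>

lemma exp_mean_lag0_Suc:
  assumes "\<beta> > 0"
  shows "\<beta> * exp_mean \<beta> (lag0 \<beta> (Suc k) * p) = exp_mean \<beta> (lag_neg1 \<beta> (Suc k) * pderiv p)"
proof -
  have "\<beta> * exp_mean \<beta> (lag_neg1 \<beta> (Suc k) * p)
      = exp_mean \<beta> (lag_neg1 \<beta> (Suc k) * pderiv p) - \<beta> * exp_mean \<beta> (lag0 \<beta> k * p)"
    using exp_mean_by_parts[OF assms, of "lag_neg1 \<beta> (Suc k) * p"] assms
      exp_mean_add[OF assms, of "lag_neg1 \<beta> (Suc k) * pderiv p" "smult (- \<beta>) (lag0 \<beta> k * p)"]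
      exp_mean_smult[of \<beta> "- \<beta>" "lag0 \<beta> k * p"]
    by (simp add: poly_lag_neg1_Suc_0 pderiv_mult pderiv_lag_neg1_Suc mult.commute)
  moreover have "exp_mean \<beta> (lag_neg1 \<beta> (Suc k) * p)
      = exp_mean \<beta> (lag0 \<beta> (Suc k) * p) - exp_mean \<beta> (lag0 \<beta> k * p)"
    using exp_mean_diff[OF assms] by (simp add: lag_neg1_Suc left_diff_distrib)
  ultimately show ?thesis by (simp add: right_diff_distrib)
qed

text \<open>
  Each application of \<open>exp_mean_lag0_Suc\<close> lowers the degree of \<open>p\<close> by 1 and the index by at most 1, until \<open>p\<close> is
  differentiated away.
\<close>

lemma lag0_orthogonal_low_degree:
  assumes "\<beta> > 0" "degree p < m" shows "exp_mean \<beta> (lag0 \<beta> m * p) = 0"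
proof -
  have "\<forall>m>n. degree p \<le> n \<longrightarrow> exp_mean \<beta> (lag0 \<beta> m * p) = 0" for n
  proof (induction n arbitrary: p)
    case 0
    show ?case
    proof (intro allI impI)
      fix m :: nat assume m: "m > 0" and "degree p \<le> 0"
      then have "pderiv p = 0" by (simp add: pderiv_eq_0_iff)
      then show "exp_mean \<beta> (lag0 \<beta> m * p) = 0"
        using exp_mean_lag0_Suc[OF assms(1), of "m - 1" p] m assms(1) by (simp add: exp_mean_0)
    qed
  next
    case (Suc n)
    show ?case
    proof (intro allI impI)
      fix m assume m: "m > Suc n" and deg: "degree p \<le> Suc n"
      then obtain k where k: "m = Suc k" "k > n" by (cases m) auto
      have "degree (pderiv p) \<le> n" using deg by (simp add: degree_pderiv)
      then have "exp_mean \<beta> (lag0 \<beta> (Suc k) * pderiv p) = 0" "exp_mean \<beta> (lag0 \<beta> k * pderiv p) = 0"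
        using Suc.IH[of "pderiv p"] k by auto
      then show "exp_mean \<beta> (lag0 \<beta> m * p) = 0"
        using exp_mean_lag0_Suc[OF assms(1), of k p] assms(1) exp_mean_diff[OF assms(1)]
        by (simp add: k lag_neg1_Suc left_diff_distrib)
    qed
  qed
  then show ?thesis using assms(2) by blast
qed

lemma lag0_norm: 
  assumes "\<beta> > 0" shows "\<beta> * exp_mean \<beta> (lag0 \<beta> m * lag0 \<beta> m) = 1"
proof (induction m)
  case 0
  then show ?case using exp_mean_by_parts[OF assms, of 1] by (simp add: lag0_0 exp_mean_0)
next
  case (Suc m)
  have low: "exp_mean \<beta> (lag0 \<beta> k * pderiv (lag0 \<beta> k)) = 0" for k
  proof (cases k)
    case 0 then show ?thesis by (simp add: lag0_0 exp_mean_0)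
  next
    case (Suc j)
    have "degree (pderiv (lag0 \<beta> k)) < k" using degree_lag0[of \<beta> k] Suc by (simp add: degree_pderiv)
    then show ?thesis by (rule lag0_orthogonal_low_degree[OF assms])
  qed
  have d: "pderiv (lag0 \<beta> (Suc m)) = pderiv (lag0 \<beta> m) - smult \<beta> (lag0 \<beta> m)"
    using pderiv_lag_neg1_Suc[of \<beta> m] by (simp add: lag_neg1_Suc pderiv_diff algebra_simps)
  have "\<beta> * exp_mean \<beta> (lag0 \<beta> (Suc m) * lag0 \<beta> (Suc m))
      = exp_mean \<beta> (lag0 \<beta> (Suc m) * pderiv (lag0 \<beta> (Suc m))) - exp_mean \<beta> (lag0 \<beta> m * pderiv (lag0 \<beta> (Suc m)))"
    using exp_mean_lag0_Suc[OF assms, of m "lag0 \<beta> (Suc m)"] exp_mean_diff[OF assms]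
    by (simp add: lag_neg1_Suc left_diff_distrib)
  also have "\<dots> = - (exp_mean \<beta> (lag0 \<beta> m * pderiv (lag0 \<beta> m)) - \<beta> * exp_mean \<beta> (lag0 \<beta> m * lag0 \<beta> m))"
    unfolding low[of "Suc m"]
    unfolding d right_diff_distrib mult_smult_right exp_mean_diff[OF assms] exp_mean_smult by simp
  also have "\<dots> = 1" unfolding low Suc by simp
  finally show ?case .
qed

lemma lag0_orthogonal:
  assumes "\<beta> > 0" shows "exp_mean \<beta> (lag0 \<beta> m * lag0 \<beta> n) = (if m = n then 1 / \<beta> else 0)"
proof -
  consider "m = n" | "n < m" | "m < n" by linarith
  then show ?thesis
  proof cases
    case 1 then show ?thesis using lag0_norm[OF assms, of n] assms by (simp add: field_simps)
  next
    case 2 then show ?thesis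
      using lag0_orthogonal_low_degree[OF assms, of "lag0 \<beta> n" m] degree_lag0[of \<beta> n] by simp
  next
    case 3 then show ?thesis
      using lag0_orthogonal_low_degree[OF assms, of "lag0 \<beta> m" n] degree_lag0[of \<beta> m] by (simp add: mult.commute)
  qed
qed

section \<open>The energy form on weighted polynomials\<close>

text \<open>
  The derivative of \<open>exp (- a x) p x\<close> is \<open>exp (- a x)\<close> times this polynomial.
\<close>

definition dpoly :: "real \<Rightarrow> real poly \<Rightarrow> real poly" where
  "dpoly a p = pderiv p - smult a p"

lemma dpoly_add: "dpoly a (p + q) = dpoly a p + dpoly a q"
  and dpoly_smult: "dpoly a (smult c p) = smult c (dpoly a p)"
proof -
  show "dpoly a (p + q) = dpoly a p + dpoly a q"
    by (simp add: dpoly_def pderiv_add smult_add_right)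
  show "dpoly a (smult c p) = smult c (dpoly a p)"
    by (simp add: dpoly_def pderiv_smult smult_diff_right mult.commute)
qed

lemma dpoly_lag_neg1_0: "dpoly (\<beta> / 2) (lag_neg1 \<beta> 0) = smult (- (\<beta> / 2)) (lag0 \<beta> 0)"
  by (simp add: dpoly_def lag_neg1_0 lag0_0 pderiv_1)

lemma dpoly_lag_neg1_Suc: "dpoly (\<beta> / 2) (lag_neg1 \<beta> (Suc k)) = smult (- (\<beta> / 2)) (lag0 \<beta> (Suc k) + lag0 \<beta> k)"
  unfolding dpoly_def pderiv_lag_neg1_Suc
  by (rule poly_eqI) (simp add: lag_neg1_Suc algebra_simps)

text \<open>
  The bilinear form \<open>A_form\<close> in terms of the polynomial factors, see \<open>A_form_expoly\<close>.
\<close>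

definition energy :: "real \<Rightarrow> real \<Rightarrow> real poly \<Rightarrow> real poly \<Rightarrow> real" where
  "energy \<beta> \<gamma> p q = exp_mean \<beta> (dpoly (\<beta> / 2) p * dpoly (\<beta> / 2) q) + \<gamma> * exp_mean \<beta> (p * q)"

text \<open>
  The functions with the polynomial factors \<open>lag_neg1 \<beta> m\<close> and their derivatives are the differences
  and, up to the factor \<open>- \<beta> / 2\<close>, the sums of two consecutive orthogonal functions. Hence the matrix of the form is
  tridiagonal. The second index is positive, which excludes the irregular first diagonal entry.
\<close>

lemma energy_lag_neg1:
  assumes \<beta>: "\<beta> > 0"
  shows "energy \<beta> \<gamma> (lag_neg1 \<beta> m) (lag_neg1 \<beta> (Suc n)) =
    (2 * ((\<beta> / 2)\<^sup>2 + \<gamma>) * (if m = Suc n then 1 else 0)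
      + ((\<beta> / 2)\<^sup>2 - \<gamma>) * ((if m = n then 1 else 0) + (if m = Suc (Suc n) then 1 else 0))) / \<beta>"
proof -
  have 1: "exp_mean \<beta> ((lag0 \<beta> (Suc k) + lag0 \<beta> k) * (lag0 \<beta> (Suc n) + lag0 \<beta> n))
      = (2 * (if k = n then 1 else 0) + (if k = Suc n then 1 else 0) + (if Suc k = n then 1 else 0)) / \<beta>" for k
    unfolding distrib_left distrib_right exp_mean_add[OF \<beta>] lag0_orthogonal[OF \<beta>] by auto
  have 2: "exp_mean \<beta> ((lag0 \<beta> (Suc k) - lag0 \<beta> k) * (lag0 \<beta> (Suc n) - lag0 \<beta> n))
      = (2 * (if k = n then 1 else 0) - (if k = Suc n then 1 else 0) - (if Suc k = n then 1 else 0)) / \<beta>" for k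
    unfolding left_diff_distrib right_diff_distrib exp_mean_diff[OF \<beta>] lag0_orthogonal[OF \<beta>] by auto
  show ?thesis
  proof (cases m)
    case 0
    have 3: "exp_mean \<beta> (lag0 \<beta> 0 * (lag0 \<beta> (Suc n) + lag0 \<beta> n)) = (if n = 0 then 1 else 0) / \<beta>"
      unfolding distrib_left exp_mean_add[OF \<beta>] lag0_orthogonal[OF \<beta>] by auto
    have 4: "exp_mean \<beta> (lag0 \<beta> 0 * (lag0 \<beta> (Suc n) - lag0 \<beta> n)) = - (if n = 0 then 1 else 0) / \<beta>"
      unfolding right_diff_distrib exp_mean_diff[OF \<beta>] lag0_orthogonal[OF \<beta>] by auto
    show ?thesis
      unfolding energy_def 0 dpoly_lag_neg1_0 dpoly_lag_neg1_Suc mult_smult_left mult_smult_right exp_mean_smult 3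
      unfolding lag_neg1_Suc using 4
      by (simp add: lag_neg1_0 lag0_0 power2_eq_square field_simps)
  next
    case (Suc k)
    show ?thesis
      unfolding energy_def Suc dpoly_lag_neg1_Suc mult_smult_left mult_smult_right exp_mean_smult 1
      unfolding lag_neg1_Suc 2
      by (simp add: power2_eq_square field_simps)
  qed
qed

lemma energy_sum_left:
  assumes "\<beta> > 0"
  shows "energy \<beta> \<gamma> (\<Sum>i\<in>I. smult (c i) (r i)) q = (\<Sum>i\<in>I. c i * energy \<beta> \<gamma> (r i) q)"
proof (induction I rule: infinite_finite_induct)
  case (insert i I)
  have "energy \<beta> \<gamma> (p + p') q = energy \<beta> \<gamma> p q + energy \<beta> \<gamma> p' q" for p p'
    by (simp add: energy_def dpoly_add distrib_right distrib_left exp_mean_add[OF assms])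
  moreover have "energy \<beta> \<gamma> (smult c p) q = c * energy \<beta> \<gamma> p q" for c p
    by (simp add: energy_def dpoly_smult exp_mean_smult distrib_left)
  ultimately show ?case using insert by simp
qed (simp_all add: energy_def dpoly_def exp_mean_0)

section \<open>The discrete boundary function\<close>

definition s0n_coeff :: "real \<Rightarrow> real \<Rightarrow> nat \<Rightarrow> nat \<Rightarrow> real" where
  "s0n_coeff \<beta> \<gamma> N m = ((2 * sqrt \<gamma> + \<beta>) ^ (2 * N + 2 - m) * (2 * sqrt \<gamma> - \<beta>) ^ m
       - (2 * sqrt \<gamma> - \<beta>) ^ (2 * N + 2 - m) * (2 * sqrt \<gamma> + \<beta>) ^ m)
     / ((2 * sqrt \<gamma> + \<beta>) ^ (2 * N + 2) - (2 * sqrt \<gamma> - \<beta>) ^ (2 * N + 2))"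

definition s0n_poly :: "real \<Rightarrow> real \<Rightarrow> nat \<Rightarrow> real poly" where
  "s0n_poly \<beta> \<gamma> N = (\<Sum>m\<le>N. smult (s0n_coeff \<beta> \<gamma> N m) (lag_neg1 \<beta> m))"

lemma S0N_eq_expoly: "S0N \<beta> \<gamma> N = expoly (\<beta> / 2) (s0n_poly \<beta> \<gamma> N)"
  by (rule ext) (simp add: S0N_def s0n_poly_def s0n_coeff_def expoly_sum expoly_smult laguerre_fun_eq_expoly)

lemma degree_s0n_poly: "degree (s0n_poly \<beta> \<gamma> N) \<le> N"
  unfolding s0n_poly_def
  by (intro degree_sum_le) (auto intro: order_trans[OF degree_smult_le] order_trans[OF degree_lag_neg1])

lemma s0n_coeff_0:
  assumes "\<beta> > 0" "\<gamma> > 0" shows "s0n_coeff \<beta> \<gamma> N 0 = 1"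
proof -
  have "\<bar>2 * sqrt \<gamma> - \<beta>\<bar> < 2 * sqrt \<gamma> + \<beta>" using assms by (auto simp: abs_if)
  then have "\<bar>2 * sqrt \<gamma> - \<beta>\<bar> ^ (2 * N + 2) < (2 * sqrt \<gamma> + \<beta>) ^ (2 * N + 2)"
    by (intro power_strict_mono) auto
  then have "(2 * sqrt \<gamma> - \<beta>) ^ (2 * N + 2) < (2 * sqrt \<gamma> + \<beta>) ^ (2 * N + 2)"
    by (simp only: power_even_abs[of "2 * N + 2"] even_add even_mult_iff even_numeral simp_thms)
  then show ?thesis by (simp add: s0n_coeff_def)
qed

lemma poly_s0n_poly_0:
  assumes "\<beta> > 0" "\<gamma> > 0" shows "poly (s0n_poly \<beta> \<gamma> N) 0 = 1"
proof -
  have "poly (lag_neg1 \<beta> m) 0 = (if m = 0 then 1 else 0)" for m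
    by (cases m) (simp_all add: lag_neg1_0 poly_lag_neg1_Suc_0)
  then have "poly (s0n_poly \<beta> \<gamma> N) 0 = (\<Sum>m\<le>N. if m = 0 then s0n_coeff \<beta> \<gamma> N 0 else 0)"
    unfolding s0n_poly_def poly_sum by (intro sum.cong) auto
  then show ?thesis by (simp add: s0n_coeff_0[OF assms])
qed

text \<open>
  With \<open>P = 2 sqrt \<gamma> + \<beta>\<close> and \<open>Q = 2 sqrt \<gamma> - \<beta>\<close> the entries of the matrix are proportional to
  \<open>P\<^sup>2 + Q\<^sup>2\<close> and \<open>- P Q\<close>. With \<open>L = 2 N + 2\<close> the sequences \<open>P\<^bsup>L-m\<^esup> Q\<^bsup>m\<^esup>\<close> and
  \<open>Q\<^bsup>L-m\<^esup> P\<^bsup>m\<^esup>\<close> both solve the recurrence, and their difference vanishes at \<open>m = N + 1\<close>.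
\<close>

lemma s0n_coeff_recurrence:
  assumes "\<gamma> > 0" "n \<le> 2 * N"
  shows "2 * ((\<beta> / 2)\<^sup>2 + \<gamma>) * s0n_coeff \<beta> \<gamma> N (Suc n)
    + ((\<beta> / 2)\<^sup>2 - \<gamma>) * (s0n_coeff \<beta> \<gamma> N n + s0n_coeff \<beta> \<gamma> N (Suc (Suc n))) = 0"
proof -
  define P where "P = 2 * sqrt \<gamma> + \<beta>"
  define Q where "Q = 2 * sqrt \<gamma> - \<beta>"
  define K where "K = P ^ (2 * N + 2) - Q ^ (2 * N + 2)"
  obtain L where L: "2 * N = n + L" using assms(2) le_Suc_ex by blast
  have c: "s0n_coeff \<beta> \<gamma> N m = (P ^ (2 * N + 2 - m) * Q ^ m - Q ^ (2 * N + 2 - m) * P ^ m) / K" for m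
    by (simp add: s0n_coeff_def P_def Q_def K_def)
  have "sqrt \<gamma> * sqrt \<gamma> = \<gamma>" using assms(1) by simp
  then have g: "2 * ((\<beta> / 2)\<^sup>2 + \<gamma>) = (P\<^sup>2 + Q\<^sup>2) / 4" "(\<beta> / 2)\<^sup>2 - \<gamma> = - (P * Q) / 4"
    by (auto simp: P_def Q_def power2_eq_square algebra_simps)
  have e: "2 * N + 2 - n = L + 2" "2 * N + 2 - Suc n = L + 1" "2 * N + 2 - Suc (Suc n) = L"
    using L by auto
  show ?thesis unfolding c g e by (simp add: power2_eq_square algebra_simps add_divide_distrib[symmetric] diff_divide_distrib[symmetric])
qed

lemma energy_s0n_poly_lag_neg1:
  assumes \<beta>: "\<beta> > 0" and \<gamma>: "\<gamma> > 0" and n: "Suc n \<le> N"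
  shows "energy \<beta> \<gamma> (s0n_poly \<beta> \<gamma> N) (lag_neg1 \<beta> (Suc n)) = 0"
proof -
  let ?c = "s0n_coeff \<beta> \<gamma> N"
  let ?A = "2 * ((\<beta> / 2)\<^sup>2 + \<gamma>)" and ?B = "(\<beta> / 2)\<^sup>2 - \<gamma>"
  \<comment> \<open>the vanishing coefficient with the index \<open>N + 1\<close> makes the last row, \<open>Suc n = N\<close>, regular\<close>
  have top: "?c (Suc N) = 0" by (simp add: s0n_coeff_def mult.commute)
  have "energy \<beta> \<gamma> (s0n_poly \<beta> \<gamma> N) (lag_neg1 \<beta> (Suc n))
      = (\<Sum>m\<le>N. ?c m * energy \<beta> \<gamma> (lag_neg1 \<beta> m) (lag_neg1 \<beta> (Suc n)))"
    unfolding s0n_poly_def by (rule energy_sum_left[OF \<beta>])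
  also have "\<dots> = (\<Sum>m\<le>Suc N. ?c m * energy \<beta> \<gamma> (lag_neg1 \<beta> m) (lag_neg1 \<beta> (Suc n)))"
    by (simp add: top)
  also have "\<dots> = (\<Sum>m\<le>Suc N. (if m = Suc n then ?A * ?c m / \<beta> else 0)
      + ((if m = n then ?B * ?c m / \<beta> else 0) + (if m = Suc (Suc n) then ?B * ?c m / \<beta> else 0)))"
    by (intro sum.cong refl) (auto simp: energy_lag_neg1[OF \<beta>])
  also have "\<dots> = ?A * ?c (Suc n) / \<beta> + (?B * ?c n / \<beta> + ?B * ?c (Suc (Suc n)) / \<beta>)"
    using n by (simp add: sum.distrib del: sum.atMost_Suc)
  also have "\<dots> = (?A * ?c (Suc n) + ?B * (?c n + ?c (Suc (Suc n)))) / \<beta>"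
    by (simp add: add_divide_distrib distrib_left)
  also have "\<dots> = 0" using s0n_coeff_recurrence[OF \<gamma>, of n N \<beta>] n by simp
  finally show ?thesis .
qed

section \<open>The generating function\<close>

text \<open>
  Multiplying by the geometric series turns the binomial coefficients into their partial sums, which raises the
  lower index by 1.
\<close>

lemma binomial_power_sums:
  fixes r :: real assumes "\<bar>r\<bar> < 1"
  shows "(\<lambda>i. real (i + j choose j) * r ^ i) sums (1 / (1 - r)) ^ Suc j"
proof -
  have "(\<lambda>i. real (i + j choose j) * r ^ i) sums (1 / (1 - r)) ^ Suc j \<and>
      summable (\<lambda>i. norm (real (i + j choose j) * r ^ i))"
  proof (induction j)
    case 0
    then show ?case using assms geometric_sums[of r] summable_geometric[of "\<bar>r\<bar>"] by (simp add: power_abs)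
  next
    case (Suc j)
    have geo: "summable (\<lambda>i. norm (r ^ i))" using assms by (simp add: power_abs summable_geometric)
    have conv: "(\<Sum>i\<le>k. real (i + j choose j) * t ^ i * t ^ (k - i)) = real (k + Suc j choose Suc j) * t ^ k"
      for k and t :: real
    proof -
      have "(\<Sum>i\<le>k. real (i + j choose j) * t ^ i * t ^ (k - i)) = (\<Sum>i\<le>k. real (j + i choose j)) * t ^ k"
        unfolding sum_distrib_right
        by (intro sum.cong) (auto simp: mult.assoc power_add[symmetric] add.commute)
      also have "(\<Sum>i\<le>k. real (j + i choose j)) = real (k + Suc j choose Suc j)"
        using choose_rising_sum(1)[where n = j and m = k] by (simp only: of_nat_sum[symmetric]) (simp add: ac_simps)
      finally show ?thesis .
    qed
    have sums: "(\<lambda>k. real (k + Suc j choose Suc j) * r ^ k) sums ((1 / (1 - r)) ^ Suc j * (1 / (1 - r)))"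
      using Cauchy_product_sums[of "\<lambda>i. real (i + j choose j) * r ^ i" "\<lambda>i. r ^ i"] Suc geo
      unfolding conv by (simp add: sums_iff suminf_geometric assms)
    have "summable (\<lambda>i. norm (norm (real (i + j choose j) * r ^ i)))" "summable (\<lambda>i. norm (norm (r ^ i)))"
      using Suc geo by simp_all
    from Cauchy_product_sums[OF this]
    have "summable (\<lambda>k. real (k + Suc j choose Suc j) * \<bar>r\<bar> ^ k)"
      by (simp add: sums_iff abs_mult power_abs conv)
    then show ?case using sums by (simp add: abs_mult power_abs mult.commute)
  qed
  then show ?thesis ..
qed

lemma binomial_power_sums':
  fixes r :: real assumes "\<bar>r\<bar> < 1"
  shows "(\<lambda>k. real (k choose j) * r ^ Suc k) sums (r / (1 - r)) ^ Suc j"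
proof -
  have "(\<lambda>i. r ^ Suc j * (real (i + j choose j) * r ^ i)) sums (r ^ Suc j * (1 / (1 - r)) ^ Suc j)"
    by (intro sums_mult binomial_power_sums assms)
  then have "(\<lambda>i. real (i + j choose j) * r ^ Suc (i + j)) sums (r / (1 - r)) ^ Suc j"
    by (simp add: power_divide power_add mult_ac)
  then show ?thesis
    by (subst (asm) sums_zero_iff_shift) auto
qed

lemma exp_minus_one_has_sum:
  fixes t :: real shows "((\<lambda>j. t ^ Suc j / fact (Suc j)) has_sum (exp t - 1)) UNIV"
proof (rule norm_summable_imp_has_sum)
  have sums: "(\<lambda>j. s ^ Suc j / fact (Suc j)) sums (exp s - 1)" for s :: real
  proof -
    have "(\<lambda>n. s ^ n / fact n) sums exp s"
      using exp_converges[of s] by (simp add: divide_inverse mult.commute)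
    then show ?thesis
      using sums_Suc_iff[of "\<lambda>n. s ^ n / fact n" "exp s - 1"] by (simp del: fact_Suc power_Suc)
  qed
  show "(\<lambda>j. t ^ Suc j / fact (Suc j)) sums (exp t - 1)" by (rule sums)
  show "summable (\<lambda>n. norm (t ^ Suc n / fact (Suc n)))"
    using sums_summable[OF sums[of "\<bar>t\<bar>"]] by (simp add: abs_mult power_abs del: fact_Suc)
qed

text \<open>
  With \<open>t = - \<beta> x\<close> the series is a double series with the terms
  \<open>(k choose j) r\<^bsup>k+1\<^esup> t\<^bsup>j+1\<^esup> / (j+1)!\<close>. Summing over \<open>k\<close> first gives the exponential series at
  \<open>r t / (1 - r)\<close> without its constant term; this also holds for \<open>\<bar>r\<bar>\<close> and \<open>\<bar>t\<bar>\<close>, which yields absolute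
  convergence and permits the exchange of the sums.
\<close>

lemma lag_neg1_generating_function:
  fixes r :: real assumes r: "\<bar>r\<bar> < 1"
  shows "(\<lambda>m. r ^ m * poly (lag_neg1 \<beta> m) x) sums exp (- r * \<beta> * x / (1 - r))"
proof -
  define t where "t = - \<beta> * x"
  define F where "F s \<rho> = (\<lambda>(j, k). (real (k choose j) * \<rho> ^ Suc k) * (s ^ Suc j / fact (Suc j)))"
    for s \<rho> :: real
  have inner: "((\<lambda>k. F s \<rho> (j, k)) has_sum ((\<rho> / (1 - \<rho>) * s) ^ Suc j / fact (Suc j))) UNIV"
    if "\<bar>\<rho>\<bar> < 1" for s \<rho> j
  proof -
    have "((\<lambda>k. real (k choose j) * \<rho> ^ Suc k) has_sum (\<rho> / (1 - \<rho>)) ^ Suc j) UNIV"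
    proof (rule norm_summable_imp_has_sum)
      show "summable (\<lambda>k. norm (real (k choose j) * \<rho> ^ Suc k))"
        using sums_summable[OF binomial_power_sums'[of "\<bar>\<rho>\<bar>" j]] that
        by (simp add: abs_mult power_abs)
    qed (rule binomial_power_sums'[OF that])
    from has_sum_cmult_left[OF this, of "s ^ Suc j / fact (Suc j)"] show ?thesis
      by (simp add: F_def power_mult_distrib power_divide mult_ac del: power_Suc fact_Suc)
  qed
  have "F \<bar>t\<bar> \<bar>r\<bar> summable_on UNIV \<times> UNIV"
  proof (rule summable_on_SigmaI)
    show "((\<lambda>k. F \<bar>t\<bar> \<bar>r\<bar> (j, k)) has_sum ((\<bar>r\<bar> / (1 - \<bar>r\<bar>) * \<bar>t\<bar>) ^ Suc j / fact (Suc j))) UNIV" for j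
      by (rule inner) (use r in simp)
    show "(\<lambda>j. (\<bar>r\<bar> / (1 - \<bar>r\<bar>) * \<bar>t\<bar>) ^ Suc j / fact (Suc j)) summable_on UNIV"
      by (rule has_sum_imp_summable[OF exp_minus_one_has_sum])
  qed (simp add: F_def)
  moreover have "(\<lambda>p. norm (F t r p)) = F \<bar>t\<bar> \<bar>r\<bar>"
    by (rule ext) (simp add: F_def case_prod_beta abs_mult power_abs del: power_Suc fact_Suc)
  ultimately have "(\<lambda>p. norm (F t r p)) summable_on UNIV \<times> UNIV" by simp
  then have summable: "F t r summable_on UNIV \<times> UNIV" by (rule abs_summable_summable)
  have "(F t r has_sum (exp (r / (1 - r) * t) - 1)) (UNIV \<times> UNIV)"
    by (rule has_sum_SigmaI[OF inner[OF r] exp_minus_one_has_sum summable])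
  then have swapped: "((\<lambda>(k, j). F t r (j, k)) has_sum (exp (r / (1 - r) * t) - 1)) (UNIV \<times> UNIV)"
    by (subst (asm) has_sum_swap)
  have row: "((\<lambda>j. (case (k, j) of (k, j) \<Rightarrow> F t r (j, k))) has_sum (r ^ Suc k * poly (lag_neg1 \<beta> (Suc k)) x)) UNIV" for k
  proof -
    have "((\<lambda>j. F t r (j, k)) has_sum (\<Sum>j\<le>k. F t r (j, k))) {..k}"
      by (rule has_sum_finite) simp
    then have "((\<lambda>j. F t r (j, k)) has_sum (\<Sum>j\<le>k. F t r (j, k))) UNIV"
      by (rule has_sum_cong_neutral[THEN iffD1, rotated -1]) (auto simp: F_def)
    moreover have "(\<Sum>j\<le>k. F t r (j, k)) = r ^ Suc k * poly (lag_neg1 \<beta> (Suc k)) x"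
    proof -
      have "poly (lag_neg1 \<beta> (Suc k)) x = (\<Sum>i\<le>Suc k. coeff (lag_neg1 \<beta> (Suc k)) i * x ^ i)"
        using arg_cong[OF poly_as_sum_of_monoms'[OF degree_lag_neg1], of "\<lambda>p. poly p x" \<beta> "Suc k"]
        by (simp only: poly_sum poly_monom)
      also have "\<dots> = (\<Sum>j\<le>k. coeff (lag_neg1 \<beta> (Suc k)) (Suc j) * x ^ Suc j)"
        by (subst sum.atMost_Suc_shift) (simp add: coeff_lag_neg1_Suc_0)
      also have "\<dots> = (\<Sum>j\<le>k. real (k choose j) * (t ^ Suc j / fact (Suc j)))"
        unfolding coeff_lag_neg1_Suc_Suc t_def power_mult_distrib
        by (intro sum.cong) (simp_all add: mult_ac del: power_Suc fact_Suc)
      finally show ?thesis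
        by (simp add: F_def sum_distrib_left mult_ac del: power_Suc fact_Suc)
    qed
    ultimately show ?thesis by simp
  qed
  have "((\<lambda>k. r ^ Suc k * poly (lag_neg1 \<beta> (Suc k)) x) has_sum (exp (r / (1 - r) * t) - 1)) UNIV"
    by (rule has_sum_Sigma'[OF swapped row])
  then have "(\<lambda>k. r ^ Suc k * poly (lag_neg1 \<beta> (Suc k)) x) sums (exp (r / (1 - r) * t) - 1)"
    by (rule has_sum_imp_sums)
  then have "(\<lambda>m. r ^ m * poly (lag_neg1 \<beta> m) x) sums (exp (r / (1 - r) * t) - 1 + r ^ 0 * poly (lag_neg1 \<beta> 0) x)"
    by (rule sums_Suc)
  moreover have "r / (1 - r) * t = - r * \<beta> * x / (1 - r)" by (simp add: t_def)
  ultimately show ?thesis by (simp add: lag_neg1_0)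
qed

theorem S0_eq_exp:
  assumes "\<beta> > 0" "\<gamma> > 0" shows "S0 \<beta> \<gamma> x = exp (- sqrt \<gamma> * x)"
proof -
  define s where "s = sqrt \<gamma>"
  have s: "s > 0" using assms by (simp add: s_def)
  define r where "r = (2 * s - \<beta>) / (2 * s + \<beta>)"
  have r: "\<bar>r\<bar> < 1" using s assms by (auto simp: r_def abs_if field_simps)
  have r': "1 - r = 2 * \<beta> / (2 * s + \<beta>)" using s assms by (simp add: r_def field_simps)
  have ratio: "r / (1 - r) = (2 * s - \<beta>) / (2 * \<beta>)"
  proof -
    have "(a / D) / (b / D) = a / b" if "D \<noteq> 0" for a b D :: real
      using that by simp
    then show ?thesis unfolding r' unfolding r_def using s assms by (simp add: add_pos_pos less_imp_neq[THEN not_sym])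
  qed
  have "- r * \<beta> * x / (1 - r) = - (r / (1 - r)) * (\<beta> * x)" by simp
  also have "\<dots> = - (2 * s - \<beta>) / 2 * x" 
  proof -
    have "- (c / (2 * \<beta>)) * (\<beta> * x) = - c / 2 * x" for c using assms by simp
    then show ?thesis unfolding ratio .
  qed
  finally have e: "- r * \<beta> * x / (1 - r) = - (2 * s - \<beta>) / 2 * x" .
  have "(\<lambda>m. exp (- (\<beta> / 2) * x) * (r ^ m * poly (lag_neg1 \<beta> m) x))
      sums (exp (- (\<beta> / 2) * x) * exp (- r * \<beta> * x / (1 - r)))"
    by (intro sums_mult lag_neg1_generating_function r)
  moreover have "exp (- (\<beta> / 2) * x) * exp (- r * \<beta> * x / (1 - r)) = exp (- s * x)"
    unfolding e mult_exp_exp by (simp add: field_simps)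
  moreover have "exp (- (\<beta> / 2) * x) * (r ^ m * poly (lag_neg1 \<beta> m) x)
      = (2 * sqrt \<gamma> - \<beta>) ^ m / (2 * sqrt \<gamma> + \<beta>) ^ m * laguerre_fun (- 1) \<beta> m x" for m
    by (simp add: r_def s_def power_divide laguerre_fun_eq_expoly expoly_def)
  ultimately show ?thesis by (simp add: S0_def sums_iff s_def)
qed

section \<open>The Sobolev space on the half line\<close>

text \<open>
  An element \<open>u\<close> of \<open>H1\<close> is an arbitrary representative of its class; \<open>z\<close> is its continuous representative and
  \<open>g\<close> a version of its derivative. The quantities \<open>weak_deriv u\<close> and \<open>cont_rep u\<close>, which rest on a choice, are
  computed from \<open>g\<close> and \<open>z\<close>.
\<close>

definition h1_rep :: "(real \<Rightarrow> real) \<Rightarrow> (real \<Rightarrow> real) \<Rightarrow> (real \<Rightarrow> real) \<Rightarrow> bool" where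
  "h1_rep u z g \<longleftrightarrow> u \<in> borel_measurable half_line \<and> (AE x in half_line. u x = z x) \<and> h1_pair z g"

lemma h1_pair_imp_rep: "h1_pair z g \<Longrightarrow> h1_rep z z g"
  by (simp add: h1_rep_def h1_pair_def L2_measurable)

lemma h1_rep_cmult: "h1_rep u z g \<Longrightarrow> h1_rep (\<lambda>x. c * u x) (\<lambda>x. c * z x) (\<lambda>x. c * g x)"
  unfolding h1_rep_def by (auto intro: h1_pair_cmult elim: eventually_mono)

lemma h1_rep_add:
  assumes "h1_rep u z g" "h1_rep v w h"
  shows "h1_rep (\<lambda>x. u x + v x) (\<lambda>x. z x + w x) (\<lambda>x. g x + h x)"
proof -
  have "AE x in half_line. u x + v x = z x + w x"
    using assms unfolding h1_rep_def by (auto elim: eventually_elim2)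
  then show ?thesis using assms unfolding h1_rep_def by (auto intro: h1_pair_add)
qed

lemma h1_rep_diff:
  assumes "h1_rep u z g" "h1_rep v w h"
  shows "h1_rep (\<lambda>x. u x - v x) (\<lambda>x. z x - w x) (\<lambda>x. g x - h x)"
  using h1_rep_add[OF assms(1) h1_rep_cmult[OF assms(2), of "- 1"]] by simp

lemma h1_rep_L2: "h1_rep u z g \<Longrightarrow> u \<in> L2 \<and> z \<in> L2 \<and> g \<in> L2"
  unfolding h1_rep_def h1_pair_def using L2_cong_AE by blast

lemma h1_rep_has_weak_deriv:
  assumes "h1_rep u z g" shows "has_weak_deriv u g"
  unfolding has_weak_deriv_def
proof
  fix \<phi> assume \<phi>: "\<phi> \<in> test_functions"
  have "L2_inner u (deriv \<phi>) = L2_inner z (deriv \<phi>)"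
    using assms h1_rep_L2[OF assms] L2_measurable[OF test_function_L2[OF test_function_deriv[OF \<phi>]]]
    by (intro L2_inner_cong_AE) (auto simp: h1_rep_def L2_def)
  then show "L2_inner u (deriv \<phi>) = - L2_inner g \<phi>"
    using h1_pair_has_weak_deriv[of z g] assms \<phi> by (auto simp: h1_rep_def has_weak_deriv_def)
qed

lemma h1_rep_H1: "h1_rep u z g \<Longrightarrow> u \<in> H1"
  unfolding H1_def using h1_rep_L2 h1_rep_has_weak_deriv by blast

lemma H1_weak_deriv:
  assumes "u \<in> H1" shows "weak_deriv u \<in> L2" "has_weak_deriv u (weak_deriv u)"
proof -
  have "\<exists>g. g \<in> L2 \<and> has_weak_deriv u g" using assms by (auto simp: H1_def)
  from someI_ex[OF this] show "weak_deriv u \<in> L2" "has_weak_deriv u (weak_deriv u)"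
    unfolding weak_deriv_def by auto
qed

lemma h1_rep_weak_deriv:
  assumes "h1_rep u z g"
  shows "AE x in half_line. weak_deriv u x = g x"
  using H1_weak_deriv[OF h1_rep_H1[OF assms]] h1_rep_L2[OF assms] h1_rep_has_weak_deriv[OF assms]
  by (intro weak_deriv_unique) auto

lemma H1_imp_h1_rep:
  assumes "u \<in> H1" obtains z g where "h1_rep u z g"
proof -
  have "u \<in> L2" using assms by (simp add: H1_def)
  obtain z where "h1_pair z (weak_deriv u)" "AE x in half_line. u x = z x"
    by (rule weak_deriv_imp_primitive[OF \<open>u \<in> L2\<close> H1_weak_deriv[OF assms]])
  then show ?thesis using that \<open>u \<in> L2\<close> unfolding h1_rep_def L2_def by blast
qed

lemma A_form_h1_rep:
  assumes "h1_rep u z g" "h1_rep v w h"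
  shows "A_form \<gamma> u v = L2_inner g h + \<gamma> * L2_inner z w"
proof -
  have m: "f \<in> borel_measurable half_line" if "f \<in> L2" for f using that by (rule L2_measurable)
  note L2 = h1_rep_L2[OF assms(1)] h1_rep_L2[OF assms(2)]
    H1_weak_deriv(1)[OF h1_rep_H1[OF assms(1)]] H1_weak_deriv(1)[OF h1_rep_H1[OF assms(2)]]
  have "L2_inner (weak_deriv u) (weak_deriv v) = L2_inner g h"
    by (intro L2_inner_cong_AE h1_rep_weak_deriv[OF assms(1)] h1_rep_weak_deriv[OF assms(2)])
      (use L2 m in auto)
  moreover have "L2_inner u v = L2_inner z w"
    by (intro L2_inner_cong_AE) (use assms L2 m in \<open>auto simp: h1_rep_def\<close>)
  ultimately show ?thesis by (simp add: A_form_def)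
qed

lemma H1_norm_A_form: "H1_norm u = sqrt (A_form 1 u u)"
  by (simp add: H1_norm_def A_form_def)

lemma H1_norm_h1_rep:
  assumes "h1_rep u z g" shows "H1_norm u = sqrt (L2_inner g g + L2_inner z z)"
  unfolding H1_norm_A_form A_form_h1_rep[OF assms assms] by simp

text \<open>
  The points of \<open>{0<..}\<close> at which the functions differ form an open null set; the boundary point 0 follows by
  continuity. This is what makes \<open>cont_rep\<close> well defined.
\<close>

lemma continuous_AE_eq_imp_eq:
  fixes z w :: "real \<Rightarrow> real"
  assumes "continuous_on {0..} z" "continuous_on {0..} w" "AE x in half_line. z x = w x" "x \<ge> 0"
  shows "z x = w x"
proof -
  let ?S = "{x \<in> {0<..}. z x - w x \<in> - {0}}"
  have cont: "continuous_on {0..} (\<lambda>x. z x - w x)" by (intro continuous_intros assms)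
  then have "continuous_on {0<..} (\<lambda>x. z x - w x)" by (rule continuous_on_subset) auto
  then have "open ({0<..} \<inter> (\<lambda>x. z x - w x) -` (- {0}))"
    by (rule continuous_open_preimage) auto
  moreover have "{0<..} \<inter> (\<lambda>x. z x - w x) -` (- {0}) = ?S" by auto
  ultimately have "open ?S" by simp
  moreover have "negligible ?S"
  proof -
    have "AE x in lebesgue. x \<in> {0<..} \<longrightarrow> z x = w x"
      using assms(3) by (simp add: AE_restrict_space_iff)
    then obtain N where N: "{x. \<not> (x \<in> {0<..} \<longrightarrow> z x = w x)} \<subseteq> N" "N \<in> null_sets lebesgue"
      by (auto simp: eventually_ae_filter)
    then have "?S \<subseteq> N" by auto
    then show ?thesis using N(2) by (auto simp: negligible_iff_null_sets[symmetric] intro: negligible_subset)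
  qed
  ultimately have "?S = {}" using open_not_negligible by blast
  then have "\<And>x. x \<in> {0<..} \<Longrightarrow> z x - w x = 0" by auto
  then have "z x - w x = 0"
    using continuous_constant_on_closure[of "{0<..}" "\<lambda>x. z x - w x" 0 x] cont assms(4) by simp
  then show ?thesis by simp
qed

lemma h1_rep_cont_rep:
  assumes "h1_rep u z g" "x \<ge> 0" shows "cont_rep u x = z x"
proof -
  have z: "continuous_on {0..} z \<and> (AE x in half_line. u x = z x)"
    using assms by (auto simp: h1_rep_def h1_pair_def primitive_of_continuous)
  have c: "continuous_on {0..} (cont_rep u) \<and> (AE x in half_line. u x = cont_rep u x)"
    unfolding cont_rep_def by (rule someI[where P = "\<lambda>v. continuous_on {0..} v \<and> (AE x in half_line. u x = v x)", OF z])
  have "AE x in half_line. cont_rep u x = z x"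
    using conjunct2[OF z] conjunct2[OF c] by eventually_elim simp
  then show ?thesis using z c assms(2) by (intro continuous_AE_eq_imp_eq) auto
qed

lemma H1_add: "u \<in> H1 \<Longrightarrow> v \<in> H1 \<Longrightarrow> (\<lambda>x. u x + v x) \<in> H1"
  by (metis H1_imp_h1_rep h1_rep_H1 h1_rep_add)

lemma H1_diff: "u \<in> H1 \<Longrightarrow> v \<in> H1 \<Longrightarrow> (\<lambda>x. u x - v x) \<in> H1"
  by (metis H1_imp_h1_rep h1_rep_H1 h1_rep_diff)

lemma H1_cmult: "u \<in> H1 \<Longrightarrow> (\<lambda>x. c * u x) \<in> H1"
  by (metis H1_imp_h1_rep h1_rep_H1 h1_rep_cmult)

lemma A_form_commute: "A_form \<gamma> u v = A_form \<gamma> v u"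
  by (simp add: A_form_def L2_inner_commute)

lemma A_form_add_left:
  assumes "u \<in> H1" "v \<in> H1" "w \<in> H1"
  shows "A_form \<gamma> (\<lambda>x. u x + v x) w = A_form \<gamma> u w + A_form \<gamma> v w"
proof -
  obtain zu gu zv gv zw gw where r: "h1_rep u zu gu" "h1_rep v zv gv" "h1_rep w zw gw"
    using assms H1_imp_h1_rep by metis
  show ?thesis
    unfolding A_form_h1_rep[OF h1_rep_add[OF r(1,2)] r(3)] A_form_h1_rep[OF r(1,3)] A_form_h1_rep[OF r(2,3)]
    using h1_rep_L2[OF r(1)] h1_rep_L2[OF r(2)] h1_rep_L2[OF r(3)]
    by (simp add: L2_inner_add_left algebra_simps)
qed

lemma A_form_cmult_left:
  assumes "u \<in> H1" "w \<in> H1"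
  shows "A_form \<gamma> (\<lambda>x. c * u x) w = c * A_form \<gamma> u w"
proof -
  obtain zu gu zw gw where r: "h1_rep u zu gu" "h1_rep w zw gw"
    using assms H1_imp_h1_rep by metis
  show ?thesis
    unfolding A_form_h1_rep[OF h1_rep_cmult[OF r(1)] r(2)] A_form_h1_rep[OF r]
    by (simp add: L2_inner_cmult_left algebra_simps)
qed

lemma A_form_diff_left:
  assumes "u \<in> H1" "v \<in> H1" "w \<in> H1"
  shows "A_form \<gamma> (\<lambda>x. u x - v x) w = A_form \<gamma> u w - A_form \<gamma> v w"
  using A_form_add_left[OF assms(1) H1_cmult[OF assms(2), of "- 1"] assms(3)]
    A_form_cmult_left[OF assms(2,3), of \<gamma> "- 1"] by simp

lemma A_form_add_right:
  assumes "u \<in> H1" "v \<in> H1" "w \<in> H1"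
  shows "A_form \<gamma> w (\<lambda>x. u x + v x) = A_form \<gamma> w u + A_form \<gamma> w v"
  using A_form_add_left[OF assms] by (simp add: A_form_commute)

lemma A_form_cmult_right:
  assumes "u \<in> H1" "w \<in> H1"
  shows "A_form \<gamma> w (\<lambda>x. c * u x) = c * A_form \<gamma> w u"
  using A_form_cmult_left[OF assms] by (simp add: A_form_commute)

lemma H1_zero: "(\<lambda>x. 0) \<in> H1"
proof -
  have "expoly 1 0 = (\<lambda>x. 0)" by (rule ext) (simp add: expoly_def)
  then show ?thesis using h1_rep_H1[OF h1_pair_imp_rep[OF h1_pair_expoly[of 1 0]]] by simp
qed

lemma H1_sum_A_form:
  assumes "finite I" "\<And>i. i \<in> I \<Longrightarrow> v i \<in> H1" "w \<in> H1"
  shows "(\<lambda>x. \<Sum>i\<in>I. c i * v i x) \<in> H1 \<and>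
    A_form \<gamma> (\<lambda>x. \<Sum>i\<in>I. c i * v i x) w = (\<Sum>i\<in>I. c i * A_form \<gamma> (v i) w)"
  using assms
proof (induction I rule: finite_induct)
  case empty
  have "A_form \<gamma> (\<lambda>x. 0) w = 0"
    using A_form_cmult_left[OF H1_zero assms(3), of \<gamma> 0] by simp
  then show ?case by (simp add: H1_zero)
next
  case (insert i I)
  then show ?case by (simp add: H1_add H1_cmult A_form_add_left A_form_cmult_left)
qed

lemma A_form_nonneg: "\<gamma> \<ge> 0 \<Longrightarrow> 0 \<le> A_form \<gamma> u u"
  by (simp add: A_form_def L2_inner_self_nonneg)

lemma H1_norm_le_A_form:
  assumes "\<gamma> > 0" shows "min 1 \<gamma> * (H1_norm u)\<^sup>2 \<le> A_form \<gamma> u u"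
proof -
  have "min 1 \<gamma> * (L2_inner (weak_deriv u) (weak_deriv u) + L2_inner u u)
      \<le> 1 * L2_inner (weak_deriv u) (weak_deriv u) + \<gamma> * L2_inner u u"
    unfolding distrib_left using L2_inner_self_nonneg[of u] L2_inner_self_nonneg[of "weak_deriv u"]
    by (intro add_mono mult_right_mono) auto
  then show ?thesis
    by (simp add: H1_norm_def A_form_def L2_inner_self_nonneg)
qed

lemma A_form_le_H1_norm:
  assumes "\<gamma> > 0" shows "A_form \<gamma> u u \<le> max 1 \<gamma> * (H1_norm u)\<^sup>2"
proof -
  have "1 * L2_inner (weak_deriv u) (weak_deriv u) + \<gamma> * L2_inner u u
      \<le> max 1 \<gamma> * (L2_inner (weak_deriv u) (weak_deriv u) + L2_inner u u)"
    unfolding distrib_left using L2_inner_self_nonneg[of u] L2_inner_self_nonneg[of "weak_deriv u"]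
    by (intro add_mono mult_right_mono) auto
  then show ?thesis
    by (simp add: H1_norm_def A_form_def L2_inner_self_nonneg)
qed

lemma expoly_h1_rep: "b > 0 \<Longrightarrow> h1_rep (expoly b p) (expoly b p) (expoly b (pderiv p - smult b p))"
  by (intro h1_pair_imp_rep h1_pair_expoly)

lemma expoly_H1: "b > 0 \<Longrightarrow> expoly b p \<in> H1"
  by (rule h1_rep_H1[OF expoly_h1_rep])

lemma test_function_h1_rep:
  assumes "\<phi> \<in> test_functions" shows "h1_rep \<phi> \<phi> (deriv \<phi>)"
proof (rule h1_pair_imp_rep)
  have "primitive_of \<phi> (deriv \<phi>)"
    by (intro primitive_of_C1 test_function_has_deriv test_function_continuous test_function_deriv assms)
  then show "h1_pair \<phi> (deriv \<phi>)"
    by (simp add: h1_pair_def test_function_L2 test_function_deriv assms)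
qed

lemma L2_inner_diff_swap:
  "L2_sqdist u v = L2_sqdist v u"
  unfolding L2_inner_def by (intro Bochner_Integration.integral_cong refl) (simp add: algebra_simps)

theorem expoly_H10:
  assumes "b > 0" "poly p 0 = 0" shows "expoly b p \<in> H10"
  unfolding H10_def
proof (intro CollectI conjI allI impI expoly_H1 assms(1))
  fix e :: real assume e: "e > 0"
  let ?d = "pderiv p - smult b p"
  show "\<exists>\<phi>\<in>test_functions. H1_norm (\<lambda>x. expoly b p x - \<phi> x) < e"
  proof (rule expoly_test_function_approximation[OF assms])
    fix \<phi> :: "nat \<Rightarrow> real \<Rightarrow> real"
    assume test: "\<And>n. \<phi> n \<in> test_functions"
      and 1: "(\<lambda>n. L2_sqdist (\<phi> n) (expoly b p)) \<longlonglongrightarrow> 0"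
      and 2: "(\<lambda>n. L2_sqdist (deriv (\<phi> n)) (expoly b ?d)) \<longlonglongrightarrow> 0"
    have norm: "H1_norm (\<lambda>x. expoly b p x - \<phi> n x) =
        sqrt (L2_sqdist (deriv (\<phi> n)) (expoly b ?d)
          + L2_sqdist (\<phi> n) (expoly b p))" for n
      using H1_norm_h1_rep[OF h1_rep_diff[OF expoly_h1_rep[OF assms(1), of p] test_function_h1_rep[OF test, of n]]]
      unfolding L2_inner_diff_swap[of "expoly b ?d"] L2_inner_diff_swap[of "expoly b p"] .
    have "(\<lambda>n. H1_norm (\<lambda>x. expoly b p x - \<phi> n x)) \<longlonglongrightarrow> sqrt (0 + 0)"
      unfolding norm by (intro tendsto_real_sqrt tendsto_add 1 2)
    then have "eventually (\<lambda>n. H1_norm (\<lambda>x. expoly b p x - \<phi> n x) < e) sequentially"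
      using e by (intro order_tendstoD(2)) auto
    then show ?thesis using test by (auto simp: eventually_sequentially)
  qed
qed

lemma A_form_expoly: "\<beta> > 0 \<Longrightarrow> A_form \<gamma> (expoly (\<beta> / 2) p) (expoly (\<beta> / 2) q) = energy \<beta> \<gamma> p q"
  by (subst A_form_h1_rep[OF expoly_h1_rep expoly_h1_rep])
    (simp_all add: energy_def dpoly_def L2_inner_expoly)

section \<open>The boundary functions\<close>

lemma S0_eq_expoly: "\<beta> > 0 \<Longrightarrow> \<gamma> > 0 \<Longrightarrow> S0 \<beta> \<gamma> = expoly (sqrt \<gamma>) 1"
  by (rule ext) (simp add: S0_eq_exp expoly_def)

text \<open>
  For \<open>s = sqrt \<gamma>\<close> and \<open>v x = exp (- \<beta> x / 2) p x\<close> the integrand \<open>- s exp (- s x) v' + s\<^sup>2 exp (- s x) v\<close>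
  is the derivative of \<open>- s exp (- s x) v\<close>, which vanishes at 0 and at infinity.
\<close>

lemma A_form_S0:
  assumes "\<beta> > 0" "\<gamma> > 0" "poly p 0 = 0"
  shows "A_form \<gamma> (S0 \<beta> \<gamma>) (expoly (\<beta> / 2) p) = 0"
proof -
  let ?s = "sqrt \<gamma>" and ?a = "\<beta> / 2"
  have s: "?s > 0" "?s * ?s = \<gamma>" using assms by auto
  let ?d = "pderiv p - smult ?a p"
  have "A_form \<gamma> (S0 \<beta> \<gamma>) (expoly ?a p)
      = L2_inner (expoly ?s (pderiv 1 - smult ?s 1)) (expoly ?a ?d) + \<gamma> * L2_inner (expoly ?s 1) (expoly ?a p)"
    unfolding S0_eq_expoly[OF assms(1,2)]
    by (rule A_form_h1_rep[OF expoly_h1_rep expoly_h1_rep]) (use assms s in auto)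
  also have "\<dots> = (LINT x|half_line. expoly (?s + ?a) (smult (- ?s) ?d) x)
      + \<gamma> * (LINT x|half_line. expoly (?s + ?a) p x)"
    by (simp add: L2_inner_def expoly_mult pderiv_1)
  also have "\<dots> = (LINT x|half_line. expoly (?s + ?a) (smult (- ?s) ?d) x + \<gamma> * expoly (?s + ?a) p x)"
    using assms s by (simp add: expoly_integrable add_pos_pos)
  also have "\<dots> = (LINT x|half_line. - ?s * expoly (?s + ?a) (pderiv p - smult (?s + ?a) p) x)"
  proof (intro Bochner_Integration.integral_cong refl)
    fix x
    have "expoly (c + ?a) (smult (- c) ?d) x + (c * c) * expoly (c + ?a) p x
        = - c * expoly (c + ?a) (pderiv p - smult (c + ?a) p) x" for c
      by (simp add: expoly_def algebra_simps)
    from this[of ?s] show "expoly (?s + ?a) (smult (- ?s) ?d) x + \<gamma> * expoly (?s + ?a) p x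
        = - ?s * expoly (?s + ?a) (pderiv p - smult (?s + ?a) p) x"
      unfolding s(2) .
  qed
  also have "\<dots> = 0"
    using expoly_integral_deriv[of "?s + ?a" p] assms s by (simp add: add_pos_pos)
  finally show ?thesis .
qed

lemma triangular_span:
  fixes P :: "nat \<Rightarrow> real poly"
  assumes P: "\<And>k. k \<ge> 1 \<Longrightarrow> degree (P k) \<le> k \<and> coeff (P k) k \<noteq> 0 \<and> poly (P k) 0 = 0"
  shows "degree p \<le> n \<Longrightarrow> poly p 0 = 0 \<Longrightarrow> \<exists>c. p = (\<Sum>k=1..n. smult (c k) (P k))"
proof (induction n arbitrary: p)
  case 0
  then obtain c where "p = [:c:]" by (auto elim: degree_eq_zeroE)
  then show ?case using 0 by simp
next
  case (Suc n)
  define t where "t = coeff p (Suc n) / coeff (P (Suc n)) (Suc n)"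
  let ?q = "p - smult t (P (Suc n))"
  have PS: "degree (P (Suc n)) \<le> Suc n" "coeff (P (Suc n)) (Suc n) \<noteq> 0" "poly (P (Suc n)) 0 = 0"
    using P[of "Suc n"] by auto
  have "degree ?q \<le> n"
  proof (rule degree_le, intro allI impI)
    fix i assume i: "n < i"
    show "coeff ?q i = 0"
    proof (cases "i = Suc n")
      case True then show ?thesis using PS by (simp add: t_def)
    next
      case False
      then show ?thesis using i Suc.prems PS by (simp add: coeff_eq_0)
    qed
  qed
  moreover have "poly ?q 0 = 0" using Suc.prems PS by simp
  ultimately obtain c where c: "?q = (\<Sum>k=1..n. smult (c k) (P k))" using Suc.IH by blast
  have "p = ?q + smult t (P (Suc n))" by simp
  also have "\<dots> = (\<Sum>k=1..n. smult ((c(Suc n := t)) k) (P k)) + smult ((c(Suc n := t)) (Suc n)) (P (Suc n))"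
    unfolding c by simp
  also have "\<dots> = (\<Sum>k=1..Suc n. smult ((c(Suc n := t)) k) (P k))" by simp
  finally show ?case by blast
qed

lemma A_form_S0N:
  assumes \<beta>: "\<beta> > 0" and \<gamma>: "\<gamma> > 0" and p: "degree p \<le> N" "poly p 0 = 0"
  shows "A_form \<gamma> (S0N \<beta> \<gamma> N) (expoly (\<beta> / 2) p) = 0"
proof -
  have "degree (lag_neg1 \<beta> k) \<le> k \<and> coeff (lag_neg1 \<beta> k) k \<noteq> 0 \<and> poly (lag_neg1 \<beta> k) 0 = 0" if "k \<ge> 1" for k
    using that \<beta> degree_lag_neg1 coeff_lag_neg1_top poly_lag_neg1_Suc_0[of \<beta> "k - 1"] by simp
  from triangular_span[OF this p]
  obtain c where c: "p = (\<Sum>k=1..N. smult (c k) (lag_neg1 \<beta> k))" by blast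
  have "energy \<beta> \<gamma> (s0n_poly \<beta> \<gamma> N) p = energy \<beta> \<gamma> p (s0n_poly \<beta> \<gamma> N)"
    by (simp add: energy_def mult.commute)
  also have "\<dots> = (\<Sum>k=1..N. c k * energy \<beta> \<gamma> (lag_neg1 \<beta> k) (s0n_poly \<beta> \<gamma> N))"
    unfolding c by (rule energy_sum_left[OF \<beta>])
  also have "\<dots> = 0"
  proof (rule sum.neutral, intro ballI)
    fix k assume k: "k \<in> {1..N}"
    then have "energy \<beta> \<gamma> (s0n_poly \<beta> \<gamma> N) (lag_neg1 \<beta> (Suc (k - 1))) = 0"
      by (intro energy_s0n_poly_lag_neg1 \<beta> \<gamma>) auto
    then show "c k * energy \<beta> \<gamma> (lag_neg1 \<beta> k) (s0n_poly \<beta> \<gamma> N) = 0"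
      using k by (simp add: energy_def mult.commute)
  qed
  finally show ?thesis by (simp add: S0N_eq_expoly A_form_expoly[OF \<beta>])
qed

section \<open>Expansion in an orthogonal system\<close>

lemma expoly_inject:
  assumes "\<And>x. x \<ge> 0 \<Longrightarrow> expoly b p x = expoly b q x" shows "p = q"
proof -
  have "{0..} \<subseteq> {x. poly (p - q) x = 0}"
    using assms by (auto simp: expoly_def)
  then have "infinite {x. poly (p - q) x = 0}"
    using infinite_Ici infinite_super by blast
  then show ?thesis using poly_roots_finite[of "p - q"] by auto
qed

lemma expoly_L2_inner_pos:
  assumes "b > 0" "p \<noteq> 0" shows "0 < L2_inner (expoly b p) (expoly b p)"
proof (rule ccontr)
  assume "\<not> ?thesis"
  then have "L2_inner (expoly b p) (expoly b p) = 0"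
    using L2_inner_self_nonneg[of "expoly b p"] by linarith
  then have "AE x in half_line. expoly b p x = 0"
    by (rule L2_inner_self_eq_0[OF expoly_L2[OF assms(1)]])
  then have "expoly b p x = 0" if "x \<ge> 0" for x
    by (intro continuous_AE_eq_imp_eq[of "expoly b p" "\<lambda>_. 0"] expoly_continuous that) auto
  then have "p = 0" by (intro expoly_inject[of b]) (simp add: expoly_def)
  then show False using assms by simp
qed

lemma X0_space_expoly: "X0_space \<beta> n = {expoly (\<beta> / 2) p | p. degree p \<le> n \<and> poly p 0 = 0}"
  and X_space_expoly: "X_space \<beta> n = {expoly (\<beta> / 2) p | p. degree p \<le> n}"
  by (simp_all add: X0_space_def X_space_def expoly_def[abs_def])

text \<open>
  The leading coefficient of \<open>S k\<close> is that of the Laguerre function, hence nonzero. This guarantees that the first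
  \<open>n\<close> functions span \<open>X0_space \<beta> n\<close>.
\<close>

lemma sobolev_orthogonal_polynomials:
  assumes "\<beta> > 0" "sobolev_orthogonal \<beta> \<gamma> S \<rho>"
  obtains P where "\<And>k. k \<ge> 1 \<Longrightarrow> S k = expoly (\<beta> / 2) (P k)"
    "\<And>k. k \<ge> 1 \<Longrightarrow> degree (P k) \<le> k \<and> coeff (P k) k \<noteq> 0 \<and> poly (P k) 0 = 0"
proof -
  have "\<exists>p. S k = expoly (\<beta> / 2) p \<and> degree p \<le> k \<and> coeff p k \<noteq> 0 \<and> poly p 0 = 0" if k: "k \<ge> 1" for k
  proof -
    have "S k \<in> X0_space \<beta> k" "(\<lambda>x. S k x - laguerre_fun (-1) \<beta> k x) \<in> X0_space \<beta> (k - 1)"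
      using assms(2) k unfolding sobolev_orthogonal_def by blast+
    then obtain p q where p: "S k = expoly (\<beta> / 2) p" "degree p \<le> k" "poly p 0 = 0"
      and q: "(\<lambda>x. S k x - laguerre_fun (-1) \<beta> k x) = expoly (\<beta> / 2) q" "degree q \<le> k - 1"
      unfolding X0_space_expoly by auto
    have "expoly (\<beta> / 2) p x = expoly (\<beta> / 2) (lag_neg1 \<beta> k + q) x" for x
      using fun_cong[OF q(1), of x] by (simp add: p(1) laguerre_fun_eq_expoly expoly_add)
    then have "p = lag_neg1 \<beta> k + q" by (rule expoly_inject)
    moreover have "coeff q k = 0" using q(2) k by (intro coeff_eq_0) auto
    ultimately have "coeff p k \<noteq> 0" using coeff_lag_neg1_top[of \<beta> k] assms(1) by simp
    then show ?thesis using p by blast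
  qed
  then show ?thesis using that by metis
qed

text \<open>
  The partial sum \<open>T n\<close> is the orthogonal projection of \<open>w\<close> in the energy form, hence its error is at most that of
  any other weighted polynomial of degree at most \<open>n\<close> that vanishes at 0. The density theorem provides one that is close to \<open>w\<close> in
  \<open>H1\<close>, and the energy norm is equivalent to the \<open>H1\<close> norm.
\<close>

theorem orthogonal_expansion:
  fixes P :: "nat \<Rightarrow> real poly"
  assumes \<beta>: "\<beta> > 0" and \<gamma>: "\<gamma> > 0"
    and P: "\<And>k. k \<ge> 1 \<Longrightarrow> degree (P k) \<le> k \<and> coeff (P k) k \<noteq> 0 \<and> poly (P k) 0 = 0"
    and orth: "\<And>k m. k \<ge> 1 \<Longrightarrow> m \<ge> 1 \<Longrightarrow>
      A_form \<gamma> (expoly (\<beta> / 2) (P k)) (expoly (\<beta> / 2) (P m)) = (if k = m then \<rho> k else 0)"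
    and w: "h1_rep w z g" and z0: "z 0 = 0"
    and c: "\<And>k. k \<ge> 1 \<Longrightarrow> c k * \<rho> k = A_form \<gamma> w (expoly (\<beta> / 2) (P k))"
  shows "H1_tendsto (\<lambda>n x. \<Sum>k=1..n. c k * expoly (\<beta> / 2) (P k) x) w"
proof -
  let ?a = "\<beta> / 2"
  let ?S = "\<lambda>k. expoly ?a (P k)"
  define T where "T n x = (\<Sum>k=1..n. c k * ?S k x)" for n x
  let ?E = "\<lambda>n x. T n x - w x" and ?R = "\<lambda>p x. w x - expoly ?a p x"
  have a: "?a > 0" using \<beta> by simp
  have S: "?S k \<in> H1" for k by (rule expoly_H1[OF a])
  have wH1: "w \<in> H1" by (rule h1_rep_H1[OF w])
  have zg: "h1_pair z g" using w by (simp add: h1_rep_def)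
  have T: "T n \<in> H1" "A_form \<gamma> (T n) v = (\<Sum>k=1..n. c k * A_form \<gamma> (?S k) v)" if "v \<in> H1" for n v
    using H1_sum_A_form[of "{1..n}" ?S v c \<gamma>] S that unfolding T_def[abs_def] by auto
  have TH1: "T n \<in> H1" for n by (rule T(1)[OF H1_zero])
  have orthS: "A_form \<gamma> (?E n) (?S m) = 0" if m: "m \<in> {1..n}" for n m
  proof -
    have "A_form \<gamma> (T n) (?S m) = (\<Sum>k=1..n. if k = m then c m * \<rho> m else 0)"
      unfolding T(2)[OF S] using m by (intro sum.cong) (auto simp: orth)
    also have "\<dots> = A_form \<gamma> w (?S m)" using m c[of m] by simp
    finally show ?thesis by (simp add: A_form_diff_left TH1 wH1 S)
  qed
  have orthX: "A_form \<gamma> (?E n) (expoly ?a q) = 0" if q: "degree q \<le> n" "poly q 0 = 0" for n q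
  proof -
    obtain d where d: "q = (\<Sum>k=1..n. smult (d k) (P k))" using triangular_span[OF P q] by blast
    have "expoly ?a q = (\<lambda>x. \<Sum>k\<in>{1..n}. d k * ?S k x)"
      by (rule ext) (simp add: d expoly_sum expoly_smult)
    then have "A_form \<gamma> (expoly ?a q) (?E n)
        = (\<Sum>k\<in>{1..n}. d k * A_form \<gamma> (?S k) (?E n))"
      using H1_sum_A_form[of "{1..n}" ?S "\<lambda>x. T n x - w x" d \<gamma>] S TH1 wH1 by (simp add: H1_diff)
    also have "\<dots> = 0"
      using orthS by (intro sum.neutral) (simp add: A_form_commute[of \<gamma> "?S _"])
    finally show ?thesis by (simp add: A_form_commute)
  qed
  have Tpoly: "\<exists>q. degree q \<le> n \<and> poly q 0 = 0 \<and> T n = expoly ?a q" for n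
  proof (intro exI conjI)
    let ?q = "\<Sum>k=1..n. smult (c k) (P k)"
    show "degree ?q \<le> n"
      by (intro degree_sum_le) (auto intro!: order_trans[OF degree_smult_le] intro: order_trans[OF conjunct1[OF P]])
    show "poly ?q 0 = 0" using P by (simp add: poly_sum)
    show "T n = expoly ?a ?q" by (rule ext) (simp add: T_def expoly_sum expoly_smult)
  qed
  have best: "A_form \<gamma> (?E n) (?E n) \<le> A_form \<gamma> (?R p) (?R p)"
    if p: "degree p \<le> n" "poly p 0 = 0" for n p
  proof -
    obtain q where q: "degree q \<le> n" "poly q 0 = 0" "T n = expoly ?a q" using Tpoly by blast
    let ?D = "?E n" and ?V = "expoly ?a (p - q)"
    have H: "?D \<in> H1" "?V \<in> H1" by (auto intro: H1_diff TH1 wH1 expoly_H1 a)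
    have "degree (p - q) \<le> n" using p(1) q(1) by (rule degree_diff_le)
    then have cross: "A_form \<gamma> ?D ?V = 0" using p q by (intro orthX) auto
    have "A_form \<gamma> (\<lambda>x. ?D x + ?V x) (\<lambda>x. ?D x + ?V x) = A_form \<gamma> ?D ?D + A_form \<gamma> ?V ?V"
      using H cross by (simp add: A_form_add_left A_form_add_right H1_add A_form_commute[of \<gamma> ?V ?D])
    moreover have "(\<lambda>x. ?D x + ?V x) = (\<lambda>x. (- 1) * (w x - expoly ?a p x))"
      by (simp add: q(3) expoly_diff)
    moreover have "A_form \<gamma> (\<lambda>x. (- 1) * (w x - expoly ?a p x)) (\<lambda>x. (- 1) * (w x - expoly ?a p x))
        = A_form \<gamma> (?R p) (?R p)"
      using H1_diff[OF wH1 expoly_H1[OF a, of p]] H1_cmult[OF H1_diff[OF wH1 expoly_H1[OF a, of p]], of "- 1"]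
      by (subst A_form_cmult_left, simp, simp, subst A_form_cmult_right) simp_all
    ultimately show ?thesis using A_form_nonneg[of \<gamma> ?V] \<gamma> by simp
  qed
  have "(\<lambda>n. H1_norm (?E n)) \<longlonglongrightarrow> 0"
  proof (rule LIMSEQ_I)
    fix e :: real assume e: "e > 0"
    \<comment> \<open>the constants of the equivalence of the energy norm and the \<open>H1\<close> norm\<close>
    define \<delta> where "\<delta> = min 1 \<gamma> * e\<^sup>2 / max 1 \<gamma>"
    have \<delta>: "\<delta> > 0" using e \<gamma> by (simp add: \<delta>_def)
    obtain p where p: "poly p 0 = 0" and
      close: "L2_sqdist g (expoly ?a (pderiv p - smult ?a p))
     + L2_sqdist z (expoly ?a p) < \<delta>"
      by (rule h1_pair_expoly_approximation[OF zg z0 a \<delta>])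
    have norm: "(H1_norm (?R p))\<^sup>2 < \<delta>"
      unfolding H1_norm_h1_rep[OF h1_rep_diff[OF w expoly_h1_rep[OF a]]]
      using close by (simp add: L2_inner_self_nonneg)
    have "H1_norm (?E n) < e" if n: "n \<ge> degree p" for n
    proof -
      have "min 1 \<gamma> * (H1_norm (?E n))\<^sup>2 \<le> A_form \<gamma> (?E n) (?E n)"
        by (rule H1_norm_le_A_form[OF \<gamma>])
      also have "\<dots> \<le> A_form \<gamma> (?R p) (?R p)"
        by (rule best[OF n p])
      also have "\<dots> \<le> max 1 \<gamma> * (H1_norm (?R p))\<^sup>2"
        by (rule A_form_le_H1_norm[OF \<gamma>])
      also have "\<dots> < max 1 \<gamma> * \<delta>" using norm by (intro mult_strict_left_mono) auto
      also have "\<dots> = min 1 \<gamma> * e\<^sup>2" by (simp add: \<delta>_def)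
      finally have "(H1_norm (?E n))\<^sup>2 < e\<^sup>2" using \<gamma> by (simp add: mult_less_cancel_left_pos)
      then show ?thesis by (rule power2_less_imp_less) (use e in simp)
    qed
    moreover have "H1_norm v \<ge> 0" for v by (simp add: H1_norm_def L2_inner_self_nonneg)
    ultimately show "\<exists>no. \<forall>n\<ge>no. norm (H1_norm (?E n) - 0) < e"
      by (intro exI[of _ "degree p"]) auto
  qed
  then have "H1_tendsto T w" using TH1 wH1 by (simp add: H1_tendsto_def)
  then show ?thesis unfolding T_def[abs_def] .
qed

theorem theorem2:
  fixes \<beta> \<gamma> \<eta> :: real and N :: nat
    and f :: "(real \<Rightarrow> real) \<Rightarrow> real"
    and u u\<^sub>N :: "real \<Rightarrow> real"
    and S :: "nat \<Rightarrow> real \<Rightarrow> real" and \<rho> uhat :: "nat \<Rightarrow> real"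
  assumes "\<beta> > 0" and "\<gamma> > 0" and "N \<ge> 1"
    and "f \<in> H10_dual"
    and "sobolev_orthogonal \<beta> \<gamma> S \<rho>"
    and "weak_solution \<gamma> \<eta> f u"
    and "spectral_solution \<beta> \<gamma> \<eta> f N u\<^sub>N"
    and "\<And>k. k \<ge> 1 \<Longrightarrow> uhat k = 1 / \<rho> k * A_form \<gamma> u (S k)"
  shows "H1_tendsto (\<lambda>n x. \<Sum>k=1..n. uhat k * S k x) (\<lambda>x. u x - \<eta> * S0 \<beta> \<gamma> x) \<and>
     (\<forall>x\<ge>0. (\<lambda>k. uhat (Suc k) * S (Suc k) x) sums (cont_rep u x - \<eta> * S0 \<beta> \<gamma> x)) \<and>
     (\<forall>x\<ge>0. u\<^sub>N x = \<eta> * S0N \<beta> \<gamma> N x + (\<Sum>k=1..N. uhat k * S k x)) \<and>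
     (\<forall>k\<ge>1. uhat k = f (S k) / \<rho> k)"
proof -
  note \<beta> = assms(1) and \<gamma> = assms(2)
  let ?a = "\<beta> / 2"
  have a: "?a > 0" using \<beta> by simp
  obtain P where SP: "\<And>k. k \<ge> 1 \<Longrightarrow> S k = expoly ?a (P k)"
    and P: "\<And>k. k \<ge> 1 \<Longrightarrow> degree (P k) \<le> k \<and> coeff (P k) k \<noteq> 0 \<and> poly (P k) 0 = 0"
    by (rule sobolev_orthogonal_polynomials[OF \<beta> assms(5)], rule that)
  have orth: "A_form \<gamma> (expoly ?a (P k)) (expoly ?a (P m)) = (if k = m then \<rho> k else 0)"
    if "k \<ge> 1" "m \<ge> 1" for k m
  proof -
    have "A_form \<gamma> (S k) (S m) = (if k = m then \<rho> k else 0)"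
      using assms(5) that unfolding sobolev_orthogonal_def by blast
    then show ?thesis unfolding SP[OF that(1)] SP[OF that(2)] .
  qed
  have \<rho>: "\<rho> k > 0" if k: "k \<ge> 1" for k
  proof -
    have "P k \<noteq> 0" using P[OF k] by auto
    then have "0 < \<gamma> * L2_inner (expoly ?a (P k)) (expoly ?a (P k))"
      using expoly_L2_inner_pos[OF a] \<gamma> by simp
    also have "\<dots> \<le> A_form \<gamma> (expoly ?a (P k)) (expoly ?a (P k))"
      by (simp add: A_form_def L2_inner_self_nonneg)
    also have "\<dots> = \<rho> k" using orth[OF k k] by simp
    finally show ?thesis .
  qed
  have u: "u \<in> H1" "cont_rep u 0 = \<eta>" "\<And>v. v \<in> H10 \<Longrightarrow> A_form \<gamma> u v = f v"
    using assms(6) unfolding weak_solution_def by blast+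
  have fS: "A_form \<gamma> u (expoly ?a (P k)) = f (S k)" if "k \<ge> 1" for k
    using u(3)[OF expoly_H10[OF a]] P[OF that] SP[OF that] by simp
  have uhat: "uhat k * \<rho> k = A_form \<gamma> u (expoly ?a (P k))" if "k \<ge> 1" for k
    using assms(8)[OF that] \<rho>[OF that] SP[OF that] by simp
  have coeffs: "uhat k = f (S k) / \<rho> k" if "k \<ge> 1" for k
    using uhat[OF that] fS[OF that] \<rho>[OF that] by (simp add: field_simps)

  obtain z g where zg: "h1_rep u z g" using H1_imp_h1_rep[OF u(1)] by blast
  define w where "w x = u x - \<eta> * S0 \<beta> \<gamma> x" for x
  have s: "sqrt \<gamma> > 0" using \<gamma> by simp
  note S0 = S0_eq_expoly[OF \<beta> \<gamma>]
  have S0H1: "S0 \<beta> \<gamma> \<in> H1" unfolding S0 by (rule expoly_H1[OF s])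
  define z' where "z' x = z x - \<eta> * S0 \<beta> \<gamma> x" for x
  obtain g' where w: "h1_rep w z' g'"
    using h1_rep_diff[OF zg h1_rep_cmult[OF expoly_h1_rep[OF s, of 1], of \<eta>]]
    unfolding S0[symmetric] w_def[abs_def] z'_def[abs_def] by blast
  have zu: "cont_rep u x = z x" if "x \<ge> 0" for x by (rule h1_rep_cont_rep[OF zg that])
  have z'0: "z' 0 = 0" using zu[of 0] u(2) by (simp add: z'_def S0 expoly_def)
  have wS: "uhat k * \<rho> k = A_form \<gamma> w (expoly ?a (P k))" if k: "k \<ge> 1" for k
  proof -
    have "A_form \<gamma> w (expoly ?a (P k))
        = A_form \<gamma> u (expoly ?a (P k)) - \<eta> * A_form \<gamma> (S0 \<beta> \<gamma>) (expoly ?a (P k))"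
      unfolding w_def[abs_def]
      by (simp add: A_form_diff_left A_form_cmult_left H1_cmult u(1) S0H1 expoly_H1[OF a])
    then show ?thesis using A_form_S0[OF \<beta> \<gamma>] P[OF k] uhat[OF k] by simp
  qed
  have sum_eq: "(\<Sum>k=1..n. uhat k * S k x) = (\<Sum>k=1..n. uhat k * expoly ?a (P k) x)" for n x
    by (intro sum.cong) (auto simp: SP)
  have conv: "H1_tendsto (\<lambda>n x. \<Sum>k=1..n. uhat k * S k x) w"
    unfolding sum_eq by (rule orthogonal_expansion[OF \<beta> \<gamma> P orth w z'0 wS])

  have pointwise: "(\<lambda>k. uhat (Suc k) * S (Suc k) x) sums (cont_rep u x - \<eta> * S0 \<beta> \<gamma> x)" if x: "x \<ge> 0" for x
  proof -
    let ?T = "\<lambda>n x. \<Sum>k=1..n. uhat k * S k x"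
    let ?q = "\<lambda>n. \<Sum>k=1..n. smult (uhat k) (P k)"
    have T: "?T n = expoly ?a (?q n)" for n
      unfolding sum_eq by (rule ext) (simp add: expoly_sum expoly_smult)
    have rep: "h1_rep (\<lambda>y. ?T n y - w y) (\<lambda>y. ?T n y - z' y)
        (\<lambda>y. expoly ?a (pderiv (?q n) - smult ?a (?q n)) y - g' y)" for n
      unfolding fun_cong[OF T] by (rule h1_rep_diff[OF expoly_h1_rep[OF a] w])
    have bound: "\<bar>?T n x - z' x\<bar> \<le> H1_norm (\<lambda>y. ?T n y - w y)" for n
    proof -
      have "?T n 0 - z' 0 = 0"
        unfolding fun_cong[OF T] using P by (simp add: z'0 expoly_def poly_sum)
      then have le: "(?T n x - z' x)\<^sup>2 \<le> (H1_norm (\<lambda>y. ?T n y - w y))\<^sup>2"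
        using h1_pair_pointwise_bound[of "\<lambda>y. ?T n y - z' y", OF _ _ x] rep[of n]
        unfolding H1_norm_h1_rep[OF rep] by (simp add: h1_rep_def L2_inner_self_nonneg)
      have "H1_norm (\<lambda>y. ?T n y - w y) \<ge> 0" by (simp add: H1_norm_def L2_inner_self_nonneg)
      from power2_le_iff_abs_le[OF this, THEN iffD1, OF le] show ?thesis .
    qed
    have "(\<lambda>n. ?T n x - z' x) \<longlonglongrightarrow> 0"
    proof (rule Lim_null_comparison[OF always_eventually])
      show "\<forall>n. norm (?T n x - z' x) \<le> H1_norm (\<lambda>y. ?T n y - w y)"
        unfolding real_norm_def using bound by blast
      show "(\<lambda>n. H1_norm (\<lambda>y. ?T n y - w y)) \<longlonglongrightarrow> 0"
        using conv unfolding H1_tendsto_def by (elim conjE)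
    qed
    then have "(\<lambda>n. ?T n x) \<longlonglongrightarrow> cont_rep u x - \<eta> * S0 \<beta> \<gamma> x"
      by (simp add: LIM_zero_iff z'_def zu[OF x])
    moreover have "?T n x = (\<Sum>k<n. uhat (Suc k) * S (Suc k) x)" for n
      by (simp add: sum.atLeast1_atMost_eq)
    ultimately show ?thesis by (simp add: sums_def)
  qed

  have numeric: "u\<^sub>N x = \<eta> * S0N \<beta> \<gamma> N x + (\<Sum>k=1..N. uhat k * S k x)" for x
  proof -
    have uN: "u\<^sub>N \<in> X_space \<beta> N" "u\<^sub>N 0 = \<eta>" "\<And>v. v \<in> X0_space \<beta> N \<Longrightarrow> A_form \<gamma> u\<^sub>N v = f v"
      using assms(7) unfolding spectral_solution_def by blast+
    obtain p where p: "u\<^sub>N = expoly ?a p" "degree p \<le> N" using uN(1) unfolding X_space_expoly by auto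
    define q where "q = p - smult \<eta> (s0n_poly \<beta> \<gamma> N)"
    have "poly q 0 = 0"
      using uN(2) by (simp add: q_def p(1) expoly_def poly_s0n_poly_0[OF \<beta> \<gamma>])
    moreover have "degree q \<le> N"
      unfolding q_def by (intro degree_diff_le p(2) order_trans[OF degree_smult_le] degree_s0n_poly)
    ultimately obtain d where d: "q = (\<Sum>k=1..N. smult (d k) (P k))" using triangular_span[OF P] by blast
    have uN_eq: "u\<^sub>N x = \<eta> * S0N \<beta> \<gamma> N x + expoly ?a q x" for x
      by (simp add: q_def p(1) S0N_eq_expoly expoly_diff expoly_smult)
    have q_sum: "expoly ?a q = (\<lambda>x. \<Sum>k\<in>{1..N}. d k * expoly ?a (P k) x)"
      by (rule ext) (simp add: d expoly_sum expoly_smult)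
    have "d m = uhat m" if m: "m \<in> {1..N}" for m
    proof -
      have m1: "m \<ge> 1" using m by simp
      have deg: "degree (P m) \<le> N" "poly (P m) 0 = 0" using P[OF m1] m by auto
      have "f (S m) = A_form \<gamma> u\<^sub>N (expoly ?a (P m))"
      proof -
        have "expoly ?a (P m) \<in> X0_space \<beta> N" unfolding X0_space_expoly using deg by blast
        then show ?thesis using uN(3) SP[OF m1] by simp
      qed
      also have "\<dots> = \<eta> * A_form \<gamma> (S0N \<beta> \<gamma> N) (expoly ?a (P m)) + A_form \<gamma> (expoly ?a q) (expoly ?a (P m))"
        unfolding uN_eq[abs_def] S0N_eq_expoly
        by (simp add: A_form_add_left A_form_cmult_left H1_cmult expoly_H1[OF a])
      also have "\<dots> = A_form \<gamma> (expoly ?a q) (expoly ?a (P m))"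
        by (simp add: A_form_S0N[OF \<beta> \<gamma> deg])
      also have "\<dots> = (\<Sum>k\<in>{1..N}. d k * A_form \<gamma> (expoly ?a (P k)) (expoly ?a (P m)))"
        unfolding q_sum by (rule H1_sum_A_form[THEN conjunct2]) (simp_all add: expoly_H1[OF a])
      also have "\<dots> = (\<Sum>k\<in>{1..N}. if k = m then d m * \<rho> m else 0)"
        using m1 by (intro sum.cong) (auto simp: orth)
      also have "\<dots> = d m * \<rho> m" using m by simp
      finally show ?thesis using coeffs[OF m1] \<rho>[OF m1] by (simp add: field_simps)
    qed
    then have "expoly ?a q x = (\<Sum>k=1..N. uhat k * S k x)"
      unfolding q_sum sum_eq by (intro sum.cong) auto
    then show ?thesis using uN_eq by simp
  qed
  show ?thesis
    using conv[unfolded w_def[abs_def]] pointwise numeric coeffs by (intro conjI allI impI)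
qed

end
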